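(* If $d\in\Delta^\times$ has $\mathrm{nr}(d)=1$ (or, more generally, if $d\in\Delta^\times$ has a level $n$ and $\mathrm{nr}(d)\equiv1\bmod\pi^{\Phi(n)+1}A$), then $d$ has level $n\ge p^r-1$.
   Context: Let $p$ be an odd prime, $r\ge1$, $s\ge1$ integers, $F/\mathbb Q_p$ a finite unramified extension with ring of integers $\mathfrak O$. Fix primitive $p^m$-th roots of unity $\zeta_m$ with $\zeta_0=1$, $\zeta_m^p=\zeta_{m-1}$; put $\mathfrak O_m=\mathfrak O[\zeta_m]$, $\pi_m=1-\zeta_m$, $\Pi=\pi_{r+s}$, $\pi=\pi_r$, $A=\mathfrak O_r[[T]]$, $B=\mathfrak O_{r+s}[[T]]$, with fraction fields $\mathfrak q(A),\mathfrak q(B)$. Let $g$ be the generator of the cyclic group $\mathrm{Gal}(\mathfrak q(B)/\mathfrak q(A))$ (of order $p^s$) fixing $\mathfrak q(A)$ with $\zeta_{r+s}\mapsto\zeta_{r+s}^{1+p^r}$. $D=\bigoplus_{j=0}^{p^s-1}\mathfrak q(B)u^j$ with $ub={}^gb\,u$ and $u^{p^s}=1+T$ is a division algebra with centre $\mathfrak q(A)$, $\Delta=\bigoplus_{j=0}^{p^s-1}Bu^j$ is an $A$-order in $D$ with $\Pi\Delta=\Delta\Pi$, and $\mathrm{nr}:D\to\mathfrak q(A)$ is the reduced norm. The level of $d\in1+\Pi\Delta$ is $\max\{k\ge1:d\in1+\Pi^k\Delta\}$ (understood as $\infty$ for $d=1$); saying that $d$ has a level includes that $d\in1+\Pi\Delta$.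 For $n\ge1$, $\Phi(n)=\min_{k\ge0}\big(k\phi(p^r)+\lfloor n/p^k\rfloor\big)$, with $\phi$ Euler's function. *)

theory Defs
  imports
    "HOL-Computational_Algebra.Polynomial"
    "HOL-Computational_Algebra.Formal_Laurent_Series"
    "HOL-Number_Theory.Totient"
    "HOL-Library.Extended_Nat"
    "HOL-Algebra.Ring"
    "Jordan_Normal_Form.Determinant"
begin

definition is_subfield :: "'a::field set \<Rightarrow> bool" where
  "is_subfield K \<longleftrightarrow> 0 \<in> K \<and> 1 \<in> K \<and>
     (\<forall>x\<in>K. \<forall>y\<in>K. x + y \<in> K \<and> x * y \<in> K) \<and>
     (\<forall>x\<in>K. - x \<in> K \<and> inverse x \<in> K)"

definition finite_extension :: "'a::field set \<Rightarrow> 'a set \<Rightarrow> bool" where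
  "finite_extension K F \<longleftrightarrow> is_subfield K \<and> is_subfield F \<and> K \<subseteq> F \<and>
     (\<exists>S\<subseteq>F. finite S \<and> (\<forall>x\<in>F. \<exists>c. (\<forall>b\<in>S. c b \<in> K) \<and> x = (\<Sum>b\<in>S. c b * b)))"

definition integral_closure :: "'a::field set \<Rightarrow> 'a set \<Rightarrow> 'a set" where
  "integral_closure R F =
     {x \<in> F. \<exists>f. lead_coeff f = 1 \<and> (\<forall>i. poly.coeff f i \<in> R) \<and> poly f x = 0}"

definition adjoin :: "'a::field set \<Rightarrow> 'a \<Rightarrow> 'a set" where
  "adjoin R z = {poly f z | f. \<forall>i. poly.coeff f i \<in> R}"

definition power_series :: "'a::field set \<Rightarrow> 'a fls set" where
  "power_series R = fps_to_fls ` {f. \<forall>n. fps_nth f n \<in> R}"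

definition fraction_field :: "'a::field set \<Rightarrow> 'a set" where
  "fraction_field R = {a / b | a b. a \<in> R \<and> b \<in> R \<and> b \<noteq> 0}"

definition padic_abs :: "nat \<Rightarrow> rat \<Rightarrow> real" where
  "padic_abs p x = (if x = 0 then 0 else
     (case quotient_of x of (a, b) \<Rightarrow>
        real p powi (int (multiplicity (int p) b) - int (multiplicity (int p) a))))"

text \<open>All fields of the arithmetic setup are subfields of one ambient field, the type \<open>'a\<close>
  (for instance an algebraic closure of the $p$-adic numbers).  The $p$-adic numbers are
  the completion of the rationals: a complete valued subfield in which the rationals
  are dense and on which the absolute value \<open>v\<close> extends the $p$-adic one.  Values of \<open>v\<close>
  outside \<open>Qp\<close> are irrelevant.\<close>

locale padic_numbers =
  fixes p :: nat and v :: "'a::field_char_0 \<Rightarrow> real" and Qp :: "'a set"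
  assumes prime_p: "prime p"
    and subfield_Qp: "is_subfield Qp"
    and v_zero_iff: "\<And>x. x \<in> Qp \<Longrightarrow> v x = 0 \<longleftrightarrow> x = 0"
    and v_nonneg: "\<And>x. x \<in> Qp \<Longrightarrow> 0 \<le> v x"
    and v_mult: "\<And>x y. x \<in> Qp \<Longrightarrow> y \<in> Qp \<Longrightarrow> v (x * y) = v x * v y"
    and v_add: "\<And>x y. x \<in> Qp \<Longrightarrow> y \<in> Qp \<Longrightarrow> v (x + y) \<le> max (v x) (v y)"
    and v_rat: "\<And>q. v (of_rat q) = padic_abs p q"
    and rat_dense: "\<And>x e. x \<in> Qp \<Longrightarrow> 0 < e \<Longrightarrow> \<exists>q. v (x - of_rat q) < e"
    and v_complete: "\<And>X. range X \<subseteq> Qp \<Longrightarrow>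
          (\<forall>e>0. \<exists>M. \<forall>m\<ge>M. \<forall>n\<ge>M. v (X m - X n) < e) \<Longrightarrow>
          \<exists>l\<in>Qp. (\<lambda>n. v (X n - l)) \<longlonglongrightarrow> 0"
begin

definition Zp :: "'a set" where
  "Zp = {x \<in> Qp. v x \<le> 1}"

end

text \<open>Unramified means that $p$ generates the maximal ideal (the set of non-units) of the
  ring of integers; the residue field extension is separable because the residue field
  of the $p$-adic integers is finite.\<close>

locale unramified_extension = padic_numbers +
  fixes F :: "'a set"
  assumes finite_ext: "finite_extension Qp F"
    and unramified:
      "{x \<in> integral_closure Zp F. \<not> (x \<noteq> 0 \<and> inverse x \<in> integral_closure Zp F)} =
       {of_nat p * y | y. y \<in> integral_closure Zp F}"

locale cyclotomic_tower = unramified_extension +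
  fixes r s :: nat and \<zeta> :: "nat \<Rightarrow> 'a"
  assumes odd_p: "odd p"
    and r_pos: "1 \<le> r"
    and s_pos: "1 \<le> s"
    and zeta_primitive: "\<And>m k. \<zeta> m ^ k = 1 \<longleftrightarrow> p ^ m dvd k"
    and zeta_0: "\<zeta> 0 = 1"
    and zeta_Suc: "\<And>m. \<zeta> (Suc m) ^ p = \<zeta> m"
begin

definition cyc_ints :: "nat \<Rightarrow> 'a set" where
  "cyc_ints m = adjoin (integral_closure Zp F) (\<zeta> m)"

text \<open>\<open>A\<close>, \<open>B\<close> and their fraction fields are taken inside the field of Laurent series over
  the ambient field.\<close>

definition A :: "'a fls set" where "A = power_series (cyc_ints r)"
definition B :: "'a fls set" where "B = power_series (cyc_ints (r + s))"
definition qA :: "'a fls set" where "qA = fraction_field A"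
definition qB :: "'a fls set" where "qB = fraction_field B"

definition pi_r :: "'a fls" where "pi_r = fls_const (1 - \<zeta> r)"
definition Pi :: "'a fls" where "Pi = fls_const (1 - \<zeta> (r + s))"

definition \<Phi> :: "nat \<Rightarrow> nat" where
  "\<Phi> n = (LEAST m. \<exists>k. m = k * totient (p ^ r) + n div p ^ k)"

end

text \<open>The automorphism \<open>g\<close> is determined on \<open>qB\<close> by these conditions; its values outside
  \<open>qB\<close> are irrelevant.\<close>

locale cyclic_order = cyclotomic_tower +
  fixes g :: "'a fls \<Rightarrow> 'a fls"
  assumes g_bij: "bij_betw g qB qB"
    and g_add: "\<And>x y. x \<in> qB \<Longrightarrow> y \<in> qB \<Longrightarrow> g (x + y) = g x + g y"
    and g_mult: "\<And>x y. x \<in> qB \<Longrightarrow> y \<in> qB \<Longrightarrow> g (x * y) = g x * g y"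
    and g_fixes: "\<And>x. x \<in> qA \<Longrightarrow> g x = x"
    and g_zeta: "g (fls_const (\<zeta> (r + s))) = fls_const (\<zeta> (r + s) ^ (1 + p ^ r))"
begin

text \<open>The element $\sum_{j<p^s} b_j u^j$ of the cyclic algebra is encoded as its coefficient
  function $j \mapsto b_j$, extended by 0.  The product is the biadditive one with
  $(a u^i)(b u^j) = a\, g^i(b)\, u^{i+j}$, where $u^{p^s} = 1 + T$.\<close>

definition D :: "(nat \<Rightarrow> 'a fls) ring" where
  "D = \<lparr>carrier = {x. (\<forall>j<p ^ s. x j \<in> qB) \<and> (\<forall>j\<ge>p ^ s. x j = 0)},
        mult = (\<lambda>x y k. \<Sum>i<p ^ s. \<Sum>j<p ^ s.
                  if (i + j) mod p ^ s = k
                  then x i * (g ^^ i) (y j) * (if i + j < p ^ s then 1 else 1 + fls_X)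
                  else 0),
        one = (\<lambda>j. if j = 0 then 1 else 0),
        zero = (\<lambda>j. 0),
        add = (\<lambda>x y j. x j + y j)\<rparr>"

definition scalar :: "'a fls \<Rightarrow> nat \<Rightarrow> 'a fls" where
  "scalar b = (\<lambda>j. if j = 0 then b else 0)"

definition Delta :: "(nat \<Rightarrow> 'a fls) set" where
  "Delta = {x. (\<forall>j<p ^ s. x j \<in> B) \<and> (\<forall>j\<ge>p ^ s. x j = 0)}"

definition Delta_units :: "(nat \<Rightarrow> 'a fls) set" where
  "Delta_units = Units (D\<lparr>carrier := Delta\<rparr>)"

text \<open>The reduced norm.  A splitting of the central simple \<open>qA\<close>-algebra \<open>D\<close> (of dimension
  $(p^s)^2$) over the field of Laurent series is a \<open>qA\<close>-algebra homomorphism from \<open>D\<close> to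
  the matrices of size $p^s$; by simplicity and equality of dimensions its linear
  extension to the scalar extension of \<open>D\<close> is then an isomorphism.  The field of Laurent
  series contains the maximal subfield \<open>qB\<close> of \<open>D\<close>, so splittings exist, and by
  Skolem--Noether the determinant does not depend on the one chosen.\<close>

definition splitting :: "((nat \<Rightarrow> 'a fls) \<Rightarrow> 'a fls mat) \<Rightarrow> bool" where
  "splitting \<rho> \<longleftrightarrow> \<rho> \<in> ring_hom D (ring_mat TYPE('a fls) (p ^ s) ()) \<and>
     (\<forall>a\<in>qA. \<rho> (scalar a) = a \<cdot>\<^sub>m 1\<^sub>m (p ^ s))"

definition nr :: "(nat \<Rightarrow> 'a fls) \<Rightarrow> 'a fls" where
  "nr d = det ((SOME \<rho>. splitting \<rho>) d)"

definition one_plus :: "nat \<Rightarrow> (nat \<Rightarrow> 'a fls) set" where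
  "one_plus k = {\<one>\<^bsub>D\<^esub> \<oplus>\<^bsub>D\<^esub> (scalar Pi [^]\<^bsub>D\<^esub> k \<otimes>\<^bsub>D\<^esub> x) | x. x \<in> Delta}"

text \<open>The supremum in \<open>enat\<close> is the maximum if that exists, and \<open>\<infinity>\<close> for $d = 1$.\<close>

definition has_level :: "(nat \<Rightarrow> 'a fls) \<Rightarrow> enat \<Rightarrow> bool" where
  "has_level d n \<longleftrightarrow> d \<in> one_plus 1 \<and> n = Sup {enat k | k. 1 \<le> k \<and> d \<in> one_plus k}"

end

end

theory Submission
  imports Defs "Jordan_Normal_Form.Char_Poly"
begin

text \<open>Write $N = p^s$ and $d = 1 + \Pi^n x$ with $x \in \Delta$ and $0 \le n < p^r - 1$.  The
  reduced norm is the determinant of right multiplication by $d$ on the left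
  $\mathfrak q(B)$-space $D$ with basis the powers of $u$.  Expand $\det(1 + Y)$ into the terms
  indexed by a set $S$ of indices and a permutation of $S$.  Rotating the indices acts on the terms
  through $g$.  A term of an orbit of length $p^k$, $k \ge 1$, is the norm from $\mathfrak q(B)$ to
  the fixed field of $g^{p^k}$ of a multiple of $\Pi^n$, so that the orbit sum is a trace lying in
  $p^k \pi^{\lfloor n/p^k\rfloor} B$, which is contained in $\pi^{n+1} B$.  The fixed terms are $1$
  and the norms of the $\Pi^n x_j u^j$.  Hence
  $\mathrm{nr}(d) \equiv 1 + \pi^n \sum_j N(x_j) (1 + T)^j$ modulo $\pi^{n+1}$.  Modulo $\Pi$,
  $N(x_j)$ is $x_j^N$, a power series in $T^N$, over which the $(1 + T)^j$ with $j < N$ are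
  independent.  So if $\mathrm{nr}(d) \equiv 1$ modulo $\pi^{n+1}$, then $\Pi$ divides $x$.
  Finally $\Phi(n) = n$ in this range.\<close>

section \<open>Subrings and integral elements\<close>

text \<open>The exponent k * totient (p ^ r) + n div p ^ k, whose minimum is
  \<open>\<Phi> n\<close>, is the power of \<open>pi_r\<close> found in the sum over an orbit of
  length p ^ k: the trace supplies p ^ k and with it the first summand, the power of
  \<open>Pi\<close> supplies the second. For k \<ge> 1 it is at least n + 1 as long as n + 1 < p ^
  r, while at n = p ^ r - 1 the value for k = 1 is n itself, so that orbit sums need no longer
  vanish modulo \<open>pi_r ^ (n + 1)\<close>. This is the origin of the bound p ^ r - 1.

  \<open>nr\<close> uses an unspecified splitting. It is compared with right multiplication
  directly: a common eigenrow of the images of the elements of \<open>B\<close>, moved around by the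
  powers of u, gives an invertible intertwining matrix.

  The arithmetic rests on two facts: the powers of \<zeta> below N generate \<open>B\<close> over
  \<open>A\<close>, and 1 - \<zeta> generates a prime ideal containing p. The ideal is proper
  because p does not become invertible in an integral extension, and prime because unramifiedness
  makes p prime in the base ring, which represents all residues.\<close>

definition is_subring :: "'a::comm_ring_1 set \<Rightarrow> bool" where
  "is_subring R \<longleftrightarrow> 1 \<in> R \<and> (\<forall>x\<in>R. \<forall>y\<in>R. x - y \<in> R \<and> x * y \<in> R)"

context
  fixes R :: "'a::comm_ring_1 set"
  assumes R: "is_subring R"
begin

lemma subring_one: "1 \<in> R" and subring_diff: "x \<in> R \<Longrightarrow> y \<in> R \<Longrightarrow> x - y \<in> R"
  and subring_mult: "x \<in> R \<Longrightarrow> y \<in> R \<Longrightarrow> x * y \<in> R"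
  using R by (auto simp: is_subring_def)

lemma subring_zero: "0 \<in> R" using subring_diff[OF subring_one subring_one] by simp

lemma subring_uminus: "x \<in> R \<Longrightarrow> - x \<in> R" using subring_diff[OF subring_zero] by simp

lemma subring_add: "x \<in> R \<Longrightarrow> y \<in> R \<Longrightarrow> x + y \<in> R"
  using subring_diff[OF _ subring_uminus[of y], of x] by simp

lemma subring_sum: "(\<And>i. i \<in> I \<Longrightarrow> f i \<in> R) \<Longrightarrow> sum f I \<in> R"
  by (induction I rule: infinite_finite_induct) (auto intro: subring_zero subring_add)

lemma subring_prod: "(\<And>i. i \<in> I \<Longrightarrow> f i \<in> R) \<Longrightarrow> prod f I \<in> R"
  by (induction I rule: infinite_finite_induct) (auto intro: subring_one subring_mult)

lemma subring_power: "x \<in> R \<Longrightarrow> x ^ n \<in> R"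
  by (induction n) (auto intro: subring_one subring_mult)

lemma subring_of_nat: "of_nat n \<in> R"
  by (induction n) (auto intro: subring_zero subring_one subring_add)

lemma subring_of_int: "of_int n \<in> R"
  by (cases n rule: int_cases2) (auto intro: subring_of_nat subring_uminus)

lemma subring_det:
  assumes "M \<in> carrier_mat n n" "\<And>i j. i < n \<Longrightarrow> j < n \<Longrightarrow> M $$ (i, j) \<in> R"
  shows "det M \<in> R"
  unfolding det_def'[OF assms(1)]
  by (intro subring_sum subring_mult subring_of_int subring_prod)
     (auto intro!: assms(2) dest: permutes_in_image)

lemma subring_polys: "is_subring {f. \<forall>i. poly.coeff f i \<in> R}"
  unfolding is_subring_def
  by (auto simp: coeff_mult coeff_pCons subring_zero subring_one split: nat.split
      intro!: subring_diff subring_sum subring_mult)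

lemma subring_poly: "(\<And>i. poly.coeff f i \<in> R) \<Longrightarrow> x \<in> R \<Longrightarrow> poly f x \<in> R"
  unfolding poly_altdef by (intro subring_sum subring_mult subring_power)

end

text \<open>The characteristic matrix has its entries in the ring of polynomials over
  \<open>R\<close>, and a determinant stays in any subring that contains the entries.\<close>

lemma char_poly_coeff_subring:
  fixes R :: "'a::comm_ring_1 set"
  assumes R: "is_subring R"
    and M: "M \<in> carrier_mat n n" "\<And>i j. i < n \<Longrightarrow> j < n \<Longrightarrow> M $$ (i, j) \<in> R"
  shows "poly.coeff (char_poly M) k \<in> R"
proof -
  have "char_poly M \<in> {f. \<forall>i. poly.coeff f i \<in> R}"
    unfolding char_poly_defs using M
    by (intro subring_det[OF subring_polys[OF R], where n = n])
       (auto simp: R subring_zero subring_one subring_uminus coeff_pCons split: nat.splits)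
  thus ?thesis by simp
qed

definition rspan :: "'a::comm_ring_1 set \<Rightarrow> 'a set \<Rightarrow> 'a set" where
  "rspan R S = {\<Sum>b\<in>S. c b * b | c. \<forall>b\<in>S. c b \<in> R}"

definition integral_over :: "'a::field set \<Rightarrow> 'a \<Rightarrow> bool" where
  "integral_over R z \<longleftrightarrow> (\<exists>f. lead_coeff f = 1 \<and> (\<forall>i. poly.coeff f i \<in> R) \<and> poly f z = 0)"

context
  fixes R S :: "'a::comm_ring_1 set"
  assumes R: "is_subring R" and S: "finite S"
begin

lemma rspan_sum: "(\<And>b. b \<in> S \<Longrightarrow> c b \<in> R) \<Longrightarrow> (\<Sum>b\<in>S. c b * b) \<in> rspan R S"
  unfolding rspan_def by blast

lemma rspan_base: assumes "b \<in> S" shows "b \<in> rspan R S"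
proof -
  have "(\<Sum>x\<in>S. (if x = b then 1 else 0) * x) = b"
    using S assms by (simp add: if_distrib[of "\<lambda>x. x * _"] sum.delta cong: if_cong)
  thus ?thesis
    using rspan_sum[of "\<lambda>x. if x = b then 1 else 0"] R by (auto simp: subring_one subring_zero)
qed

lemma rspan_diff: assumes "x \<in> rspan R S" "y \<in> rspan R S" shows "x - y \<in> rspan R S"
proof -
  obtain c e where "\<forall>b\<in>S. c b \<in> R" "x = (\<Sum>b\<in>S. c b * b)" "\<forall>b\<in>S. e b \<in> R" "y = (\<Sum>b\<in>S. e b * b)"
    using assms unfolding rspan_def by auto
  thus ?thesis using rspan_sum[of "\<lambda>b. c b - e b"] R
    by (simp add: subring_diff sum_subtractf left_diff_distrib)
qed

lemma rspan_smult: assumes "a \<in> R" "x \<in> rspan R S" shows "a * x \<in> rspan R S"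
proof -
  obtain c where "\<forall>b\<in>S. c b \<in> R" "x = (\<Sum>b\<in>S. c b * b)"
    using assms unfolding rspan_def by auto
  thus ?thesis using rspan_sum[of "\<lambda>b. a * c b"] R assms(1)
    by (simp add: subring_mult sum_distrib_left mult.assoc)
qed

lemma rspan_zero: "0 \<in> rspan R S"
  using rspan_sum[of "\<lambda>_. 0"] R by (simp add: subring_zero)

lemma rspan_add: assumes "x \<in> rspan R S" "y \<in> rspan R S" shows "x + y \<in> rspan R S"
  using rspan_diff[OF assms(1) rspan_diff[OF rspan_zero assms(2)]] by simp

lemma rspan_setsum: "(\<And>i. i \<in> I \<Longrightarrow> f i \<in> rspan R S) \<Longrightarrow> sum f I \<in> rspan R S"
  by (induction I rule: infinite_finite_induct) (auto intro: rspan_zero rspan_add)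

lemma rspan_mult_stable:
  assumes "\<And>b. b \<in> S \<Longrightarrow> z * b \<in> rspan R S" "x \<in> rspan R S"
  shows "z * x \<in> rspan R S"
proof -
  obtain c where c: "\<forall>b\<in>S. c b \<in> R" "x = (\<Sum>b\<in>S. c b * b)"
    using assms unfolding rspan_def by auto
  have "z * x = (\<Sum>b\<in>S. c b * (z * b))" by (simp add: c sum_distrib_left mult_ac)
  thus ?thesis using c assms(1) by (simp add: rspan_setsum rspan_smult)
qed

end

text \<open>Multiplication by \<open>z\<close> on the generators \<open>S\<close> is given by a
  matrix over \<open>R\<close> that has the column of generators as an eigenvector. This column is
  nonzero because \<open>S\<close> contains 1, so \<open>z\<close> is a root of the monic
  characteristic polynomial.\<close>

lemma integral_over_if_rspan_stable:
  fixes R S :: "'a::field set"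
  assumes R: "is_subring R" and S: "finite S" "1 \<in> S"
    and stable: "\<And>b. b \<in> S \<Longrightarrow> z * b \<in> rspan R S"
  shows "integral_over R z"
proof -
  define n where "n = card S"
  obtain e where e: "bij_betw e {0..<n} S"
    using ex_bij_betw_nat_finite[OF S(1)] n_def by auto
  have "\<forall>i\<in>{0..<n}. \<exists>c. (\<forall>b\<in>S. c b \<in> R) \<and> z * e i = (\<Sum>b\<in>S. c b * b)"
    using stable bij_betwE[OF e] unfolding rspan_def by blast
  then obtain C where C: "\<And>i b. i < n \<Longrightarrow> b \<in> S \<Longrightarrow> C i b \<in> R"
     "\<And>i. i < n \<Longrightarrow> z * e i = (\<Sum>b\<in>S. C i b * b)"
    by (metis atLeastLessThan_iff bot_nat_0.extremum)
  define M where "M = mat n n (\<lambda>(i, j). C i (e j))"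
  have M: "M \<in> carrier_mat n n" by (simp add: M_def)
  have "M *\<^sub>v vec n e = z \<cdot>\<^sub>v vec n e"
  proof (rule eq_vecI)
    fix i assume i: "i < dim_vec (z \<cdot>\<^sub>v vec n e)"
    hence "(M *\<^sub>v vec n e) $ i = (\<Sum>j = 0..<n. C i (e j) * e j)"
      by (simp add: M_def scalar_prod_def)
    also have "\<dots> = (\<Sum>b\<in>S. C i b * b)" by (rule sum.reindex_bij_betw[OF e])
    finally show "(M *\<^sub>v vec n e) $ i = (z \<cdot>\<^sub>v vec n e) $ i" using C(2) i by simp
  qed (simp add: M_def)
  moreover have "vec n e \<noteq> 0\<^sub>v n"
  proof
    assume z: "vec n e = 0\<^sub>v n"
    obtain i where "i < n" "e i = 1" using e S(2) by (force simp: bij_betw_def image_iff)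
    thus False using z by (metis index_vec index_zero_vec(1) zero_neq_one)
  qed
  ultimately have "eigenvalue M z"
    unfolding eigenvalue_def eigenvector_def using M by (intro exI[of _ "vec n e"]) auto
  hence "poly (char_poly M) z = 0" using eigenvalue_root_char_poly[OF M] by simp
  moreover have "poly.coeff (char_poly M) k \<in> R" for k
    using C(1) bij_betwE[OF e] by (intro char_poly_coeff_subring[OF R M]) (auto simp: M_def)
  ultimately show ?thesis
    unfolding integral_over_def using degree_monic_char_poly[OF M] by metis
qed

lemma integral_over_power:
  fixes R :: "'a::field set"
  assumes "integral_over R x"
  obtains n c where "n > 0" "\<And>i. c i \<in> R" "x ^ n = - (\<Sum>i<n. c i * x ^ i)"
proof -
  obtain f where f: "lead_coeff f = 1" "\<And>i. poly.coeff f i \<in> R" "poly f x = 0"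
    using assms unfolding integral_over_def by auto
  have "degree f > 0"
  proof (rule ccontr)
    assume "\<not> 0 < degree f"
    then obtain a where "f = [:a:]" by (metis degree_eq_zeroE gr0I)
    thus False using f by simp
  qed
  moreover have "x ^ degree f = - (\<Sum>i<degree f. poly.coeff f i * x ^ i)"
    using f(1,3) by (simp add: poly_altdef lessThan_Suc_atMost[symmetric] eq_neg_iff_add_eq_0 add.commute)
  ultimately show ?thesis using f(2) that by blast
qed

text \<open>The monomials x ^ i * y ^ j below the two degrees span an \<open>R\<close>-module that
  is stable under \<open>x\<close> and \<open>y\<close>, hence under their difference and
  product.\<close>

lemma integral_over_diff_mult:
  fixes R :: "'a::field set"
  assumes R: "is_subring R" and "integral_over R x" "integral_over R y"
  shows "integral_over R (x - y)" "integral_over R (x * y)"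
proof -
  obtain m c where m: "m > 0" "\<And>i. c i \<in> R" "x ^ m = - (\<Sum>i<m. c i * x ^ i)"
    using integral_over_power assms by metis
  obtain n e where n: "n > 0" "\<And>i. e i \<in> R" "y ^ n = - (\<Sum>i<n. e i * y ^ i)"
    using integral_over_power assms by metis
  define S where "S = (\<lambda>(i, j). x ^ i * y ^ j) ` ({..<m} \<times> {..<n})"
  have S: "finite S" by (simp add: S_def)
  have mem: "i < m \<Longrightarrow> j < n \<Longrightarrow> x ^ i * y ^ j \<in> rspan R S" for i j
    by (intro rspan_base R S) (auto simp: S_def)
  have neg: "- u \<in> rspan R S" if "u \<in> rspan R S" for u
    using rspan_diff[OF R S rspan_zero[OF R S] that] by simp
  have x: "x * b \<in> rspan R S" if "b \<in> S" for b
  proof -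
    obtain i j where b: "b = x ^ i * y ^ j" "i < m" "j < n" using \<open>b \<in> S\<close> by (auto simp: S_def)
    show ?thesis
    proof (cases "Suc i < m")
      case True
      thus ?thesis using mem[of "Suc i" j] b by (simp add: mult.assoc)
    next
      case False
      hence "x * b = x ^ m * y ^ j" using b by (metis Suc_lessI mult.assoc power_Suc)
      also have "\<dots> = - (\<Sum>i<m. c i * (x ^ i * y ^ j))"
        by (simp add: m(3) sum_distrib_right mult.assoc)
      finally show ?thesis using b m(2) by (auto intro!: neg rspan_setsum rspan_smult R S mem)
    qed
  qed
  have y: "y * b \<in> rspan R S" if "b \<in> S" for b
  proof -
    obtain i j where b: "b = x ^ i * y ^ j" "i < m" "j < n" using \<open>b \<in> S\<close> by (auto simp: S_def)
    show ?thesis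
    proof (cases "Suc j < n")
      case True
      thus ?thesis using mem[of i "Suc j"] b by (simp add: mult_ac)
    next
      case False
      hence "Suc j = n" using b by simp
      hence "y * b = x ^ i * y ^ n" using b by (auto simp: mult_ac)
      also have "\<dots> = - (\<Sum>j<n. e j * (x ^ i * y ^ j))"
        by (simp add: n(3) sum_distrib_left mult_ac)
      finally show ?thesis using b n(2) by (auto intro!: neg rspan_setsum rspan_smult R S mem)
    qed
  qed
  have one: "1 \<in> S" unfolding S_def using m(1) n(1) by (intro image_eqI[of _ _ "(0, 0)"]) auto
  have "(x - y) * b \<in> rspan R S" if "b \<in> S" for b
    unfolding left_diff_distrib using that by (intro rspan_diff[OF R S] x y)
  thus "integral_over R (x - y)" by (rule integral_over_if_rspan_stable[OF R S one])
  have "x * y * b \<in> rspan R S" if "b \<in> S" for b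
    unfolding mult.assoc by (rule rspan_mult_stable[OF R S x y[OF that]])
  thus "integral_over R (x * y)" by (rule integral_over_if_rspan_stable[OF R S one])
qed

lemma integral_over_base: "is_subring R \<Longrightarrow> x \<in> R \<Longrightarrow> integral_over R x"
  unfolding integral_over_def
  by (intro exI[of _ "[:-x, 1:]"])
     (auto simp: coeff_pCons subring_one subring_zero subring_uminus split: nat.split)

lemma is_subring_integral_closure:
  assumes "is_subring R" "is_subring F"
  shows "is_subring (integral_closure R F)"
  using assms integral_over_diff_mult[OF assms(1)] integral_over_base[OF assms(1), of 1]
  unfolding is_subring_def integral_closure_def integral_over_def by auto

text \<open>The powers of \<open>z\<close> below \<open>n\<close> span a stable module, since
  exponents can be reduced modulo \<open>n\<close>. This makes the cyclotomic integers integral over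
  the unramified base ring.\<close>

lemma integral_over_adjoin_root_of_unity:
  fixes R :: "'a::field set"
  assumes R: "is_subring R" and z: "z ^ n = 1" "n > 0" and x: "x \<in> adjoin R z"
  shows "integral_over R x"
proof (rule integral_over_if_rspan_stable[OF R])
  let ?S = "(\<lambda>i. z ^ i) ` {..<n}"
  show "finite ?S" by simp
  show "1 \<in> ?S" using z(2) by force
  have pow: "z ^ i \<in> rspan R ?S" for i
  proof -
    have "z ^ i = z ^ (i mod n)"
      by (metis mult_1 power_add power_mult power_one mult_div_mod_eq z(1))
    thus ?thesis using z(2) by (auto intro!: rspan_base R)
  qed
  fix b assume "b \<in> ?S"
  then obtain i where b: "b = z ^ i" by auto
  obtain f where f: "x = poly f z" "\<And>i. poly.coeff f i \<in> R" using x by (auto simp: adjoin_def)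
  have "x * b = (\<Sum>j\<le>degree f. poly.coeff f j * z ^ (j + i))"
    by (simp add: f(1) b poly_altdef sum_distrib_right power_add mult.assoc)
  also have "\<dots> \<in> rspan R ?S" by (intro rspan_setsum rspan_smult R pow f(2)) auto
  finally show "x * b \<in> rspan R ?S" .
qed

lemma is_subring_adjoin: "is_subring R \<Longrightarrow> is_subring (adjoin R z)"
  unfolding is_subring_def[of "adjoin R z"]
proof (intro conjI ballI)
  assume R: "is_subring R"
  let ?P = "{f. \<forall>i. poly.coeff f i \<in> R}"
  have P: "is_subring ?P" by (rule subring_polys[OF R])
  have adj: "adjoin R z = (\<lambda>f. poly f z) ` ?P" by (auto simp: adjoin_def)
  show "1 \<in> adjoin R z" unfolding adj using subring_one[OF P] by (intro image_eqI[of _ _ 1]) auto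
  fix x y assume "x \<in> adjoin R z" "y \<in> adjoin R z"
  then obtain f h where "f \<in> ?P" "x = poly f z" "h \<in> ?P" "y = poly h z" unfolding adj by blast
  with subring_diff[OF P, of f h] subring_mult[OF P, of f h]
  show "x - y \<in> adjoin R z" "x * y \<in> adjoin R z" unfolding adj
    by (auto simp del: mem_Collect_eq intro: image_eqI[of _ _ "f - h"] image_eqI[of _ _ "f * h"])
qed

lemma is_subring_power_series:
  assumes R: "is_subring R"
  shows "is_subring (power_series R)"
  unfolding is_subring_def[of "power_series R"]
proof (intro conjI ballI)
  let ?P = "{f. \<forall>n. fps_nth f n \<in> R}"
  show "1 \<in> power_series R" unfolding power_series_def using R
    by (intro image_eqI[of _ _ 1]) (auto simp: subring_one subring_zero)
  fix x y assume "x \<in> power_series R" "y \<in> power_series R"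
  then obtain f h where "f \<in> ?P" "x = fps_to_fls f" "h \<in> ?P" "y = fps_to_fls h"
    unfolding power_series_def by blast
  with R have "f - h \<in> ?P" "f * h \<in> ?P" "x - y = fps_to_fls (f - h)" "x * y = fps_to_fls (f * h)"
    by (auto intro!: subring_diff subring_sum subring_mult simp: fps_mult_nth fls_times_fps_to_fls)
  thus "x - y \<in> power_series R" "x * y \<in> power_series R" unfolding power_series_def by blast+
qed

section \<open>Ideals and the Frobenius map\<close>

definition is_ideal :: "'a::comm_ring_1 set \<Rightarrow> 'a set \<Rightarrow> bool" where
  "is_ideal R I \<longleftrightarrow> is_subring R \<and> I \<subseteq> R \<and> 0 \<in> I \<and> (\<forall>x\<in>I. \<forall>y\<in>I. x + y \<in> I) \<and>
     (\<forall>a\<in>R. \<forall>x\<in>I. a * x \<in> I)"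

lemma is_ideal_principal: "is_subring R \<Longrightarrow> w \<in> R \<Longrightarrow> is_ideal R ((*) w ` R)"
  unfolding is_ideal_def
proof (intro conjI ballI)
  assume R: "is_subring R" "w \<in> R"
  show "(*) w ` R \<subseteq> R" using R by (auto intro: subring_mult)
  show "0 \<in> (*) w ` R" using subring_zero[OF R(1)] by force
  show "x + y \<in> (*) w ` R" if "x \<in> (*) w ` R" "y \<in> (*) w ` R" for x y
    using that subring_add[OF R(1)] by (auto simp flip: distrib_left)
  show "a * x \<in> (*) w ` R" if "a \<in> R" "x \<in> (*) w ` R" for a x
    using that subring_mult[OF R(1)] by (auto simp: mult.left_commute[of _ w])
qed

context
  fixes R I :: "'a::comm_ring_1 set"
  assumes I: "is_ideal R I"
begin

lemma ideal_subring: "is_subring R" and ideal_subset: "x \<in> I \<Longrightarrow> x \<in> R" and ideal_zero: "0 \<in> I"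
  and ideal_add: "x \<in> I \<Longrightarrow> y \<in> I \<Longrightarrow> x + y \<in> I" and ideal_lmult: "a \<in> R \<Longrightarrow> x \<in> I \<Longrightarrow> a * x \<in> I"
  using I by (auto simp: is_ideal_def)

lemma ideal_rmult: "a \<in> R \<Longrightarrow> x \<in> I \<Longrightarrow> x * a \<in> I"
  by (subst mult.commute) (rule ideal_lmult)

lemma ideal_uminus: "x \<in> I \<Longrightarrow> - x \<in> I"
  using ideal_lmult[OF subring_uminus[OF ideal_subring subring_one[OF ideal_subring]]] by simp

lemma ideal_diff: "x \<in> I \<Longrightarrow> y \<in> I \<Longrightarrow> x - y \<in> I"
  using ideal_add[OF _ ideal_uminus, of x y] by simp

lemma ideal_sum: "(\<And>i. i \<in> A \<Longrightarrow> f i \<in> I) \<Longrightarrow> sum f A \<in> I"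
  by (induction A rule: infinite_finite_induct) (auto intro: ideal_zero ideal_add)

lemma ideal_prod_diff:
  assumes "\<And>i. i \<in> A \<Longrightarrow> f i \<in> R" "\<And>i. i \<in> A \<Longrightarrow> h i \<in> R" "\<And>i. i \<in> A \<Longrightarrow> f i - h i \<in> I"
  shows "prod f A - prod h A \<in> I"
  using assms
proof (induction A rule: infinite_finite_induct)
  case (insert a A)
  have "prod f (insert a A) - prod h (insert a A)
      = prod f A * (f a - h a) + h a * (prod f A - prod h A)"
    using insert.hyps by (simp add: algebra_simps)
  also have "\<dots> \<in> I"
    using insert by (intro ideal_add ideal_lmult subring_prod[OF ideal_subring]) auto
  finally show ?case .
qed (simp_all add: ideal_zero)

lemma ideal_power_diff: "x \<in> R \<Longrightarrow> y \<in> R \<Longrightarrow> x - y \<in> I \<Longrightarrow> x ^ n - y ^ n \<in> I"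
  using ideal_prod_diff[of "{..<n}" "\<lambda>_. x" "\<lambda>_. y"] by simp

text \<open>Frobenius modulo an ideal that contains p: the inner binomial coefficients of exponent p
  are divisible by p, and the step from s to s + 1 applies the case s to the p-th powers.\<close>

lemma ideal_prime_power_add:
  assumes p: "prime p" "of_nat p \<in> I" and "a \<in> R" "b \<in> R"
  shows "(a + b) ^ p ^ s - (a ^ p ^ s + b ^ p ^ s) \<in> I"
  using assms(3,4)
proof (induction s arbitrary: a b)
  case 0
  show ?case by (simp add: ideal_zero)
next
  case (Suc s)
  note R = ideal_subring
  have base: "(a + b) ^ p - (a ^ p + b ^ p) \<in> I" if "a \<in> R" "b \<in> R" for a b
  proof -
    have p0: "p > 0" using p(1) prime_gt_0_nat by blast
    have "(a + b) ^ p = (\<Sum>k\<in>{..p}. of_nat (p choose k) * a ^ k * b ^ (p - k))"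
      by (rule binomial_ring)
    also have "{..p} = insert 0 (insert p {0<..<p})" using p0 by auto
    finally have "(a + b) ^ p - (a ^ p + b ^ p)
        = (\<Sum>k\<in>{0<..<p}. of_nat (p choose k) * a ^ k * b ^ (p - k))" using p0 by simp
    also have "\<dots> \<in> I"
    proof (intro ideal_sum)
      fix k assume k: "k \<in> {0<..<p}"
      hence "p dvd (p choose k)" using p(1) by (intro dvd_choose_prime) auto
      then obtain q where "p choose k = p * q" by (auto simp: dvd_def)
      hence "of_nat (p choose k) * a ^ k * b ^ (p - k)
          = (of_nat q * a ^ k * b ^ (p - k)) * of_nat p" by (simp add: mult_ac)
      also have "\<dots> \<in> I"
        by (intro ideal_lmult p subring_mult[OF R] subring_power[OF R] subring_of_nat[OF R] that)
      finally show "of_nat (p choose k) * a ^ k * b ^ (p - k) \<in> I" .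
    qed
    finally show ?thesis .
  qed
  have pw: "(x ^ p) ^ p ^ s = x ^ p ^ Suc s" for x :: 'a by (simp add: power_mult)
  have "((a + b) ^ p) ^ p ^ s - (a ^ p + b ^ p) ^ p ^ s \<in> I"
    using Suc.prems base by (intro ideal_power_diff subring_add[OF R] subring_power[OF R]) auto
  moreover have "(a ^ p + b ^ p) ^ p ^ s - ((a ^ p) ^ p ^ s + (b ^ p) ^ p ^ s) \<in> I"
    using Suc.prems by (intro Suc.IH subring_power[OF R])
  ultimately show ?case unfolding pw
    by (metis (no_types, lifting) ideal_add add_diff_eq diff_add_cancel)
qed

text \<open>The matrix of binomial coefficients is unitriangular, so the system can be solved from
  the last index downwards.\<close>

lemma ideal_triangular_binomial:
  fixes y :: "nat \<Rightarrow> 'a"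
  assumes "\<And>l. l < n \<Longrightarrow> (\<Sum>j<n. y j * of_nat (j choose l)) \<in> I"
  shows "j < n \<Longrightarrow> y j \<in> I"
proof (induction "n - j" arbitrary: j rule: less_induct)
  case less
  have "(\<Sum>i<n. y i * of_nat (i choose j))
      = y j + (\<Sum>i\<in>{..<n} - {j}. y i * of_nat (i choose j))"
    using less.prems by (subst sum.remove[of _ j]) auto
  moreover have "(\<Sum>i\<in>{..<n} - {j}. y i * of_nat (i choose j)) \<in> I"
  proof (intro ideal_sum)
    fix i assume i: "i \<in> {..<n} - {j}"
    show "y i * of_nat (i choose j) \<in> I"
    proof (cases "i < j")
      case True
      thus ?thesis by (simp add: binomial_eq_0 ideal_zero)
    next
      case False
      thus ?thesis using less.hyps[of i] i less.prems
        by (intro ideal_rmult subring_of_nat ideal_subring) auto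
    qed
  qed
  ultimately show ?case using ideal_diff[OF assms[OF less.prems]]
    by (metis add_diff_cancel_right')
qed

end

lemma is_ideal_fps:
  assumes I: "is_ideal R I"
  shows "is_ideal {f. \<forall>n. fps_nth f n \<in> R} {f. \<forall>n. fps_nth f n \<in> I}"
  using ideal_subring[OF I] I unfolding is_ideal_def[of "{f. \<forall>n. fps_nth f n \<in> R}"]
  by (auto simp: fps_mult_nth is_subring_def[of "{f. \<forall>n. fps_nth f n \<in> R}"] subring_zero subring_one
      intro!: subring_diff subring_sum subring_mult ideal_sum[OF I] ideal_lmult[OF I]
      intro: ideal_subset[OF I] ideal_zero[OF I] ideal_add[OF I])

lemma one_plus_fps_X_power_nth:
  "fps_nth ((1 + fps_X) ^ n :: 'a::comm_ring_1 fps) k = of_nat (n choose k)"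
proof (induction n arbitrary: k)
  case 0
  show ?case by (cases k) auto
next
  case (Suc n)
  thus ?case by (cases k) (auto simp: distrib_right)
qed

text \<open>Modulo the prime ideal, \<open>f j ^ p ^ s\<close> is a power series in \<open>X ^ p ^ s\<close>, and the powers
  of \<open>1 + X\<close> with exponents below \<open>p ^ s\<close> are independent over such series.\<close>

lemma fps_ideal_if_frobenius_sum:
  fixes f :: "nat \<Rightarrow> 'a::idom fps"
  assumes I: "is_ideal R I" and p: "prime p" "of_nat p \<in> I"
    and pr: "\<And>x y. x \<in> R \<Longrightarrow> y \<in> R \<Longrightarrow> x * y \<in> I \<Longrightarrow> x \<in> I \<or> y \<in> I"
    and f: "\<And>j n. j < p ^ s \<Longrightarrow> fps_nth (f j) n \<in> R"
    and sum: "\<And>n. fps_nth (\<Sum>j<p ^ s. f j ^ p ^ s * (1 + fps_X) ^ j) n \<in> I"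
  shows "j < p ^ s \<Longrightarrow> fps_nth (f j) n \<in> I"
proof (induction n arbitrary: j rule: less_induct)
  case (less m)
  let ?N = "p ^ s" and ?R = "{f. \<forall>n. fps_nth f n \<in> R}" and ?I = "{f. \<forall>n. fps_nth f n \<in> I}"
  have II: "is_ideal ?R ?I" by (rule is_ideal_fps[OF I])
  have R: "is_subring R" and RR: "is_subring ?R"
    using ideal_subring[OF I] ideal_subring[OF II] by auto
  have N: "?N > 0" using p(1) prime_gt_0_nat by auto
  have X: "fps_X \<in> ?R" using subring_zero[OF R] subring_one[OF R] by (auto simp: fps_X_def)
  have pI: "of_nat p \<in> ?I"
    using p(2) ideal_zero[OF I] by (auto simp: fps_of_nat[symmetric])
  \<comment> \<open>By the induction hypothesis \<open>f j\<close> is X ^ m times \<open>b j\<close>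
    modulo the ideal. The constant term \<open>\<beta> j\<close> of \<open>b j\<close> is the
    coefficient in question, and \<open>b' j\<close> collects the rest.\<close>
  define b where "b j = fps_shift m (f j)" for j
  define b' where "b' j = fps_shift 1 (b j)" for j
  define \<beta> where "\<beta> j = fps_nth (f j) m" for j
  define S where "S = (\<Sum>j<?N. fps_const (\<beta> j ^ ?N) * fps_X ^ (m * ?N) * (1 + fps_X) ^ j)"
  have bR: "b j \<in> ?R" "b' j \<in> ?R" "fps_const (\<beta> j) \<in> ?R" "f j \<in> ?R" if "j < ?N" for j
    using f[OF that] subring_zero[OF R] by (auto simp: b_def b'_def \<beta>_def)
  have b_eq: "b j = fps_const (\<beta> j) + fps_X * b' j" for j
    by (rule fps_ext) (auto simp: b_def b'_def \<beta>_def)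
  have step: "f j ^ ?N - (fps_const (\<beta> j ^ ?N) * fps_X ^ (m * ?N)
      + fps_X ^ (m * ?N + ?N) * b' j ^ ?N) \<in> ?I" if j: "j < ?N" for j
  proof -
    have "f j - fps_X ^ m * b j \<in> ?I"
      using less.IH[OF _ j] ideal_zero[OF I] by (auto simp: fps_X_power_mult_nth b_def)
    hence "f j ^ ?N - (fps_X ^ m * b j) ^ ?N \<in> ?I"
      using bR[OF j] by (intro ideal_power_diff[OF II] subring_mult[OF RR] subring_power[OF RR] X)
    moreover have "b j ^ ?N - (fps_const (\<beta> j) ^ ?N + (fps_X * b' j) ^ ?N) \<in> ?I"
      unfolding b_eq using bR[OF j]
      by (intro ideal_prime_power_add[OF II p(1) pI] subring_mult[OF RR] X)
    hence "fps_X ^ (m * ?N) * (b j ^ ?N - (fps_const (\<beta> j) ^ ?N + (fps_X * b' j) ^ ?N)) \<in> ?I"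
      by (intro ideal_lmult[OF II] subring_power[OF RR] X)
    ultimately have "f j ^ ?N - (fps_X ^ m * b j) ^ ?N +
       fps_X ^ (m * ?N) * (b j ^ ?N - (fps_const (\<beta> j) ^ ?N + (fps_X * b' j) ^ ?N)) \<in> ?I"
      by (rule ideal_add[OF II])
    thus ?thesis
      by (simp add: algebra_simps power_mult_distrib power_add flip: power_mult)
  qed
  have 1: "(\<Sum>j<?N. (f j ^ ?N - (fps_const (\<beta> j ^ ?N) * fps_X ^ (m * ?N)
      + fps_X ^ (m * ?N + ?N) * b' j ^ ?N)) * (1 + fps_X) ^ j) \<in> ?I"
    by (intro ideal_sum[OF II] ideal_rmult[OF II] step subring_power[OF RR]
        subring_add[OF RR] subring_one[OF RR] X) auto
  have 2: "(\<Sum>j<?N. (f j ^ ?N - (fps_const (\<beta> j ^ ?N) * fps_X ^ (m * ?N)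
      + fps_X ^ (m * ?N + ?N) * b' j ^ ?N)) * (1 + fps_X) ^ j)
     = (\<Sum>j<?N. f j ^ ?N * (1 + fps_X) ^ j) - S
       - fps_X ^ (m * ?N + ?N) * (\<Sum>j<?N. b' j ^ ?N * (1 + fps_X) ^ j)"
    by (simp add: S_def algebra_simps sum.distrib sum_subtractf sum_distrib_left)
  \<comment> \<open>In the degrees m * N + l with l < N the rest does not contribute, because its
    N-th power starts at degree (m + 1) * N. Only the constants with their binomial coefficients are
    left.\<close>
  have "(\<Sum>j<?N. \<beta> j ^ ?N * of_nat (j choose l)) \<in> I" if l: "l < ?N" for l
  proof -
    have "fps_nth ((\<Sum>j<?N. f j ^ ?N * (1 + fps_X) ^ j) - S
       - fps_X ^ (m * ?N + ?N) * (\<Sum>j<?N. b' j ^ ?N * (1 + fps_X) ^ j)) (m * ?N + l) \<in> I"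
      using 1 unfolding 2 by blast
    moreover have "fps_nth (fps_X ^ (m * ?N + ?N) * (\<Sum>j<?N. b' j ^ ?N * (1 + fps_X) ^ j)) (m * ?N + l) = 0"
      using l by (simp add: fps_X_power_mult_nth)
    moreover have "fps_nth S (m * ?N + l) = (\<Sum>j<?N. \<beta> j ^ ?N * of_nat (j choose l))"
    proof -
      have "fps_nth (fps_const (\<beta> j ^ ?N) * fps_X ^ (m * ?N) * (1 + fps_X) ^ j) (m * ?N + l)
        = \<beta> j ^ ?N * of_nat (j choose l)" for j
        by (simp add: mult.assoc fps_X_power_mult_nth one_plus_fps_X_power_nth)
      thus ?thesis by (simp add: S_def fps_sum_nth)
    qed
    ultimately have "fps_nth (\<Sum>j<?N. f j ^ ?N * (1 + fps_X) ^ j) (m * ?N + l)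
        - (\<Sum>j<?N. \<beta> j ^ ?N * of_nat (j choose l)) \<in> I" by simp
    from ideal_diff[OF I sum[of "m * ?N + l"] this] show ?thesis by simp
  qed
  hence "\<beta> j ^ ?N \<in> I" by (rule ideal_triangular_binomial[OF I]) (use less.prems in auto)
  \<comment> \<open>The ideal is prime, so a positive power lies in it only if its base
    does.\<close>
  moreover have "\<beta> j ^ k \<in> I \<Longrightarrow> k > 0 \<Longrightarrow> \<beta> j \<in> I" for k
  proof (induction k)
    case (Suc k)
    have bj: "\<beta> j \<in> R" using f[OF less.prems] by (simp add: \<beta>_def)
    from pr[OF bj subring_power[OF R bj, of k]] Suc show ?case by (cases k) auto
  qed simp
  ultimately show ?case using N by (simp add: \<beta>_def)
qed

text \<open>The \<open>f i\<close> are distinct roots of the polynomial X ^ n - a, and there are n =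
  \<open>card I\<close> of them, so the monic product over them is this polynomial. It serves to
  compute norms of elements 1 - \<zeta>.\<close>

lemma prod_roots_of_power:
  fixes f :: "'b \<Rightarrow> 'a::idom"
  assumes "finite I" "inj_on f I" "card I > 0" "\<And>i. i \<in> I \<Longrightarrow> f i ^ card I = a"
  shows "(\<Prod>i\<in>I. x - f i) = x ^ card I - a"
proof -
  have d: "degree (\<Prod>i\<in>I. [:- f i, 1:]) = card I" by (subst degree_prod_eq_sum_degree) auto
  have "(\<Prod>i\<in>I. [:- f i, 1:]) = monom 1 (card I) - [:a:]"
  proof (rule poly_eqI_degree_lead_coeff[of _ "card I" _ "f ` I"])
    have "lead_coeff (\<Prod>i\<in>I. [:- f i, 1:]) = 1" by (simp add: lead_coeff_prod)
    thus "poly.coeff (\<Prod>i\<in>I. [:- f i, 1:]) (card I) = poly.coeff (monom 1 (card I) - [:a:]) (card I)"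
      using d assms(3) by (simp add: coeff_eq_0)
    show "card I \<le> card (f ` I)" using assms by (simp add: card_image)
    show "degree (monom 1 (card I) - [:a:]) \<le> card I"
      by (rule degree_diff_le) (auto simp: degree_monom_eq)
    fix z assume "z \<in> f ` I"
    thus "poly (\<Prod>i\<in>I. [:- f i, 1:]) z = poly (monom 1 (card I) - [:a:]) z"
      using assms by (auto simp: poly_prod poly_monom)
  qed (simp add: d)
  hence "poly (\<Prod>i\<in>I. [:- f i, 1:]) x = poly (monom 1 (card I) - [:a:]) x" by simp
  thus ?thesis by (simp add: poly_prod poly_monom)
qed

lemma sum_root_of_unity_powers:
  fixes x :: "'a::idom"
  assumes "x ^ n = 1" "x \<noteq> 1"
  shows "(\<Sum>j<n. x ^ j) = 0"
  using assms power_diff_1_eq[of x n] by simp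


section \<open>Orbit sums, determinants and orders of units\<close>

text \<open>Orbits are split off one at a time. The period of a point divides p ^ s, so a point that
  is not fixed has an orbit of p ^ k points with k \<ge> 1, whose sum is in \<open>J\<close> by
  hypothesis. The fixed points survive.\<close>

lemma cyclic_orbit_sum:
  fixes t :: "'b \<Rightarrow> 'a::comm_ring_1"
  assumes J: "is_ideal R J" and p: "prime p" and fin: "finite X"
    and closed: "\<And>x. x \<in> X \<Longrightarrow> \<tau> x \<in> X" and period: "\<And>x. x \<in> X \<Longrightarrow> (\<tau> ^^ (p ^ s)) x = x"
    and orbit: "\<And>x k. x \<in> X \<Longrightarrow> \<tau> x \<noteq> x \<Longrightarrow> 1 \<le> k \<Longrightarrow> k \<le> s \<Longrightarrow> (\<tau> ^^ (p ^ k)) x = x \<Longrightarrow>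
       (\<Sum>i<p ^ k. t ((\<tau> ^^ i) x)) \<in> J"
  shows "sum t X - (\<Sum>x\<in>{x\<in>X. \<tau> x = x}. t x) \<in> J"
  using fin closed period orbit
proof (induction "card X" arbitrary: X rule: less_induct)
  case less
  show ?case
  proof (cases "\<forall>x\<in>X. \<tau> x = x")
    case True
    hence "{x\<in>X. \<tau> x = x} = X" by auto
    thus ?thesis by (simp add: ideal_zero[OF J])
  next
    case False
    then obtain x where x: "x \<in> X" "\<tau> x \<noteq> x" by auto
    have pN: "p ^ s > 0" using p prime_gt_0_nat by auto
    define d where "d = (LEAST m. m > 0 \<and> (\<tau> ^^ m) x = x)"
    have d: "d > 0" "(\<tau> ^^ d) x = x"
      using LeastI[of "\<lambda>m. m > 0 \<and> (\<tau> ^^ m) x = x" "p ^ s"] pN less.prems(3)[OF x(1)]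
      by (auto simp: d_def)
    have dmin: "d \<le> m" if "m > 0" "(\<tau> ^^ m) x = x" for m
      using Least_le[of "\<lambda>m. m > 0 \<and> (\<tau> ^^ m) x = x" m] that by (simp add: d_def)
    have mod: "(\<tau> ^^ m) x = (\<tau> ^^ (m mod d)) x" for m
      by (rule funpow_mod_eq[OF d(2), symmetric])
    \<comment> \<open>Otherwise the remainder of p ^ s would be a positive period below the least
      one.\<close>
    have "d dvd p ^ s"
    proof (rule ccontr)
      assume "\<not> d dvd p ^ s"
      hence "p ^ s mod d > 0" by (simp add: dvd_eq_mod_eq_0)
      moreover have "(\<tau> ^^ (p ^ s mod d)) x = x" using mod[of "p ^ s"] less.prems(3)[OF x(1)] by simp
      ultimately have "d \<le> p ^ s mod d" by (rule dmin)
      thus False using d(1) mod_less_divisor[of d "p ^ s"] by linarith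
    qed
    then obtain k where k: "k \<le> s" "d = p ^ k" using divides_primepow_nat[OF p] by blast
    have k1: "1 \<le> k"
    proof (rule ccontr)
      assume "\<not> 1 \<le> k"
      hence "d = 1" using k by simp
      thus False using d(2) x(2) by simp
    qed
    define Ob where "Ob = (\<lambda>i. (\<tau> ^^ i) x) ` {..<d}"
    have Ob_mem: "(\<tau> ^^ m) x \<in> Ob" for m
      using mod[of m] d(1) by (auto simp: Ob_def)
    have X_mem: "(\<tau> ^^ m) x \<in> X" for m
      by (induction m) (auto simp: x less.prems(2))
    have inj: "inj_on (\<lambda>i. (\<tau> ^^ i) x) {..<d}"
    proof (rule linorder_inj_onI)
      fix i j assume ij: "i < j" "i \<in> {..<d}" "j \<in> {..<d}"
      show "(\<tau> ^^ i) x \<noteq> (\<tau> ^^ j) x"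
      proof
        assume "(\<tau> ^^ i) x = (\<tau> ^^ j) x"
        hence "(\<tau> ^^ (d - i)) ((\<tau> ^^ i) x) = (\<tau> ^^ (d - i)) ((\<tau> ^^ j) x)" by simp
        hence "(\<tau> ^^ (d - i + i)) x = (\<tau> ^^ (d - i + j)) x" by (simp only: funpow_add o_apply)
        moreover have "d - i + i = d" "d - i + j = (j - i) + d" using ij by auto
        ultimately have "(\<tau> ^^ d) x = (\<tau> ^^ ((j - i) + d)) x" by metis
        hence "(\<tau> ^^ (j - i)) x = x" using d(2) by (simp only: funpow_add o_apply)
        thus False using dmin[of "j - i"] ij by auto
      qed
    qed auto
    have sumOb: "sum t Ob = (\<Sum>i<p ^ k. t ((\<tau> ^^ i) x))"
      unfolding Ob_def k(2)[symmetric] by (subst sum.reindex[OF inj]) simp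
    have ObX: "Ob \<subseteq> X" using X_mem by (auto simp: Ob_def)
    have fixO: "\<tau> y \<noteq> y" if y: "y \<in> Ob" for y
    proof
      assume eq: "\<tau> y = y"
      obtain i where i: "y = (\<tau> ^^ i) x" "i < d" using y by (auto simp: Ob_def)
      have "(\<tau> ^^ m) y = y" for m by (induction m) (auto simp: eq)
      hence "y = (\<tau> ^^ (d - i)) ((\<tau> ^^ i) x)" using i by metis
      also have "\<dots> = (\<tau> ^^ (d - i + i)) x" by (simp only: funpow_add o_apply)
      also have "\<dots> = x" using i d by simp
      finally show False using eq x by simp
    qed
    have "sum t (X - Ob) - (\<Sum>x\<in>{x\<in>X - Ob. \<tau> x = x}. t x) \<in> J"
    proof (rule less.hyps)
      have "x \<in> Ob" using Ob_mem[of 0] by simp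
      thus "card (X - Ob) < card X" using less.prems(1) x(1) by (intro psubset_card_mono) auto
      fix y assume y: "y \<in> X - Ob"
      have "\<tau> y \<notin> Ob"
      proof
        assume "\<tau> y \<in> Ob"
        then obtain i where i: "\<tau> y = (\<tau> ^^ i) x" by (auto simp: Ob_def)
        \<comment> \<open>On \<open>X\<close> the map is invertible, with its (p ^ s - 1)-th iterate
          as inverse. A point whose image is in the orbit therefore lies in the orbit
          itself.\<close>
        have "y = (\<tau> ^^ (Suc (p ^ s - 1))) y" using less.prems(3)[of y] y pN by simp
        also have "\<dots> = (\<tau> ^^ (p ^ s - 1)) (\<tau> y)" by (simp only: funpow_Suc_right o_apply)
        also have "\<dots> = (\<tau> ^^ (p ^ s - 1 + i)) x" by (simp only: i funpow_add o_apply)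
        finally show False using Ob_mem y by auto
      qed
      thus "\<tau> y \<in> X - Ob" using y less.prems(2) by auto
    qed (use less.prems in auto)
    moreover have "{x\<in>X - Ob. \<tau> x = x} = {x\<in>X. \<tau> x = x}" using fixO by auto
    moreover have "sum t X = sum t (X - Ob) + sum t Ob"
      using sum.subset_diff[OF ObX less.prems(1)] by simp
    moreover have "sum t Ob \<in> J" unfolding sumOb using less.prems(4)[OF x k1 k(1)] d k by simp
    ultimately show ?thesis using ideal_add[OF J] by (metis add_diff_eq add.commute)
  qed
qed

text \<open>\<open>S\<close> is the set of rows in which the entry of \<open>Y\<close> is chosen. In
  the other rows the identity matrix forces the permutation to fix the index, so that it permutes
  \<open>S\<close>.\<close>

lemma det_one_plus:
  fixes Y :: "'a::comm_ring_1 mat"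
  assumes Y: "Y \<in> carrier_mat n n"
  shows "det (1\<^sub>m n + Y) =
    (\<Sum>S\<in>Pow {0..<n}. \<Sum>q\<in>{q. q permutes S}. signof q * (\<Prod>i\<in>S. Y $$ (i, q i)))"
proof -
  let ?A = "{0..<n}"
  have fA: "finite {q. q permutes ?A}" by (rule finite_permutations) simp
  have "det (1\<^sub>m n + Y) = (\<Sum>q\<in>{q. q permutes ?A}. signof q *
      (\<Prod>i\<in>?A. Y $$ (i, q i) + (if i = q i then 1 else 0)))"
    using Y by (subst det_def'[of _ n]) (auto intro!: sum.cong prod.cong arg_cong2[of _ _ _ _ "(*)"] simp: permutes_in_image)
  also have "\<dots> = (\<Sum>q\<in>{q. q permutes ?A}. \<Sum>S\<in>Pow ?A. signof q *
      ((\<Prod>i\<in>S. Y $$ (i, q i)) * (\<Prod>i\<in>?A - S. if i = q i then 1 else 0)))"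
    by (subst prod_add) (auto simp: sum_distrib_left)
  also have "\<dots> = (\<Sum>S\<in>Pow ?A. \<Sum>q\<in>{q. q permutes ?A}. signof q *
      ((\<Prod>i\<in>S. Y $$ (i, q i)) * (\<Prod>i\<in>?A - S. if i = q i then 1 else 0)))"
    by (rule sum.swap)
  also have "\<dots> = (\<Sum>S\<in>Pow ?A. \<Sum>q\<in>{q. q permutes S}. signof q * (\<Prod>i\<in>S. Y $$ (i, q i)))"
  proof (rule sum.cong[OF refl])
    fix S assume S: "S \<in> Pow ?A"
    show "(\<Sum>q\<in>{q. q permutes ?A}. signof q *
        ((\<Prod>i\<in>S. Y $$ (i, q i)) * (\<Prod>i\<in>?A - S. if i = q i then 1 else 0))) =
      (\<Sum>q\<in>{q. q permutes S}. signof q * (\<Prod>i\<in>S. Y $$ (i, q i)))"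
    proof (rule sum.mono_neutral_cong_right)
      show "{q. q permutes S} \<subseteq> {q. q permutes ?A}" using S permutes_subset by blast
      show "\<forall>q\<in>{q. q permutes ?A} - {q. q permutes S}. signof q *
        ((\<Prod>i\<in>S. Y $$ (i, q i)) * (\<Prod>i\<in>?A - S. if i = q i then 1 else 0)) = 0"
      proof
        fix q assume q: "q \<in> {q. q permutes ?A} - {q. q permutes S}"
        then obtain i where "i \<in> ?A - S" "q i \<noteq> i" using permutes_superset[of q ?A S] by blast
        hence "(\<Prod>i\<in>?A - S. if i = q i then 1 else 0 :: 'a) = 0" by (intro prod_zero) force+
        thus "signof q * ((\<Prod>i\<in>S. Y $$ (i, q i)) * (\<Prod>i\<in>?A - S. if i = q i then 1 else 0)) = 0"
          by simp
      qed
      fix q assume "q \<in> {q. q permutes S}"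
      hence "(\<Prod>i\<in>?A - S. if i = q i then 1 else 0 :: 'a) = 1"
        by (intro prod.neutral) (auto simp: permutes_def)
      thus "signof q * ((\<Prod>i\<in>S. Y $$ (i, q i)) * (\<Prod>i\<in>?A - S. if i = q i then 1 else 0)) =
         signof q * (\<Prod>i\<in>S. Y $$ (i, q i))" by simp
    qed (rule fA)
  qed
  finally show ?thesis .
qed

text \<open>Raising 1 + x to the power p increases the valuation of x by exactly one: the inner
  terms gain a factor p from the binomial coefficients, and x ^ p is divisible enough because p
  \<ge> 3.\<close>

lemma one_plus_prime_power:
  assumes p: "prime (p::nat)" "odd p" and r: "r \<ge> 1"
  shows "\<exists>u. (1 + p ^ r) ^ p ^ k = 1 + p ^ (r + k) * u \<and> \<not> p dvd u"
proof (induction k)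
  case 0
  show ?case using p(1) by (intro exI[of _ 1]) (auto simp: prime_nat_iff)
next
  case (Suc k)
  then obtain u where u: "(1 + p ^ r) ^ p ^ k = 1 + p ^ (r + k) * u" "\<not> p dvd u" by blast
  define x where "x = p ^ (r + k) * u"
  have p3: "p \<ge> 3" using p prime_ge_2_nat[OF p(1)] by (cases "p = 2") auto
  have px: "p dvd x" using r by (auto simp: x_def intro: dvd_mult2 dvd_power)
  \<comment> \<open>One factor x contributes p ^ (r + k), the other at least one more p because r
    \<ge> 1.\<close>
  obtain y where y: "x ^ 2 = p ^ (r + k + 1) * y"
  proof -
    have "x ^ 2 = x * (p ^ (r + k) * u)" by (simp add: power2_eq_square x_def)
    moreover obtain z where "x = p * z" using px by (auto simp: dvd_def)
    ultimately have "x ^ 2 = p ^ (r + k + 1) * (z * u)" by simp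
    thus ?thesis by (rule that)
  qed
  have "(1 + x) ^ p = (\<Sum>i\<le>p. (p choose i) * x ^ i)" using binomial_ring[of x 1 p] by (simp add: add.commute)
  also have "{..p} = insert 0 (insert 1 (insert p {2..<p}))" using p3 by auto
  also have "(\<Sum>i\<in>\<dots>. (p choose i) * x ^ i) = 1 + p * x + (x ^ p + (\<Sum>i\<in>{2..<p}. (p choose i) * x ^ i))"
    using p3 by simp
  finally have e: "(1 + x) ^ p = 1 + p * x + (x ^ p + (\<Sum>i\<in>{2..<p}. (p choose i) * x ^ i))" .
  have "p * (p ^ (r + k + 1)) dvd (p choose i) * x ^ i" if "i \<in> {2..<p}" for i
  proof -
    have "p dvd (p choose i)" using that p by (intro dvd_choose_prime) auto
    moreover have "p ^ (r + k + 1) dvd x ^ i"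
    proof (rule dvd_trans[OF _ le_imp_power_dvd[of 2 i x]])
      show "p ^ (r + k + 1) dvd x ^ 2" unfolding y by simp
    qed (use that in auto)
    ultimately show ?thesis by (rule mult_dvd_mono)
  qed
  moreover have "p * (p ^ (r + k + 1)) dvd x ^ p"
  proof -
    have "x ^ p = x * x ^ (p - 1)" using p3 by (cases p) auto
    moreover have "p ^ (r + k + 1) dvd x ^ (p - 1)"
      by (rule dvd_trans[OF _ le_imp_power_dvd[of 2 "p - 1" x]]) (use y p3 in auto)
    ultimately show ?thesis using px by (auto intro: mult_dvd_mono)
  qed
  ultimately have "p * (p ^ (r + k + 1)) dvd x ^ p + (\<Sum>i\<in>{2..<p}. (p choose i) * x ^ i)"
    by (intro dvd_add dvd_sum)
  then obtain w where "x ^ p + (\<Sum>i\<in>{2..<p}. (p choose i) * x ^ i) = p * (p ^ (r + k + 1)) * w"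
    by (auto simp: dvd_def)
  hence "(1 + x) ^ p = 1 + p ^ (r + Suc k) * (u + p * w)"
    unfolding e by (simp add: x_def algebra_simps)
  moreover have "(1 + p ^ r) ^ p ^ Suc k = (1 + x) ^ p"
    using u by (simp add: x_def power_mult mult.commute[of p])
  moreover have "\<not> p dvd u + p * w" using u(2) by (simp add: dvd_add_left_iff)
  ultimately show ?case by metis
qed

text \<open>This concerns the order of 1 + p ^ r modulo p ^ (r + s). If i = p ^ a * j with j prime
  to p, then (1 + p ^ r) ^ i - 1 is divisible by p exactly r + a times.\<close>

lemma one_plus_prime_power_order:
  assumes p: "prime (p::nat)" "odd p" and r: "r \<ge> 1" and d: "p ^ (r + s) dvd (1 + p ^ r) ^ i - 1"
  shows "p ^ s dvd i"
proof (cases "i = 0")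
  case False
  define a where "a = multiplicity p i"
  obtain j where j: "i = p ^ a * j" "\<not> p dvd j"
    using multiplicity_decompose'[of i p] False p(1) unfolding a_def
    by (metis not_prime_unit)
  show ?thesis
  proof (cases "s \<le> a")
    case True
    thus ?thesis unfolding j(1) by (intro dvd_mult2 le_imp_power_dvd)
  next
    case False
    obtain u where u: "(1 + p ^ r) ^ p ^ a = 1 + p ^ (r + a) * u" "\<not> p dvd u"
      using one_plus_prime_power[OF p r] by blast
    have "\<exists>w. (1 + p ^ (r + a) * u) ^ j = 1 + p ^ (r + a) * (u * j + p * w)"
    proof (induction j)
      case (Suc j)
      then obtain w where w: "(1 + p ^ (r + a) * u) ^ j = 1 + p ^ (r + a) * (u * j + p * w)" by blast
      obtain q where q: "p ^ (r + a) = p * q" using r by (cases r) auto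
      have "(1 + p ^ (r + a) * u) ^ Suc j = 1 + p ^ (r + a) * (u * Suc j + p * (w + u * q * (u * j + p * w)))"
      proof -
        have "(1 + p ^ (r + a) * u) ^ Suc j
            = (1 + p ^ (r + a) * u) * (1 + p ^ (r + a) * (u * j + p * w))" by (simp only: power_Suc w)
        also have "\<dots> = 1 + p ^ (r + a) * (u * Suc j + p * w + p ^ (r + a) * u * (u * j + p * w))"
          by (simp add: algebra_simps)
        also have "\<dots> = 1 + p ^ (r + a) * (u * Suc j + p * (w + u * q * (u * j + p * w)))"
          by (subst (2) q) (simp add: algebra_simps)
        finally show ?thesis .
      qed
      thus ?case by blast
    qed (auto intro: exI[of _ 0])
    then obtain w where w: "(1 + p ^ r) ^ i = 1 + p ^ (r + a) * (u * j + p * w)"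
      using u(1) by (auto simp: j(1) power_mult)
    have "p ^ (r + a) * p dvd p ^ (r + s)" using False
      by (metis Suc_leI add_Suc_right le_imp_power_dvd nat_add_left_cancel_le not_le power_Suc2)
    hence "p ^ (r + a) * p dvd p ^ (r + a) * (u * j + p * w)" using d w dvd_trans by fastforce
    hence "p dvd u * j + p * w" using p(1) by (simp add: prime_gt_0_nat)
    hence "p dvd u * j" by (simp add: dvd_add_left_iff)
    thus ?thesis using p(1) u(2) j(2) prime_dvd_mult_iff by blast
  qed
qed simp

section \<open>Divisibility with quotients in a subring\<close>

context
  fixes R :: "'a::comm_ring_1 set"
  assumes R: "is_subring R"
begin

text \<open>Being in the image of \<open>R\<close> under multiplication by \<open>a\<close> stands
  for divisibility by \<open>a\<close> in \<open>R\<close>. The rules are applied inside fields,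
  where divisibility in the whole type would say nothing.\<close>

lemma principal_mem_mult: "x \<in> (*) a ` R \<Longrightarrow> y \<in> (*) b ` R \<Longrightarrow> x * y \<in> (*) (a * b) ` R"
  using subring_mult[OF R] by (force simp: mult_ac)

lemma principal_mem_trans: "b \<in> (*) a ` R \<Longrightarrow> c \<in> (*) b ` R \<Longrightarrow> c \<in> (*) a ` R"
  using subring_mult[OF R] by (force simp: mult.assoc)

lemma principal_mem_self: "a \<in> (*) a ` R"
  using subring_one[OF R] by force

lemma principal_mem_prod:
  "finite A \<Longrightarrow> (\<And>i. i \<in> A \<Longrightarrow> f i \<in> (*) a ` R) \<Longrightarrow> prod f A \<in> (*) (a ^ card A) ` R"
  by (induction A rule: finite_induct) (auto intro: principal_mem_mult subring_one[OF R])

lemma principal_mem_power: "x \<in> (*) a ` R \<Longrightarrow> x ^ n \<in> (*) (a ^ n) ` R"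
  using principal_mem_prod[of "{..<n}" "\<lambda>_. x" a] by simp

lemma one_minus_power_mem: "z \<in> R \<Longrightarrow> 1 - z ^ n \<in> (*) (1 - z) ` R"
  by (subst one_diff_power_eq) (auto intro!: imageI subring_sum[OF R] subring_power[OF R])

end

text \<open>The powers of \<open>z\<close> are all the n-th roots of unity, so the product of the X
  - z ^ c with 0 < c < n is 1 + X + ... + X ^ (n - 1). It is evaluated at 1.\<close>

lemma prod_one_minus_root_powers:
  fixes z :: "'a::field_char_0"
  assumes n: "n > 0" and z: "\<And>k. z ^ k = 1 \<longleftrightarrow> n dvd k"
  shows "(\<Prod>c\<in>{0<..<n}. 1 - z ^ c) = of_nat n"
proof -
  let ?P = "\<Prod>c\<in>{0<..<n}. [:- (z ^ c), 1:]" and ?Q = "\<Sum>j<n. monom (1::'a) j"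
  have z0: "z \<noteq> 0" using z[of n] n by (cases "z = 0") (auto simp: power_0_left)
  have inj: "inj_on (\<lambda>c. z ^ c) {..<n}"
  proof (rule linorder_inj_onI)
    fix i j assume ij: "i < j" "i \<in> {..<n}" "j \<in> {..<n}"
    have "z ^ j = z ^ i * z ^ (j - i)" using ij by (simp flip: power_add)
    moreover have "z ^ (j - i) \<noteq> 1" using z[of "j - i"] ij by (auto dest: dvd_imp_le)
    ultimately show "z ^ i \<noteq> z ^ j" using z0 by auto
  qed auto
  have "poly (?P * [:- 1, 1:]) x = poly (?Q * [:- 1, 1:]) x" for x
  proof -
    have "(\<Prod>c\<in>{..<n}. x - z ^ c) = x ^ n - 1"
      using prod_roots_of_power[OF _ inj, of 1 x] n z by (simp flip: power_mult)
    moreover have "{..<n} = insert 0 {0<..<n}" using n by auto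
    ultimately have "(x - 1) * (\<Prod>c\<in>{0<..<n}. x - z ^ c) = (x - 1) * (\<Sum>j<n. x ^ j)"
      using power_diff_1_eq[of x n] by simp
    thus ?thesis by (simp add: poly_prod poly_sum poly_monom algebra_simps)
  qed
  hence "?P * [:- 1, 1:] = ?Q * [:- 1, 1:]" by (simp add: poly_eq_poly_eq_iff[symmetric] fun_eq_iff)
  hence "?P = ?Q" by (subst (asm) mult_right_cancel) auto
  hence "poly ?P 1 = poly ?Q 1" by simp
  thus ?thesis by (simp add: poly_prod poly_sum poly_monom)
qed

text \<open>When the integral equation of the inverse is multiplied by a ^ (n - 1), its leading term
  becomes the inverse itself and all other terms become polynomial in \<open>a\<close>.\<close>

lemma integral_over_inverse_mem:
  fixes R :: "'a::field set"
  assumes R: "is_subring R" and x: "integral_over R (inverse a)" and a: "a \<in> R" "a \<noteq> 0"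
  shows "inverse a \<in> R"
proof -
  obtain n c where n: "n > 0" "\<And>i. c i \<in> R" "inverse a ^ n = - (\<Sum>i<n. c i * inverse a ^ i)"
    using integral_over_power[OF x] by metis
  have pow: "a ^ (n - 1) * inverse a ^ i = a ^ (n - 1 - i)" if "i < n" for i
  proof -
    have "n - 1 = (n - 1 - i) + i" using that by simp
    hence "a ^ (n - 1) * inverse a ^ i = a ^ (n - 1 - i) * (a ^ i * inverse a ^ i)"
      by (metis mult.assoc power_add)
    thus ?thesis using a(2) by (simp flip: power_mult_distrib)
  qed
  have "inverse a = a ^ (n - 1) * inverse a ^ (n - 1) * inverse a"
    using pow[of "n - 1"] n(1) by simp
  also have "\<dots> = a ^ (n - 1) * inverse a ^ n"
    using n(1) by (metis mult.assoc power_minus_mult)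
  also have "\<dots> = - (\<Sum>i<n. c i * (a ^ (n - 1) * inverse a ^ i))"
    by (simp add: n(3) sum_distrib_left mult_ac)
  also have "\<dots> = - (\<Sum>i<n. c i * a ^ (n - 1 - i))" using pow by (intro arg_cong[of _ _ uminus] sum.cong) auto
  also have "\<dots> \<in> R"
    by (intro subring_uminus[OF R] subring_sum[OF R] subring_mult[OF R] subring_power[OF R] n a)
  finally show ?thesis .
qed

lemma subfield_is_subring: "is_subfield K \<Longrightarrow> is_subring K"
  unfolding is_subfield_def is_subring_def by (metis diff_conv_add_uminus)

section \<open>The cyclotomic integers\<close>

context padic_numbers
begin

lemma p_pos: "p > 0" using prime_p prime_gt_0_nat by blast

lemma v_one: "v 1 = 1"
  using v_rat[of 1] by (simp add: padic_abs_def)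

lemma v_uminus_one: "v (- 1) = 1"
proof -
  have "multiplicity (int p) (- 1) = 0" using prime_p by (intro not_dvd_imp_multiplicity_0) auto
  thus ?thesis using v_rat[of "- 1"]
    by (simp add: padic_abs_def rat_uminus_code)
qed

lemma is_subring_Zp: "is_subring Zp"
proof -
  have Q: "is_subring Qp" by (rule subfield_is_subring[OF subfield_Qp])
  note mem = subring_mult[OF Q] subring_uminus[OF Q] subring_one[OF Q] subring_diff[OF Q]
  have "v (x - y) \<le> 1" if "x \<in> Qp" "y \<in> Qp" "v x \<le> 1" "v y \<le> 1" for x y
  proof -
    have "v (- y) = v y" using v_mult[of "- 1" y] that mem by (simp add: v_uminus_one)
    thus ?thesis using v_add[of x "- y"] that mem by simp
  qed
  thus ?thesis unfolding is_subring_def Zp_def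
    using mem by (auto simp: v_one v_mult v_nonneg mult_le_one)
qed

end

context unramified_extension
begin

abbreviation OF :: "'a set" where "OF \<equiv> integral_closure Zp F"

lemma is_subring_OF: "is_subring OF"
  using finite_ext
  by (intro is_subring_integral_closure is_subring_Zp subfield_is_subring[of F])
     (auto simp: finite_extension_def)

lemma OF_unit: "x \<in> OF \<Longrightarrow> x \<notin> (*) (of_nat p) ` OF \<Longrightarrow> x \<noteq> 0 \<and> inverse x \<in> OF"
  and OF_nonunit: "x \<in> (*) (of_nat p) ` OF \<Longrightarrow> x \<noteq> 0 \<Longrightarrow> inverse x \<notin> OF"
  using unramified by blast+

lemma inverse_p_notin_OF: "inverse (of_nat p) \<notin> OF"
  using OF_nonunit[OF principal_mem_self[OF is_subring_OF]] p_pos by simp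

text \<open>Two factors outside the multiples of p are units, so their product is a unit and cannot
  be a multiple of p.\<close>

lemma p_prime_in_OF:
  assumes "x \<in> OF" "y \<in> OF" "x * y \<in> (*) (of_nat p) ` OF"
  shows "x \<in> (*) (of_nat p) ` OF \<or> y \<in> (*) (of_nat p) ` OF"
  using OF_unit[OF assms(1)] OF_unit[OF assms(2)] OF_nonunit[OF assms(3)]
    subring_mult[OF is_subring_OF, of "inverse x" "inverse y"] by auto

end

context cyclotomic_tower
begin

lemma p_gt_2: "p > 2"
  using prime_ge_2_nat[OF prime_p] odd_p by (cases "p = 2") auto

lemma zeta_pow_p_pow: "\<zeta> (m + k) ^ p ^ k = \<zeta> m"
proof (induction k)
  case (Suc k)
  have "\<zeta> (m + Suc k) ^ p ^ Suc k = (\<zeta> (Suc (m + k)) ^ p) ^ p ^ k" by (simp add: power_mult)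
  thus ?case using Suc by (simp only: zeta_Suc)
qed simp

lemma zeta_root_of_unity: "\<zeta> m ^ p ^ m = 1" by (simp add: zeta_primitive)

lemma zeta_nonzero: "\<zeta> m \<noteq> 0"
  using zeta_root_of_unity[of m] p_pos by (cases "\<zeta> m = 0") (auto simp: power_0_left)

lemma zeta_pow_eq_iff:
  assumes "a \<le> b"
  shows "\<zeta> m ^ a = \<zeta> m ^ b \<longleftrightarrow> p ^ m dvd b - a"
proof -
  have "\<zeta> m ^ b = \<zeta> m ^ a * \<zeta> m ^ (b - a)" using assms by (simp flip: power_add)
  thus ?thesis using zeta_nonzero[of m] by (auto simp: zeta_primitive[symmetric])
qed

lemma is_subring_cyc_ints: "is_subring (cyc_ints m)"
  unfolding cyc_ints_def by (rule is_subring_adjoin[OF is_subring_OF])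

lemma OF_subset_cyc_ints: "c \<in> OF \<Longrightarrow> c \<in> cyc_ints m"
  unfolding cyc_ints_def adjoin_def using subring_zero[OF is_subring_OF]
  by (auto intro!: exI[of _ "[:c:]"] simp: coeff_pCons split: nat.split)

lemma zeta_in_cyc_ints: "\<zeta> m \<in> cyc_ints m"
  unfolding cyc_ints_def adjoin_def using subring_zero[OF is_subring_OF] subring_one[OF is_subring_OF]
  by (auto intro!: exI[of _ "[:0, 1:]"] simp: coeff_pCons split: nat.split)

lemma cyc_ints_poly:
  assumes "x \<in> cyc_ints m"
  shows "\<exists>f. x = poly f (\<zeta> m) \<and> (\<forall>i. poly.coeff f i \<in> OF)"
  using assms unfolding cyc_ints_def adjoin_def by blast

lemma cyc_ints_mono: assumes "x \<in> cyc_ints m" shows "x \<in> cyc_ints (m + k)"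
proof -
  obtain f where f: "x = poly f (\<zeta> m)" "\<And>i. poly.coeff f i \<in> OF" using cyc_ints_poly[OF assms] by blast
  have "\<zeta> m \<in> cyc_ints (m + k)"
    by (subst zeta_pow_p_pow[of m k, symmetric])
       (intro subring_power[OF is_subring_cyc_ints] zeta_in_cyc_ints)
  thus ?thesis unfolding f(1)
    using f(2) by (intro subring_poly[OF is_subring_cyc_ints]) (auto intro: OF_subset_cyc_ints)
qed

lemma one_minus_zeta_in_cyc_ints: "1 - \<zeta> m \<in> cyc_ints m"
  by (intro subring_diff[OF is_subring_cyc_ints] subring_one[OF is_subring_cyc_ints] zeta_in_cyc_ints)

lemma one_minus_zeta_ideal: "is_ideal (cyc_ints m) ((*) (1 - \<zeta> m) ` cyc_ints m)"
  by (intro is_ideal_principal is_subring_cyc_ints one_minus_zeta_in_cyc_ints)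

text \<open>Cyclotomic integers are integral over \<open>OF\<close>, and 1 / p could be integral
  over \<open>OF\<close> only by lying in it, where p is not a unit.\<close>

lemma inverse_p_notin_cyc_ints: "inverse (of_nat p) \<notin> cyc_ints m"
proof
  assume "inverse (of_nat p) \<in> cyc_ints m"
  hence "integral_over OF (inverse (of_nat p))" unfolding cyc_ints_def
    using zeta_root_of_unity p_pos
    by (intro integral_over_adjoin_root_of_unity[OF is_subring_OF, of "\<zeta> m" "p ^ m"]) auto
  thus False using integral_over_inverse_mem[OF is_subring_OF] inverse_p_notin_OF p_pos
      subring_of_nat[OF is_subring_OF] by auto
qed

text \<open>Modulo p the power of 1 - \<zeta> with exponent p ^ m is 1 - \<zeta> ^ (p ^ m) = 0. So p
  divides this power, and p would be a unit if 1 - \<zeta> were one.\<close>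

lemma one_minus_zeta_not_unit: "1 \<notin> (*) (1 - \<zeta> m) ` cyc_ints m"
proof
  note R = is_subring_cyc_ints[of m]
  let ?P = "(*) (of_nat p) ` cyc_ints m"
  have I: "is_ideal (cyc_ints m) ?P" by (intro is_ideal_principal R subring_of_nat[OF R])
  have "(1 + - \<zeta> m) ^ p ^ m - (1 ^ p ^ m + (- \<zeta> m) ^ p ^ m) \<in> ?P"
    by (intro ideal_prime_power_add[OF I prime_p] principal_mem_self[OF R] subring_one[OF R]
        subring_uminus[OF R] zeta_in_cyc_ints)
  hence pw: "(1 - \<zeta> m) ^ p ^ m \<in> ?P"
    using odd_p by (simp add: power_minus_odd zeta_root_of_unity)
  assume "1 \<in> (*) (1 - \<zeta> m) ` cyc_ints m"
  hence "1 ^ p ^ m \<in> (*) ((1 - \<zeta> m) ^ p ^ m) ` cyc_ints m" by (rule principal_mem_power[OF R])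
  hence "1 \<in> ?P" using principal_mem_trans[OF R pw] by simp
  then obtain y where "y \<in> cyc_ints m" "of_nat p * y = 1" by auto
  thus False using inverse_p_notin_cyc_ints inverse_unique by metis
qed

text \<open>With q = p ^ (m - 1), the element 1 - \<open>\<zeta> 1\<close> is a product of q factors
  1 - \<open>\<zeta> m ^ (1 + j * p)\<close>, and p is a product of p - 1 factors 1 -
  \<open>\<zeta> 1 ^ c\<close>. Each factor is divisible by the one with exponent 1, and q * (p - 1)
  is the totient.\<close>

lemma one_minus_zeta_power_dvd_p:
  assumes m: "m \<ge> 1"
  shows "of_nat p \<in> (*) ((1 - \<zeta> m) ^ totient (p ^ m)) ` cyc_ints m"
proof -
  note R = is_subring_cyc_ints[of m]
  define q where "q = p ^ (m - 1)"
  have q: "q > 0" "p ^ m = q * p" using p_pos m by (auto simp: q_def simp flip: power_Suc2)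
  have z1: "\<zeta> m ^ q = \<zeta> 1" using zeta_pow_p_pow[of 1 "m - 1"] m by (simp add: q_def)
  have z1R: "\<zeta> 1 \<in> cyc_ints m"
    unfolding z1[symmetric] by (intro subring_power[OF R] zeta_in_cyc_ints)
  have "(\<Prod>j\<in>{..<q}. 1 - \<zeta> m ^ (1 + j * p)) = 1 ^ card {..<q} - \<zeta> 1"
  proof (rule prod_roots_of_power)
    show "inj_on (\<lambda>j. \<zeta> m ^ (1 + j * p)) {..<q}"
    proof (rule linorder_inj_onI)
      fix i j assume ij: "i < j" "i \<in> {..<q}" "j \<in> {..<q}"
      have "\<not> q * p dvd (j - i) * p" using ij p_pos by (auto dest: dvd_imp_le)
      moreover have "1 + j * p - (1 + i * p) = (j - i) * p" by (simp add: diff_mult_distrib)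
      ultimately show "\<zeta> m ^ (1 + i * p) \<noteq> \<zeta> m ^ (1 + j * p)"
        using ij by (subst zeta_pow_eq_iff) (auto simp: q)
    qed auto
    fix j
    have "(\<zeta> m ^ (1 + j * p)) ^ q = \<zeta> m ^ q * (\<zeta> m ^ p ^ m) ^ j"
      by (simp add: q(2) power_add algebra_simps flip: power_mult)
    thus "(\<zeta> m ^ (1 + j * p)) ^ card {..<q} = \<zeta> 1" by (simp add: z1 zeta_root_of_unity)
  qed (use q in auto)
  moreover have "(\<Prod>j\<in>{..<q}. 1 - \<zeta> m ^ (1 + j * p)) \<in> (*) ((1 - \<zeta> m) ^ card {..<q}) ` cyc_ints m"
    by (intro principal_mem_prod[OF R] one_minus_power_mem[OF R] zeta_in_cyc_ints) auto
  ultimately have 1: "1 - \<zeta> 1 \<in> (*) ((1 - \<zeta> m) ^ q) ` cyc_ints m" by simp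
  have "(\<Prod>c\<in>{0<..<p}. 1 - \<zeta> 1 ^ c) = of_nat p"
    using zeta_primitive[of 1] p_pos by (intro prod_one_minus_root_powers) auto
  moreover have "(\<Prod>c\<in>{0<..<p}. 1 - \<zeta> 1 ^ c) \<in> (*) ((1 - \<zeta> 1) ^ card {0<..<p}) ` cyc_ints m"
    by (intro principal_mem_prod[OF R] one_minus_power_mem[OF R] z1R) auto
  ultimately have 2: "of_nat p \<in> (*) ((1 - \<zeta> 1) ^ (p - 1)) ` cyc_ints m" by simp
  have "totient (p ^ m) = q * (p - 1)"
    using m prime_p by (simp add: totient_prime_power q_def)
  thus ?thesis
    using principal_mem_trans[OF R principal_mem_power[OF R 1] 2] by (simp add: power_mult)
qed

text \<open>Since \<open>\<zeta> m\<close> is congruent to 1, the value of the representing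
  polynomial at 1 lies in the same class: the extension has no new residues.\<close>

lemma cyc_ints_residue:
  assumes "x \<in> cyc_ints m"
  obtains c where "c \<in> OF" "x - c \<in> (*) (1 - \<zeta> m) ` cyc_ints m"
proof -
  obtain f where f: "x = poly f (\<zeta> m)" "\<And>i. poly.coeff f i \<in> OF" using cyc_ints_poly[OF assms] by blast
  note I = one_minus_zeta_ideal[of m]
  have 1: "poly f 1 \<in> OF" using f(2) by (intro subring_poly subring_one is_subring_OF)
  have "x - poly f 1 = (\<Sum>i\<le>degree f. poly.coeff f i * - (1 - \<zeta> m ^ i))"
    by (simp add: f(1) poly_altdef algebra_simps flip: sum_subtractf)
  also have "\<dots> \<in> (*) (1 - \<zeta> m) ` cyc_ints m"
    by (intro ideal_sum[OF I] ideal_lmult[OF I] ideal_uminus[OF I] OF_subset_cyc_ints f(2)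
        one_minus_power_mem[OF is_subring_cyc_ints] zeta_in_cyc_ints)
  finally show ?thesis using 1 that by blast
qed

text \<open>Outside the multiples of p the elements of \<open>OF\<close> are units, and the ideal of
  1 - \<zeta> is proper.\<close>

lemma OF_inter_one_minus_zeta:
  assumes c: "c \<in> OF" "c \<in> (*) (1 - \<zeta> m) ` cyc_ints m"
  shows "c \<in> (*) (of_nat p) ` OF"
proof (rule ccontr)
  assume "c \<notin> (*) (of_nat p) ` OF"
  from OF_unit[OF c(1) this] have "c \<noteq> 0" "inverse c \<in> cyc_ints m"
    using OF_subset_cyc_ints by auto
  hence "1 \<in> (*) (1 - \<zeta> m) ` cyc_ints m"
    using ideal_rmult[OF one_minus_zeta_ideal, OF _ c(2), of "inverse c"] by simp
  thus False using one_minus_zeta_not_unit by blast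
qed

lemma p_in_one_minus_zeta: 
  assumes "m \<ge> 1" shows "of_nat p \<in> (*) (1 - \<zeta> m) ` cyc_ints m"
proof (rule principal_mem_trans[OF is_subring_cyc_ints _ one_minus_zeta_power_dvd_p[OF assms]])
  have "totient (p ^ m) = Suc (totient (p ^ m) - 1)" using p_pos by simp
  hence "(1 - \<zeta> m) ^ totient (p ^ m) = (1 - \<zeta> m) * (1 - \<zeta> m) ^ (totient (p ^ m) - 1)"
    by (metis power_Suc)
  thus "(1 - \<zeta> m) ^ totient (p ^ m) \<in> (*) (1 - \<zeta> m) ` cyc_ints m"
    by (auto intro!: imageI subring_power[OF is_subring_cyc_ints] one_minus_zeta_in_cyc_ints)
qed

text \<open>Passing to residues moves the question to \<open>OF\<close>, where the ideal of 1 -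
  \<zeta> cuts out the multiples of p, a prime ideal.\<close>

lemma one_minus_zeta_prime:
  assumes m: "m \<ge> 1" and x: "x \<in> cyc_ints m" and y: "y \<in> cyc_ints m"
    and xy: "x * y \<in> (*) (1 - \<zeta> m) ` cyc_ints m" (is "_ \<in> ?I")
  shows "x \<in> ?I \<or> y \<in> ?I"
proof -
  note I = one_minus_zeta_ideal[of m]
  obtain c where c: "c \<in> OF" "x - c \<in> ?I" using x by (rule cyc_ints_residue)
  obtain e where e: "e \<in> OF" "y - e \<in> ?I" using y by (rule cyc_ints_residue)
  have "c * e = x * y - (x - c) * y - c * (y - e)" by (simp add: algebra_simps)
  also have "\<dots> \<in> ?I"
    by (intro ideal_diff[OF I] ideal_lmult[OF I] ideal_rmult[OF I] xy c e y OF_subset_cyc_ints)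
  finally have "c * e \<in> (*) (of_nat p) ` OF"
    using OF_inter_one_minus_zeta subring_mult[OF is_subring_OF c(1) e(1)] by blast
  hence "c \<in> (*) (of_nat p) ` OF \<or> e \<in> (*) (of_nat p) ` OF" by (rule p_prime_in_OF[OF c(1) e(1)])
  moreover have "z \<in> ?I" if "z \<in> (*) (of_nat p) ` OF" for z
    using that by (auto intro!: ideal_rmult[OF I] p_in_one_minus_zeta m OF_subset_cyc_ints)
  ultimately have "c \<in> ?I \<or> e \<in> ?I" by blast
  moreover have "x \<in> ?I" if "c \<in> ?I" using ideal_add[OF I c(2) that] by simp
  moreover have "y \<in> ?I" if "e \<in> ?I" using ideal_add[OF I e(2) that] by simp
  ultimately show ?thesis by blast
qed

end

section \<open>The power series rings and the automorphism\<close>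

lemma fps_to_fls_sum: "fps_to_fls (sum f I) = (\<Sum>i\<in>I. fps_to_fls (f i))"
  by (induction I rule: infinite_finite_induct) auto

lemma is_subfield_fraction_field:
  assumes R: "is_subring R"
  shows "is_subfield (fraction_field R)"
  unfolding is_subfield_def
proof (intro conjI ballI)
  note mem = subring_mult[OF R] subring_add[OF R] subring_uminus[OF R] subring_zero[OF R] subring_one[OF R]
  show "0 \<in> fraction_field R" "1 \<in> fraction_field R"
    unfolding fraction_field_def using mem(4,5)
    by (force intro: exI[of _ 0] exI[of _ 1])+
  fix x assume "x \<in> fraction_field R"
  then obtain a b where x: "x = a / b" "a \<in> R" "b \<in> R" "b \<noteq> 0" by (auto simp: fraction_field_def)
  have "- x = (- a) / b" by (simp add: x)
  thus "- x \<in> fraction_field R" unfolding fraction_field_def using x mem by blast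
  show "inverse x \<in> fraction_field R"
  proof (cases "a = 0")
    case True
    thus ?thesis using \<open>0 \<in> fraction_field R\<close> by (simp add: x)
  next
    case False
    have "inverse x = b / a" by (simp add: x)
    thus ?thesis unfolding fraction_field_def using x False by blast
  qed
  fix y assume "y \<in> fraction_field R"
  then obtain c e where y: "y = c / e" "c \<in> R" "e \<in> R" "e \<noteq> 0" by (auto simp: fraction_field_def)
  have eqs: "x + y = (a * e + c * b) / (b * e)" "x * y = (a * c) / (b * e)" and "b * e \<noteq> 0"
    using x y by (auto simp: add_frac_eq)
  have quot: "u / (b * e) \<in> fraction_field R" if "u \<in> R" for u
    unfolding fraction_field_def using that mem(1)[OF x(3) y(3)] \<open>b * e \<noteq> 0\<close> by blast
  show "x + y \<in> fraction_field R" "x * y \<in> fraction_field R"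
    unfolding eqs by (intro quot mem x y)+
qed

lemma power_series_iff: "f \<in> power_series R \<longleftrightarrow> (\<exists>h. f = fps_to_fls h \<and> (\<forall>n. fps_nth h n \<in> R))"
  by (auto simp: power_series_def)

lemma fls_const_in_power_series: "is_subring R \<Longrightarrow> c \<in> R \<Longrightarrow> fls_const c \<in> power_series R"
  unfolding power_series_iff by (intro exI[of _ "fps_const c"]) (auto simp: subring_zero)

lemma fls_X_in_power_series: "is_subring R \<Longrightarrow> fls_X \<in> power_series R"
  unfolding power_series_iff
  by (intro exI[of _ fps_X]) (auto simp: subring_zero subring_one)

lemma fps_to_fls_in_principal_iff:
  assumes h: "\<And>n. fps_nth h n \<in> R"
  shows "fps_to_fls h \<in> (*) (fls_const c) ` power_series R \<longleftrightarrow> (\<forall>n. fps_nth h n \<in> (*) c ` R)"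
proof
  assume "fps_to_fls h \<in> (*) (fls_const c) ` power_series R"
  then obtain k where k: "fps_to_fls h = fls_const c * fps_to_fls k" "\<And>n. fps_nth k n \<in> R"
    by (auto simp: power_series_def)
  hence "fps_to_fls h = fps_to_fls (fps_const c * k)" by (simp add: fls_times_fps_to_fls)
  hence "h = fps_const c * k" by (simp only: fps_to_fls_eq_iff)
  hence "fps_nth h n = c * fps_nth k n" for n by simp
  thus "\<forall>n. fps_nth h n \<in> (*) c ` R" using k(2) by blast
next
  assume "\<forall>n. fps_nth h n \<in> (*) c ` R"
  hence "\<forall>n. \<exists>a\<in>R. fps_nth h n = c * a" by blast
  then obtain k where k: "\<And>n. fps_nth h n = c * k n" "\<And>n. k n \<in> R" by metis
  hence "h = fps_const c * Abs_fps k" by (intro fps_ext) auto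
  hence "fps_to_fls h = fls_const c * fps_to_fls (Abs_fps k)" by (simp add: fls_times_fps_to_fls)
  moreover have "fps_to_fls (Abs_fps k) \<in> power_series R" using k(2) by (auto simp: power_series_def)
  ultimately show "fps_to_fls h \<in> (*) (fls_const c) ` power_series R" by blast
qed

context cyclotomic_tower
begin

abbreviation N :: nat where "N \<equiv> p ^ s"
abbreviation Z :: "'a fls" where "Z \<equiv> fls_const (\<zeta> (r + s))"

lemma is_subring_A: "is_subring A" and is_subring_B: "is_subring B"
  unfolding A_def B_def by (intro is_subring_power_series is_subring_cyc_ints)+

lemmas B_closed = subring_mult[OF is_subring_B] subring_add[OF is_subring_B]
  subring_diff[OF is_subring_B] subring_uminus[OF is_subring_B] subring_zero[OF is_subring_B]
  subring_one[OF is_subring_B] subring_sum[OF is_subring_B] subring_prod[OF is_subring_B]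
  subring_power[OF is_subring_B] subring_of_nat[OF is_subring_B] subring_of_int[OF is_subring_B]

lemma A_subset_B: "a \<in> A \<Longrightarrow> a \<in> B"
  unfolding A_def B_def power_series_def using cyc_ints_mono by blast

lemma X_in_A: "1 + fls_X \<in> A"
  by (intro subring_add subring_one is_subring_A) (auto simp: A_def intro!: fls_X_in_power_series is_subring_cyc_ints)

lemma const_in_A: "c \<in> cyc_ints r \<Longrightarrow> fls_const c \<in> A"
  unfolding A_def by (intro fls_const_in_power_series is_subring_cyc_ints)

lemma const_in_B: "c \<in> cyc_ints (r + s) \<Longrightarrow> fls_const c \<in> B"
  unfolding B_def by (intro fls_const_in_power_series is_subring_cyc_ints)

lemma Z_in_B: "Z \<in> B"
  by (intro const_in_B zeta_in_cyc_ints)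

lemma Pi_in_B: "Pi \<in> B"
  unfolding Pi_def by (intro const_in_B one_minus_zeta_in_cyc_ints)

lemma Pi_eq: "Pi = 1 - Z"
  by (simp add: Pi_def flip: fls_minus_const)

lemma Pi_ideal: "is_ideal B ((*) Pi ` B)"
  by (intro is_ideal_principal is_subring_B Pi_in_B)

lemma N_pos: "N > 0" using p_pos by simp

lemma Z_pow_eq_iff: "a \<le> b \<Longrightarrow> Z ^ a = Z ^ b \<longleftrightarrow> p ^ (r + s) dvd b - a"
proof -
  have "fls_const x = fls_const y \<longleftrightarrow> x = y" for x y :: 'a
    using fls_minus_const[of x y] by (metis eq_iff_diff_eq_0 fls_const_eq_0_iff)
  thus "a \<le> b \<Longrightarrow> Z ^ a = Z ^ b \<longleftrightarrow> p ^ (r + s) dvd b - a"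
    by (simp add: zeta_pow_eq_iff flip: fls_const_power)
qed

lemma Z_nonzero: "Z \<noteq> 0" using zeta_nonzero by simp

lemma Z_pow_one_iff: "Z ^ k = 1 \<longleftrightarrow> p ^ (r + s) dvd k"
  using Z_pow_eq_iff[of 0 k] by auto

lemma Z_pow_N: "Z ^ N = fls_const (\<zeta> r)"
  by (simp add: zeta_pow_p_pow flip: fls_const_power)

lemma Z_pow_N_in_A: "Z ^ N \<in> A"
  unfolding Z_pow_N by (intro const_in_A zeta_in_cyc_ints)

text \<open>\<open>\<zeta> (r + s) ^ N\<close> is \<open>\<zeta> r\<close>, so after division of
  each exponent by N the quotient part can be moved into the coefficient.\<close>

lemma cyc_ints_decompose:
  assumes "x \<in> cyc_ints (r + s)"
  shows "\<exists>a. (\<forall>j. a j \<in> cyc_ints r) \<and> x = (\<Sum>j<N. a j * \<zeta> (r + s) ^ j)"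
proof -
  obtain f where f: "x = poly f (\<zeta> (r + s))" "\<And>i. poly.coeff f i \<in> OF"
    using cyc_ints_poly[OF assms] by blast
  note R = is_subring_cyc_ints[of r]
  define a where "a j = (\<Sum>i\<in>{i. i \<le> degree f \<and> i mod N = j}. poly.coeff f i * \<zeta> r ^ (i div N))" for j
  have "a j \<in> cyc_ints r" for j
    unfolding a_def by (intro subring_sum[OF R] subring_mult[OF R] subring_power[OF R]
        zeta_in_cyc_ints OF_subset_cyc_ints f(2))
  moreover have "x = (\<Sum>j<N. a j * \<zeta> (r + s) ^ j)"
  proof -
    have "x = (\<Sum>i\<le>degree f. poly.coeff f i * \<zeta> (r + s) ^ i)" by (simp add: f(1) poly_altdef)
    also have "\<dots> = (\<Sum>j<N. \<Sum>i\<in>{i\<in>{..degree f}. i mod N = j}. poly.coeff f i * \<zeta> (r + s) ^ i)"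
      using N_pos by (intro sum.group[symmetric]) auto
    also have "\<dots> = (\<Sum>j<N. a j * \<zeta> (r + s) ^ j)"
      unfolding a_def sum_distrib_right
    proof (intro sum.cong)
      fix j i assume "j \<in> {..<N}" "i \<in> {i. i \<le> degree f \<and> i mod N = j}"
      hence "\<zeta> (r + s) ^ i = \<zeta> (r + s) ^ (N * (i div N) + j)" by auto
      thus "poly.coeff f i * \<zeta> (r + s) ^ i = poly.coeff f i * \<zeta> r ^ (i div N) * \<zeta> (r + s) ^ j"
        by (simp add: power_add power_mult zeta_pow_p_pow)
    qed auto
    finally show ?thesis .
  qed
  ultimately show ?thesis by blast
qed

text \<open>As \<open>A\<close> is fixed by g, this decomposition reduces statements about the
  action of g on \<open>B\<close> to the powers of \<open>Z\<close>.\<close>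

lemma B_decompose:
  assumes "b \<in> B"
  shows "\<exists>a. (\<forall>j. a j \<in> A) \<and> b = (\<Sum>j<N. a j * Z ^ j)"
proof -
  obtain h where h: "b = fps_to_fls h" "\<And>n. fps_nth h n \<in> cyc_ints (r + s)"
    using assms by (auto simp: B_def power_series_def)
  have "\<forall>n. \<exists>a. (\<forall>j. a j \<in> cyc_ints r) \<and> fps_nth h n = (\<Sum>j<N. a j * \<zeta> (r + s) ^ j)"
    using cyc_ints_decompose h(2) by blast
  then obtain a where a: "\<And>n j. a n j \<in> cyc_ints r"
      "\<And>n. fps_nth h n = (\<Sum>j<N. a n j * \<zeta> (r + s) ^ j)" by metis
  have "h = (\<Sum>j<N. Abs_fps (\<lambda>n. a n j) * fps_const (\<zeta> (r + s) ^ j))"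
    by (intro fps_ext) (simp add: a(2) fps_sum_nth)
  hence "b = (\<Sum>j<N. fps_to_fls (Abs_fps (\<lambda>n. a n j)) * Z ^ j)"
    by (simp add: h(1) fps_to_fls_sum fls_times_fps_to_fls fls_const_power)
  moreover have "fps_to_fls (Abs_fps (\<lambda>n. a n j)) \<in> A" for j
    using a(1) by (auto simp: A_def power_series_def)
  ultimately show ?thesis by (intro exI[of _ "\<lambda>j. fps_to_fls (Abs_fps (\<lambda>n. a n j))"]) auto
qed

text \<open>Divisibility by the constant \<open>Pi\<close> can be tested on coefficients, so this is
  the independence of the powers of 1 + X over N-th powers, for the prime ideal of 1 -
  \<zeta>.\<close>

lemma Pi_dvd_if_Pi_dvd_frobenius_sum:
  assumes x: "\<And>j. j < N \<Longrightarrow> x j \<in> B"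
    and sum: "(\<Sum>j<N. x j ^ N * (1 + fls_X) ^ j) \<in> (*) Pi ` B" and j: "j < N"
  shows "x j \<in> (*) Pi ` B"
proof -
  let ?R = "cyc_ints (r + s)" and ?I = "(*) (1 - \<zeta> (r + s)) ` cyc_ints (r + s)"
  have m: "r + s \<ge> 1" using r_pos by simp
  have "\<forall>j. \<exists>h. j < N \<longrightarrow> x j = fps_to_fls h \<and> (\<forall>n. fps_nth h n \<in> ?R)"
    using x unfolding B_def power_series_iff by blast
  then obtain f where f: "\<And>j. j < N \<Longrightarrow> x j = fps_to_fls (f j)"
      "\<And>j n. j < N \<Longrightarrow> fps_nth (f j) n \<in> ?R" by metis
  define S where "S = (\<Sum>j<N. f j ^ N * (1 + fps_X) ^ j)"
  have S_eq: "fps_to_fls S = (\<Sum>j<N. x j ^ N * (1 + fls_X) ^ j)"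
  proof -
    have X1: "1 + fls_X = fps_to_fls (1 + fps_X)" by simp
    show ?thesis unfolding S_def fps_to_fls_sum X1
      by (intro sum.cong) (auto simp: f(1) fls_times_fps_to_fls fps_to_fls_power simp del: fps_to_fls_plus)
  qed
  have "fps_to_fls S \<in> B" unfolding S_eq
    using x A_subset_B[OF X_in_A] by (intro B_closed(1,7,9)) auto
  hence SR: "fps_nth S n \<in> ?R" for n by (auto simp: B_def power_series_def)
  have "\<forall>n. fps_nth S n \<in> ?I"
    using sum fps_to_fls_in_principal_iff[OF SR] by (simp add: S_eq Pi_def B_def)
  hence "fps_nth (f j) n \<in> ?I" for n
    unfolding S_def
    by (intro fps_ideal_if_frobenius_sum[OF one_minus_zeta_ideal prime_p p_in_one_minus_zeta[OF m]
          one_minus_zeta_prime[OF m] f(2) _ j]) auto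
  thus ?thesis using fps_to_fls_in_principal_iff[OF f(2)[OF j]] f(1)[OF j] by (simp add: B_def Pi_def)
qed

lemma is_subfield_qB: "is_subfield qB" and is_subfield_qA: "is_subfield qA"
  unfolding qA_def qB_def by (intro is_subfield_fraction_field is_subring_B is_subring_A)+

lemmas is_subring_qB = subfield_is_subring[OF is_subfield_qB]

lemmas qB_closed = subring_mult[OF is_subring_qB] subring_add[OF is_subring_qB]
  subring_diff[OF is_subring_qB] subring_uminus[OF is_subring_qB] subring_zero[OF is_subring_qB]
  subring_one[OF is_subring_qB] subring_sum[OF is_subring_qB] subring_prod[OF is_subring_qB]
  subring_power[OF is_subring_qB] subring_of_nat[OF is_subring_qB]

lemma B_subset_qB: "b \<in> B \<Longrightarrow> b \<in> qB"
  unfolding qB_def fraction_field_def using B_closed(6) by force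

lemma A_subset_qA: "a \<in> A \<Longrightarrow> a \<in> qA"
  unfolding qA_def fraction_field_def using subring_one[OF is_subring_A] by force

lemma qA_subset_qB: "a \<in> qA \<Longrightarrow> a \<in> qB"
  unfolding qA_def qB_def fraction_field_def using A_subset_B by blast

end

context cyclic_order
begin

lemma g_mem: "x \<in> qB \<Longrightarrow> g x \<in> qB" using g_bij by (auto simp: bij_betw_def)

lemma giter_mem: "x \<in> qB \<Longrightarrow> (g ^^ i) x \<in> qB"
  by (induction i) (auto intro: g_mem)

lemma giter_add: "x \<in> qB \<Longrightarrow> y \<in> qB \<Longrightarrow> (g ^^ i) (x + y) = (g ^^ i) x + (g ^^ i) y"
  by (induction i) (auto simp: g_add giter_mem)

lemma giter_mult: "x \<in> qB \<Longrightarrow> y \<in> qB \<Longrightarrow> (g ^^ i) (x * y) = (g ^^ i) x * (g ^^ i) y"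
  by (induction i) (auto simp: g_mult giter_mem)

lemma giter_fixes: "a \<in> qA \<Longrightarrow> (g ^^ i) a = a"
  by (induction i) (auto simp: g_fixes)

lemma giter_fixes_A: "a \<in> A \<Longrightarrow> (g ^^ i) a = a"
  by (intro giter_fixes A_subset_qA)

lemma giter_0 [simp]: "(g ^^ i) 0 = 0" and giter_1 [simp]: "(g ^^ i) 1 = 1"
  by (intro giter_fixes_A subring_zero subring_one is_subring_A)+

lemma giter_sum: "(\<And>a. a \<in> I \<Longrightarrow> f a \<in> qB) \<Longrightarrow> (g ^^ i) (sum f I) = (\<Sum>a\<in>I. (g ^^ i) (f a))"
proof (induction I rule: infinite_finite_induct)
  case (insert a I)
  thus ?case using qB_closed(7)[of I f] by (auto simp: giter_add)
qed auto

lemma giter_prod: "(\<And>a. a \<in> I \<Longrightarrow> f a \<in> qB) \<Longrightarrow> (g ^^ i) (prod f I) = (\<Prod>a\<in>I. (g ^^ i) (f a))"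
proof (induction I rule: infinite_finite_induct)
  case (insert a I)
  thus ?case using qB_closed(8)[of I f] by (auto simp: giter_mult)
qed auto

lemma giter_power: "x \<in> qB \<Longrightarrow> (g ^^ i) (x ^ n) = (g ^^ i) x ^ n"
  using giter_prod[of "{..<n}" "\<lambda>_. x" i] by simp

lemma giter_uminus: assumes "x \<in> qB" shows "(g ^^ i) (- x) = - (g ^^ i) x"
  using giter_add[OF assms qB_closed(4)[OF assms], of i] by (simp add: eq_neg_iff_add_eq_0 add.commute)

lemma giter_diff: "x \<in> qB \<Longrightarrow> y \<in> qB \<Longrightarrow> (g ^^ i) (x - y) = (g ^^ i) x - (g ^^ i) y"
  using giter_add[of x "- y" i] qB_closed(4)[of y] by (simp add: giter_uminus)

lemma giter_funpow_add: "(g ^^ i) ((g ^^ j) x) = (g ^^ (i + j)) x"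
  by (simp add: funpow_add)

section \<open>Galois action on the root of unity, norms and traces\<close>

definition gexp :: nat where "gexp = 1 + p ^ r"

lemma gexp_power: "\<exists>u. gexp ^ p ^ k = 1 + p ^ (r + k) * u \<and> \<not> p dvd u"
  unfolding gexp_def by (rule one_plus_prime_power[OF prime_p odd_p r_pos])

lemma giter_Z: "(g ^^ i) Z = Z ^ (gexp ^ i)"
proof (induction i)
  case (Suc i)
  have "(g ^^ Suc i) Z = (g ^^ 1) (Z ^ (gexp ^ i))" using Suc by simp
  also have "\<dots> = (g ^^ 1) Z ^ (gexp ^ i)" by (intro giter_power B_subset_qB Z_in_B)
  also have "(g ^^ 1) Z = Z ^ gexp" using g_zeta by (simp only: fls_const_power gexp_def funpow_0 One_nat_def funpow.simps o_apply id_apply)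
  finally show ?case by (simp flip: power_mult)
qed simp

lemma giter_B_decompose:
  assumes "\<And>j. a j \<in> A"
  shows "(g ^^ i) (\<Sum>j<N. a j * Z ^ j) = (\<Sum>j<N. a j * (g ^^ i) Z ^ j)"
  using assms by (simp add: giter_sum giter_mult giter_power giter_fixes_A B_subset_qB A_subset_B B_closed Z_in_B)

text \<open>The automorphism is given on the fraction field only. That it preserves \<open>B\<close>
  is read off from its values on the powers of \<open>Z\<close>.\<close>

lemma giter_B: assumes "b \<in> B" shows "(g ^^ i) b \<in> B"
proof -
  obtain a where "\<And>j. a j \<in> A" "b = (\<Sum>j<N. a j * Z ^ j)" using B_decompose[OF assms] by blast
  thus ?thesis using giter_B_decompose[of a i]
    by (simp add: giter_Z B_closed Z_in_B A_subset_B)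
qed

text \<open>Total ramification in explicit form: every power of \<open>Z\<close> is congruent to 1
  modulo \<open>Pi\<close>, hence also to its conjugates.\<close>

lemma giter_cong: assumes "b \<in> B" shows "(g ^^ i) b - b \<in> (*) Pi ` B"
proof -
  obtain a where a: "\<And>j. a j \<in> A" "b = (\<Sum>j<N. a j * Z ^ j)" using B_decompose[OF assms] by blast
  have e: "(g ^^ i) b - b = (\<Sum>j<N. a j * ((g ^^ i) Z ^ j - Z ^ j))"
    by (simp add: a(2) giter_B_decompose[OF a(1)] right_diff_distrib sum_subtractf)
  have m: "1 - Z ^ k \<in> (*) Pi ` B" for k
    unfolding Pi_eq by (intro one_minus_power_mem is_subring_B Z_in_B)
  have "(g ^^ i) Z ^ j - Z ^ j \<in> (*) Pi ` B" for j
    using ideal_diff[OF Pi_ideal m[of j] m[of "gexp ^ i * j"]] by (simp add: giter_Z power_mult)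
  thus ?thesis unfolding e using a(1)
    by (intro ideal_sum[OF Pi_ideal] ideal_lmult[OF Pi_ideal]) (auto intro: A_subset_B)
qed

lemma giter_N_Z: "(g ^^ N) Z = Z"
proof -
  obtain u where u: "gexp ^ N = 1 + p ^ (r + s) * u"
    using gexp_power[of s] by blast
  have "Z ^ (p ^ (r + s) * u) = 1" by (simp add: Z_pow_one_iff)
  thus ?thesis by (simp add: giter_Z u power_add)
qed

lemma giter_N_B: assumes "b \<in> B" shows "(g ^^ N) b = b"
proof -
  obtain a where a: "\<And>j. a j \<in> A" "b = (\<Sum>j<N. a j * Z ^ j)" using B_decompose[OF assms] by blast
  thus ?thesis by (simp add: giter_B_decompose[OF a(1)] giter_N_Z)
qed

lemma giter_N: assumes "x \<in> qB" shows "(g ^^ N) x = x"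
proof -
  obtain a b where x: "x = a / b" "a \<in> B" "b \<in> B" "b \<noteq> 0"
    using assms by (auto simp: qB_def fraction_field_def)
  have "(g ^^ N) (x * b) = (g ^^ N) x * (g ^^ N) b" by (intro giter_mult assms B_subset_qB x)
  moreover have "x * b = a" using x by simp
  ultimately have "x * b = (g ^^ N) x * b" using x giter_N_B by metis
  thus ?thesis using x(4) by simp
qed

lemma giter_mod_N: assumes "x \<in> qB" shows "(g ^^ (i mod N)) x = (g ^^ i) x"
  by (rule funpow_mod_eq[OF giter_N[OF assms]])

text \<open>If two conjugates agreed, p ^ (r + s) would divide a power of \<open>gexp\<close> times
  gexp ^ (j - i) - 1. The first factor is prime to p, and the order of \<open>gexp\<close> modulo p
  ^ (r + s) is a multiple of N.\<close>

lemma giter_Z_inj: "inj_on (\<lambda>i. (g ^^ i) Z) {..<N}"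
proof (rule linorder_inj_onI)
  fix i j assume ij: "i < j" "i \<in> {..<N}" "j \<in> {..<N}"
  show "(g ^^ i) Z \<noteq> (g ^^ j) Z"
  proof
    assume "(g ^^ i) Z = (g ^^ j) Z"
    hence "p ^ (r + s) dvd gexp ^ j - gexp ^ i"
      using Z_pow_eq_iff[of "gexp ^ i" "gexp ^ j"] ij by (simp add: giter_Z power_increasing gexp_def)
    also have "gexp ^ j - gexp ^ i = gexp ^ i * (gexp ^ (j - i) - 1)"
      using ij by (simp add: diff_mult_distrib2 flip: power_add)
    finally have "p ^ (r + s) dvd gexp ^ i * (gexp ^ (j - i) - 1)" .
    moreover have "coprime (p ^ (r + s)) (gexp ^ i)"
    proof -
      have "\<not> p dvd gexp" using r_pos prime_p unfolding gexp_def
        by (metis One_nat_def Suc_le_eq dvd_add_left_iff dvd_power not_prime_unit)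
      thus ?thesis using prime_p by (simp add: prime_imp_coprime)
    qed
    ultimately have "p ^ (r + s) dvd gexp ^ (j - i) - 1" by (simp add: coprime_dvd_mult_right_iff)
    hence "N dvd j - i" by (rule one_plus_prime_power_order[OF prime_p odd_p r_pos, folded gexp_def])
    thus False using ij by (auto dest: dvd_imp_le)
  qed
qed auto

text \<open>The power of \<open>Z\<close> has order p ^ (r + k), and \<open>g ^^ p ^ k\<close> acts
  by an exponent that is 1 modulo p ^ (r + k).\<close>

lemma giter_Z_pow:
  assumes k: "k \<le> s"
  shows "(g ^^ (p ^ k * m)) (Z ^ p ^ (s - k)) = Z ^ p ^ (s - k)"
proof -
  obtain u where u: "gexp ^ p ^ k = 1 + p ^ (r + k) * u"
    using gexp_power[of k] by blast
  have "(g ^^ p ^ k) (Z ^ p ^ (s - k)) = Z ^ (gexp ^ p ^ k * p ^ (s - k))"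
    by (simp add: giter_power giter_Z B_subset_qB Z_in_B power_mult)
  also have "gexp ^ p ^ k * p ^ (s - k) = p ^ (s - k) + p ^ (r + k) * p ^ (s - k) * u"
    by (simp add: u algebra_simps)
  also have "p ^ (r + k) * p ^ (s - k) = p ^ (r + s)" using k by (simp flip: power_add)
  also have "Z ^ (p ^ (s - k) + p ^ (r + s) * u) = Z ^ p ^ (s - k)"
    using Z_pow_one_iff[of "p ^ (r + s) * u"] by (simp add: power_add)
  finally have "(g ^^ p ^ k) (Z ^ p ^ (s - k)) = Z ^ p ^ (s - k)" .
  thus ?thesis by (induction m) (auto simp: giter_funpow_add[symmetric] funpow_add)
qed

text \<open>The left side is the norm of \<open>Pi\<close> to the fixed field of
  \<open>g ^^ p ^ k\<close>. With h = p ^ (s - k), the conjugates of \<open>Z\<close> that occur are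
  h distinct roots of X ^ h - Z ^ h, which is evaluated at 1.\<close>

lemma prod_giter_Pi:
  assumes k: "k \<le> s"
  shows "(\<Prod>m<p ^ (s - k). (g ^^ (p ^ k * m)) Pi) = 1 - Z ^ p ^ (s - k)"
proof -
  let ?h = "p ^ (s - k)"
  have h: "?h > 0" using p_pos by simp
  have N: "N = p ^ k * ?h" using k by (simp flip: power_add)
  have "(\<Prod>m\<in>{..<?h}. 1 - (g ^^ (p ^ k * m)) Z) = 1 ^ card {..<?h} - Z ^ ?h"
  proof (rule prod_roots_of_power)
    show "inj_on (\<lambda>m. (g ^^ (p ^ k * m)) Z) {..<?h}"
    proof (rule inj_onI)
      fix a b assume "a \<in> {..<?h}" "b \<in> {..<?h}" "(g ^^ (p ^ k * a)) Z = (g ^^ (p ^ k * b)) Z"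
      moreover from this have "p ^ k * a < N" "p ^ k * b < N" using p_pos by (auto simp: N)
      ultimately have "p ^ k * a = p ^ k * b" by (intro inj_onD[OF giter_Z_inj]) auto
      thus "a = b" using p_pos by simp
    qed
    show "(g ^^ (p ^ k * m)) Z ^ card {..<?h} = Z ^ ?h" for m
      using giter_Z_pow[OF k, of m] by (simp add: giter_power B_subset_qB Z_in_B)
  qed (use h in auto)
  moreover have "(g ^^ i) Pi = 1 - (g ^^ i) Z" for i
    by (simp add: Pi_eq giter_diff B_subset_qB Z_in_B B_closed)
  ultimately show ?thesis by simp
qed

lemma sum_giter_shift:
  assumes "x \<in> qB"
  shows "(\<Sum>i<N. (g ^^ (i + j)) x) = (\<Sum>i<N. (g ^^ i) x)"
proof (induction j)
  case (Suc j)
  have "(\<Sum>i<N. (g ^^ (i + Suc j)) x) = (\<Sum>i\<in>{Suc 0..<Suc N}. (g ^^ (i + j)) x)"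
    by (subst sum.shift_bounds_Suc_ivl) (simp add: lessThan_atLeast0)
  also have "\<dots> = (\<Sum>i\<in>{0..<N}. (g ^^ (i + j)) x) - (g ^^ j) x + (g ^^ (N + j)) x"
  proof -
    have "{0..<Suc N} = insert 0 {Suc 0..<Suc N}" by auto
    hence "(\<Sum>i\<in>{0..<Suc N}. (g ^^ (i + j)) x) = (g ^^ j) x + (\<Sum>i\<in>{Suc 0..<Suc N}. (g ^^ (i + j)) x)"
      by simp
    moreover have "(\<Sum>i\<in>{0..<Suc N}. (g ^^ (i + j)) x) = (\<Sum>i\<in>{0..<N}. (g ^^ (i + j)) x) + (g ^^ (N + j)) x"
      by simp
    ultimately show ?thesis by (simp add: algebra_simps)
  qed
  also have "(g ^^ (N + j)) x = (g ^^ j) x"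
    using giter_N[OF giter_mem[OF assms]] by (simp add: funpow_add)
  finally show ?case using Suc by (simp add: lessThan_atLeast0)
qed simp

text \<open>Some power of g multiplies Z ^ j by a nontrivial p-th root of unity that lies in
  \<open>A\<close>. The trace is invariant under g, so it equals itself times this root.\<close>

lemma trace_Z_pow:
  assumes j: "0 < j" "j < N"
  shows "(\<Sum>i<N. (g ^^ i) (Z ^ j)) = 0"
proof -
  obtain a j' where a: "j = p ^ a * j'" "\<not> p dvd j'"
    using multiplicity_decompose'[of j p] j prime_p by (metis not_prime_unit neq0_conv)
  have "p ^ a \<le> j" using j a by (intro dvd_imp_le) auto
  hence as: "a < s" using j(2) p_gt_2 by (metis One_nat_def Suc_lessD le_less_trans numeral_2_eq_2 power_less_imp_less_exp)
  \<comment> \<open>With this \<open>b\<close>, \<open>g ^^ p ^ b\<close> changes the exponent j, of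
    valuation a, by p ^ (r + s - 1) times a number prime to p: one factor p short of the order of
    \<open>Z\<close>.\<close>
  define b where "b = s - 1 - a"
  obtain u where u: "gexp ^ p ^ b = 1 + p ^ (r + b) * u" "\<not> p dvd u"
    using gexp_power[of b] by blast
  define \<omega> where "\<omega> = Z ^ (p ^ (r + s - 1) * (j' * u))"
  have "p ^ (r + b) * p ^ a = p ^ (r + s - 1)"
    using as by (simp add: b_def flip: power_add)
  hence e: "p ^ (r + b) * u * j = p ^ (r + s - 1) * (j' * u)"
    by (simp add: a(1) algebra_simps)
  have gz: "(g ^^ p ^ b) (Z ^ j) = \<omega> * Z ^ j"
  proof -
    have "(g ^^ p ^ b) (Z ^ j) = Z ^ ((1 + p ^ (r + b) * u) * j)"
      by (simp only: giter_power[OF B_subset_qB[OF Z_in_B]] giter_Z u(1) power_mult)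
    also have "(1 + p ^ (r + b) * u) * j = p ^ (r + s - 1) * (j' * u) + j"
      by (subst distrib_right, subst e) simp
    finally show ?thesis by (simp only: \<omega>_def power_add)
  qed
  have "\<omega> \<noteq> 1"
  proof
    assume "\<omega> = 1"
    hence "p ^ (r + s) dvd p ^ (r + s - 1) * (j' * u)" by (simp add: \<omega>_def Z_pow_one_iff)
    moreover have "p ^ (r + s) = p ^ (r + s - 1) * p" using r_pos by (simp flip: power_Suc2)
    ultimately have "p dvd j' * u" using p_pos by simp
    thus False using a(2) u(2) prime_p by (simp add: prime_dvd_mult_iff)
  qed
  have "\<omega> = (Z ^ N) ^ (p ^ (r - 1) * (j' * u))"
    using r_pos by (simp add: \<omega>_def algebra_simps flip: power_mult power_add)
  hence \<omega>A: "\<omega> \<in> A" by (simp add: subring_power[OF is_subring_A] Z_pow_N_in_A)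
  have Zj: "Z ^ j \<in> qB" "\<omega> \<in> qB"
    using \<omega>A by (auto intro: B_subset_qB B_closed(9) Z_in_B A_subset_B)
  have "(\<Sum>i<N. (g ^^ i) (Z ^ j)) = (\<Sum>i<N. (g ^^ (i + p ^ b)) (Z ^ j))"
    by (rule sum_giter_shift[symmetric, OF Zj(1)])
  also have "\<dots> = \<omega> * (\<Sum>i<N. (g ^^ i) (Z ^ j))"
    using Zj by (simp add: funpow_add gz giter_mult giter_fixes_A[OF \<omega>A] sum_distrib_left)
  finally show ?thesis using \<open>\<omega> \<noteq> 1\<close> by simp
qed

text \<open>The traces of the other powers of \<open>Z\<close> vanish, so only the coefficient of Z
  ^ 0 contributes, and it does so N times.\<close>

lemma trace_B:
  assumes "b \<in> B"
  shows "(\<Sum>i<N. (g ^^ i) b) \<in> (*) (of_nat N) ` A"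
proof -
  obtain a where a: "\<And>j. a j \<in> A" "b = (\<Sum>j<N. a j * Z ^ j)" using B_decompose[OF assms] by blast
  have "(\<Sum>i<N. (g ^^ i) b) = (\<Sum>i<N. \<Sum>j<N. a j * (g ^^ i) (Z ^ j))"
    using a(1) by (simp add: a(2) giter_B_decompose giter_power B_subset_qB Z_in_B)
  also have "\<dots> = (\<Sum>j<N. a j * (\<Sum>i<N. (g ^^ i) (Z ^ j)))"
    by (subst sum.swap) (simp add: sum_distrib_left)
  also have "\<dots> = (\<Sum>j<N. if j = 0 then of_nat N * a 0 else 0)"
    by (intro sum.cong) (auto simp: trace_Z_pow)
  also have "\<dots> = of_nat N * a 0" using N_pos by (simp add: sum.delta)
  finally show ?thesis using a(1) by blast
qed

text \<open>Over the orbit of length $p^s$ each summand recurs $p^{s-k}$ times, so no description of the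
  ring fixed by $g^{p^k}$ is needed.\<close>

lemma partial_trace_B:
  assumes b: "b \<in> B" and k: "k \<le> s" and fix_b: "(g ^^ p ^ k) b = b"
  shows "(\<Sum>i<p ^ k. (g ^^ i) b) \<in> (*) (of_nat (p ^ k)) ` A"
proof -
  let ?h = "p ^ (s - k)"
  have N: "N = ?h * p ^ k" using k by (simp flip: power_add)
  have per: "(g ^^ (m * p ^ k)) b = b" for m
    by (induction m) (auto simp: funpow_add fix_b)
  have "(\<Sum>i<N. (g ^^ i) b) = (\<Sum>m<?h. \<Sum>i\<in>{m * p ^ k..<m * p ^ k + p ^ k}. (g ^^ i) b)"
    unfolding N by (rule sum.nat_group[symmetric])
  also have "\<dots> = (\<Sum>m<?h. \<Sum>i<p ^ k. (g ^^ i) b)"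
  proof (rule sum.cong[OF refl])
    fix m
    have "(\<Sum>i\<in>{m * p ^ k..<m * p ^ k + p ^ k}. (g ^^ i) b) = (\<Sum>i<p ^ k. (g ^^ (i + m * p ^ k)) b)"
      using sum.shift_bounds_nat_ivl[of "\<lambda>i. (g ^^ i) b" 0 "m * p ^ k" "p ^ k"]
      by (simp add: lessThan_atLeast0 add.commute)
    thus "(\<Sum>i\<in>{m * p ^ k..<m * p ^ k + p ^ k}. (g ^^ i) b) = (\<Sum>i<p ^ k. (g ^^ i) b)"
      by (simp add: funpow_add per)
  qed
  also have "\<dots> = of_nat ?h * (\<Sum>i<p ^ k. (g ^^ i) b)" by simp
  finally have e: "(\<Sum>i<N. (g ^^ i) b) = of_nat ?h * (\<Sum>i<p ^ k. (g ^^ i) b)" .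
  obtain a where a: "a \<in> A" "(\<Sum>i<N. (g ^^ i) b) = of_nat N * a" using trace_B[OF b] by auto
  have "of_nat ?h * (\<Sum>i<p ^ k. (g ^^ i) b) = of_nat ?h * (of_nat (p ^ k) * a)"
    using e a(2) by (simp add: N mult.assoc)
  hence "(\<Sum>i<p ^ k. (g ^^ i) b) = of_nat (p ^ k) * a"
    using p_pos by (subst (asm) mult_left_cancel) auto
  thus ?thesis using a(1) by blast
qed

end

section \<open>Splittings and the reduced norm\<close>

text \<open>For i \<le> n this is the index j below n with i + j congruent to k; adding n first
  keeps the subtraction of natural numbers exact.\<close>

definition mod_diff :: "nat \<Rightarrow> nat \<Rightarrow> nat \<Rightarrow> nat" where
  "mod_diff n k i = (k + n - i) mod n"

lemma mod_diff_less: "n > 0 \<Longrightarrow> mod_diff n k i < n"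
  by (simp add: mod_diff_def)

lemma add_mod_diff: "i \<le> n \<Longrightarrow> k < n \<Longrightarrow> (i + mod_diff n k i) mod n = k"
  by (simp add: mod_diff_def mod_add_right_eq)

lemma mod_diff_unique:
  assumes "i \<le> n" "j < (n::nat)" "(i + j) mod n = k mod n"
  shows "mod_diff n k i = j"
proof -
  have "k + n - i = k + (n - i)" using assms by simp
  hence "(k + n - i) mod n = (k mod n + (n - i)) mod n" by (simp only: mod_add_left_eq)
  also have "\<dots> = (i + j + (n - i)) mod n" by (simp add: assms(3)[symmetric] mod_add_left_eq)
  also have "\<dots> = j" using assms by simp
  finally show ?thesis by (simp add: mod_diff_def)
qed

lemma mod_diff_eq_iff:
  "i < n \<Longrightarrow> j < n \<Longrightarrow> k < n \<Longrightarrow> (i + j) mod n = k \<longleftrightarrow> j = mod_diff n k i"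
  using mod_diff_unique[of i n j k] add_mod_diff[of i n k] by auto

lemma bij_betw_add_mod:
  assumes "n > 0"
  shows "bij_betw (\<lambda>a. (i + a) mod n) {..<n} {..<n::nat}"
proof -
  have "inj_on (\<lambda>a. (i + a) mod n) {..<n}"
  proof (rule inj_onI)
    fix a b assume ab: "a \<in> {..<n}" "b \<in> {..<n}" "(i + a) mod n = (i + b) mod n"
    have "(i mod n + a) mod n = (i + b) mod n" "(i mod n + b) mod n = (i + b) mod n"
      using ab by (simp_all add: mod_add_left_eq)
    thus "a = b" using mod_diff_unique[of "i mod n" n _ "i + b"] ab assms by (metis lessThan_iff mod_le_divisor)
  qed
  moreover have "(\<lambda>a. (i + a) mod n) ` {..<n} \<subseteq> {..<n}" using assms by auto
  ultimately show ?thesis by (simp add: bij_betw_def endo_inj_surj)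
qed

text \<open>Carries in the addition of exponents of u modulo N: each carry yields a factor
  \<open>1 + fls_X\<close>, and this identity makes their number independent of the
  bracketing.\<close>

lemma div_add_div: "(a::nat) div n + (a mod n + b) div n = (a + b) div n"
proof (cases "n = 0")
  case False
  have "a + b = a mod n + b + a div n * n" by simp
  hence "(a + b) div n = (a mod n + b + a div n * n) div n" by (rule arg_cong)
  thus ?thesis using div_mult_self1[OF False, of "a mod n + b" "a div n"] by linarith
qed simp

context cyclic_order
begin

declare p_pos [simp]

lemma p_nonzero [simp]: "p \<noteq> 0" using p_pos by linarith

abbreviation T :: "'a fls" where "T \<equiv> 1 + fls_X"
abbreviation \<delta> :: "nat \<Rightarrow> nat \<Rightarrow> nat" where "\<delta> \<equiv> mod_diff N"

lemma T_nonzero: "T \<noteq> 0"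
proof
  assume "T = 0"
  hence "fls_nth T 0 = 0" by (simp only: fls_zero_nth)
  thus False by simp
qed

lemma T_pow_in_A: "T ^ n \<in> A"
  by (intro subring_power is_subring_A X_in_A)

lemma T_pow_in_qB: "T ^ n \<in> qB"
  by (rule B_subset_qB[OF A_subset_B[OF T_pow_in_A]])

lemma carrier_D: "carrier D = {x. (\<forall>j<N. x j \<in> qB) \<and> (\<forall>j\<ge>N. x j = 0)}"
  and one_D: "\<one>\<^bsub>D\<^esub> = scalar 1"
  and add_D: "x \<oplus>\<^bsub>D\<^esub> y = (\<lambda>j. x j + y j)"
  by (simp_all add: D_def scalar_def)

lemma carrier_D_mem: "x \<in> carrier D \<Longrightarrow> x j \<in> qB"
  by (cases "j < N") (auto simp: carrier_D qB_closed)

text \<open>Row \<open>i\<close> holds the coordinates of $u^i d$, so this is right multiplication by \<open>d\<close> on the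
  left \<open>qB\<close>-space $D$; acting on rows, it is multiplicative.\<close>

definition rmat :: "(nat \<Rightarrow> 'a fls) \<Rightarrow> 'a fls mat" where
  "rmat d = mat N N (\<lambda>(i, k). (g ^^ i) (d (\<delta> k i)) * T ^ ((i + \<delta> k i) div N))"

lemma rmat_carrier: "rmat d \<in> carrier_mat N N"
  by (simp add: rmat_def)

lemma rmat_nth: "i < N \<Longrightarrow> k < N \<Longrightarrow> rmat d $$ (i, k) = (g ^^ i) (d (\<delta> k i)) * T ^ ((i + \<delta> k i) div N)"
  by (simp add: rmat_def)

text \<open>The product is the row of coefficients of \<open>x\<close> times the matrix of
  \<open>y\<close>. For given i and k exactly one j contributes, and the case distinction on the
  wrap-around becomes a power of \<open>T\<close> with exponent 0 or 1.\<close>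

lemma mult_D:
  "(x \<otimes>\<^bsub>D\<^esub> y) k = (if k < N then \<Sum>i<N. x i * rmat y $$ (i, k) else 0)"
proof -
  have t: "(if i + j < N then 1 else T) = T ^ ((i + j) div N)" if "i < N" "j < N" for i j
  proof (cases "i + j < N")
    case False
    hence "(i + j) div N = 1" using that by (intro div_nat_eqI) auto
    thus ?thesis using False by simp
  qed simp
  have "(x \<otimes>\<^bsub>D\<^esub> y) k = (\<Sum>i<N. \<Sum>j<N. if (i + j) mod N = k
      then x i * (g ^^ i) (y j) * (if i + j < N then 1 else T) else 0)" by (simp add: D_def)
  also have "\<dots> = (if k < N then \<Sum>i<N. x i * rmat y $$ (i, k) else 0)"
  proof (cases "k < N")
    case True
    have "(\<Sum>j<N. if (i + j) mod N = k then x i * (g ^^ i) (y j) * (if i + j < N then 1 else T) else 0)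
      = x i * rmat y $$ (i, k)" if i: "i < N" for i
    proof -
      have "(\<Sum>j<N. if (i + j) mod N = k then x i * (g ^^ i) (y j) * (if i + j < N then 1 else T) else 0)
        = (\<Sum>j<N. if j = \<delta> k i then x i * (g ^^ i) (y j) * T ^ ((i + j) div N) else 0)"
        using i True by (intro sum.cong) (auto simp: mod_diff_eq_iff t)
      thus ?thesis using i True N_pos by (simp add: mod_diff_less rmat_nth mult.assoc)
    qed
    thus ?thesis using True by simp
  next
    case False
    hence "(i + j) mod N \<noteq> k" for i j using N_pos by (metis mod_less_divisor)
    thus ?thesis using False by simp
  qed
  finally show ?thesis .
qed

lemma rmat_mem_qB: "x \<in> carrier D \<Longrightarrow> i < N \<Longrightarrow> k < N \<Longrightarrow> rmat x $$ (i, k) \<in> qB"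
  by (simp add: rmat_nth qB_closed giter_mem carrier_D_mem T_pow_in_qB)

lemma mult_D_closed: "x \<in> carrier D \<Longrightarrow> y \<in> carrier D \<Longrightarrow> x \<otimes>\<^bsub>D\<^esub> y \<in> carrier D"
  by (subst carrier_D)
     (auto simp: mult_D intro!: qB_closed(7) qB_closed(1)[OF carrier_D_mem[of x] rmat_mem_qB[of y]])

text \<open>This is associativity of the multiplication of D in coordinates. Applying
  \<open>g ^^ i\<close> to row a of the matrix of \<open>y\<close> gives row (i + a) mod N, and the
  powers of \<open>T\<close> agree by counting carries.\<close>

lemma rmat_mult:
  assumes x: "x \<in> carrier D" and y: "y \<in> carrier D"
  shows "rmat (x \<otimes>\<^bsub>D\<^esub> y) = rmat x * rmat y"
proof (rule eq_matI)
  fix i l assume "i < dim_row (rmat x * rmat y)" "l < dim_col (rmat x * rmat y)"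
  hence il: "i < N" "l < N" by (auto simp: rmat_def)
  define m where "m = \<delta> l i"
  have m: "m < N" "(i + m) mod N = l" using il N_pos by (auto simp: m_def mod_diff_less add_mod_diff)
  have "rmat (x \<otimes>\<^bsub>D\<^esub> y) $$ (i, l) = (g ^^ i) (\<Sum>a<N. x a * rmat y $$ (a, m)) * T ^ ((i + m) div N)"
    using il m by (simp add: rmat_nth mult_D flip: m_def)
  also have "\<dots> = (\<Sum>a<N. (g ^^ i) (x a) * (g ^^ i) (rmat y $$ (a, m)) * T ^ ((i + m) div N))"
    using m x y by (subst giter_sum)
      (auto simp: sum_distrib_right giter_mult rmat_mem_qB carrier_D_mem qB_closed)
  also have "\<dots> = (\<Sum>a<N. rmat x $$ (i, (i + a) mod N) * rmat y $$ ((i + a) mod N, l))"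
  proof (rule sum.cong[OF refl])
    fix a assume "a \<in> {..<N}"
    hence a: "a < N" by simp
    define b where "b = \<delta> m a"
    have b: "b < N" "(a + b) mod N = m" using a m N_pos by (auto simp: b_def mod_diff_less add_mod_diff)
    have d1: "\<delta> ((i + a) mod N) i = a" using il a by (intro mod_diff_unique) auto
    have "((i + a) mod N + b) mod N = (i + (a + b) mod N) mod N"
      by (metis add.assoc mod_add_left_eq mod_add_right_eq)
    hence d2: "\<delta> l ((i + a) mod N) = b" using b m il N_pos by (intro mod_diff_unique) auto
    have "(i + a) div N + ((i + a) mod N + b) div N = (a + b) div N + (m + i) div N"
      using div_add_div[of "i + a" N b] div_add_div[of "a + b" N i] b(2) by (simp add: add_ac)
    hence e: "T ^ ((i + a) div N) * T ^ (((i + a) mod N + b) div N) = T ^ ((a + b) div N) * T ^ ((i + m) div N)"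
      by (simp add: add.commute flip: power_add)
    have "(g ^^ i) (rmat y $$ (a, m)) = (g ^^ (i + a)) (y b) * T ^ ((a + b) div N)"
    proof -
      have "(g ^^ i) ((g ^^ a) (y b) * T ^ ((a + b) div N))
         = (g ^^ i) ((g ^^ a) (y b)) * (g ^^ i) (T ^ ((a + b) div N))"
        using y by (intro giter_mult giter_mem carrier_D_mem T_pow_in_qB)
      thus ?thesis using a m by (simp add: rmat_nth giter_funpow_add giter_fixes_A T_pow_in_A flip: b_def)
    qed
    moreover have "rmat x $$ (i, (i + a) mod N) = (g ^^ i) (x a) * T ^ ((i + a) div N)"
      using il N_pos by (simp add: rmat_nth d1)
    moreover have "rmat y $$ ((i + a) mod N, l) = (g ^^ (i + a)) (y b) * T ^ (((i + a) mod N + b) div N)"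
      using il N_pos giter_mod_N[OF carrier_D_mem[OF y]] by (simp add: rmat_nth d2)
    ultimately show "(g ^^ i) (x a) * (g ^^ i) (rmat y $$ (a, m)) * T ^ ((i + m) div N)
        = rmat x $$ (i, (i + a) mod N) * rmat y $$ ((i + a) mod N, l)"
      using e by (simp add: mult_ac)
  qed
  also have "\<dots> = (\<Sum>k<N. rmat x $$ (i, k) * rmat y $$ (k, l))"
    by (rule sum.reindex_bij_betw[OF bij_betw_add_mod[OF N_pos]])
  also have "\<dots> = (rmat x * rmat y) $$ (i, l)"
    using il rmat_carrier[of x] rmat_carrier[of y]
    by (simp add: scalar_prod_def lessThan_atLeast0)
  finally show "rmat (x \<otimes>\<^bsub>D\<^esub> y) $$ (i, l) = (rmat x * rmat y) $$ (i, l)" .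
qed (auto simp: rmat_def)

lemma \<delta>_self: "i < N \<Longrightarrow> \<delta> k i = 0 \<longleftrightarrow> k = i" if "k < N"
  using add_mod_diff[of i N k] mod_diff_unique[of i N 0 k] that by auto

lemma \<delta>_refl: "j < N \<Longrightarrow> \<delta> j j = 0"
  by (simp add: \<delta>_self)

lemma rmat_scalar:
  assumes "a \<in> qA"
  shows "rmat (scalar a) = a \<cdot>\<^sub>m 1\<^sub>m N"
  by (rule eq_matI) (auto simp: rmat_nth scalar_def \<delta>_self \<delta>_refl giter_fixes[OF assms] rmat_def)

text \<open>With this witness the choice operator in \<open>nr\<close> does select a
  splitting.\<close>

lemma splitting_rmat: "splitting rmat"
proof -
  have "rmat (x \<oplus>\<^bsub>D\<^esub> y) = rmat x + rmat y" if "x \<in> carrier D" "y \<in> carrier D" for x y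
    using that by (intro eq_matI) (auto simp: rmat_def add_D giter_add carrier_D_mem distrib_right)
  moreover have "rmat \<one>\<^bsub>D\<^esub> = 1\<^sub>m N"
    using rmat_scalar[of 1] subring_one[OF subfield_is_subring[OF is_subfield_qA]]
    by (auto simp: one_D intro!: eq_matI)
  ultimately show ?thesis
    unfolding splitting_def ring_hom_def
    by (auto simp: ring_mat_simps rmat_carrier rmat_mult rmat_scalar)
qed

section \<open>Monomials of the cyclic algebra\<close>

definition upow :: "nat \<Rightarrow> nat \<Rightarrow> 'a fls" where
  "upow i = (\<lambda>j. if j = i then 1 else 0)"

lemma upow_carrier: "i < N \<Longrightarrow> upow i \<in> carrier D"
  by (auto simp: carrier_D upow_def qB_closed)

lemma scalar_carrier: "b \<in> qB \<Longrightarrow> scalar b \<in> carrier D"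
  using N_pos by (auto simp: carrier_D scalar_def qB_closed)

lemma scalar_mult:
  assumes "x \<in> carrier D"
  shows "scalar b \<otimes>\<^bsub>D\<^esub> x = (\<lambda>j. b * x j)"
proof
  fix k
  have "(\<Sum>i<N. scalar b i * rmat x $$ (i, k)) = (\<Sum>i<N. if i = 0 then b * rmat x $$ (0, k) else 0)"
    by (intro sum.cong) (auto simp: scalar_def)
  also have "\<dots> = b * rmat x $$ (0, k)" using N_pos by (simp add: sum.delta)
  finally have "(scalar b \<otimes>\<^bsub>D\<^esub> x) k = (if k < N then b * rmat x $$ (0, k) else 0)"
    by (simp add: mult_D)
  moreover have "rmat x $$ (0, k) = x k" if "k < N"
    using that N_pos by (simp add: rmat_nth mod_diff_def)
  ultimately show "(scalar b \<otimes>\<^bsub>D\<^esub> x) k = b * x k"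
    using assms by (auto simp: carrier_D not_less)
qed

lemma upow_mult:
  assumes "i < N"
  shows "upow i \<otimes>\<^bsub>D\<^esub> x = (\<lambda>k. if k < N then rmat x $$ (i, k) else 0)"
proof
  fix k
  have "(\<Sum>a<N. upow i a * rmat x $$ (a, k)) = (\<Sum>a<N. if a = i then rmat x $$ (i, k) else 0)"
    by (intro sum.cong) (auto simp: upow_def)
  also have "\<dots> = rmat x $$ (i, k)" using assms by (simp add: sum.delta)
  finally show "(upow i \<otimes>\<^bsub>D\<^esub> x) k = (if k < N then rmat x $$ (i, k) else 0)" by (simp add: mult_D)
qed

lemma upow_scalar:
  assumes "i < N" "b \<in> qB"
  shows "upow i \<otimes>\<^bsub>D\<^esub> scalar b = scalar ((g ^^ i) b) \<otimes>\<^bsub>D\<^esub> upow i"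
  using assms unfolding upow_mult[OF assms(1)] scalar_mult[OF upow_carrier[OF assms(1)]]
  by (auto simp: fun_eq_iff rmat_nth scalar_def upow_def \<delta>_self \<delta>_refl)

text \<open>\<open>\<delta> 0 i\<close> is N - i for 0 < i and 0 for i = 0. The product is a nonzero
  central scalar, so the power of u is invertible up to such a factor.\<close>

lemma upow_upow_inverse:
  assumes "i < N"
  shows "upow i \<otimes>\<^bsub>D\<^esub> upow (\<delta> 0 i) = scalar (T ^ ((i + \<delta> 0 i) div N))"
proof
  fix k
  have "\<delta> k i = \<delta> 0 i \<longleftrightarrow> k = 0" if "k < N"
    using add_mod_diff[of i N k] add_mod_diff[of i N 0] assms that N_pos by auto
  thus "(upow i \<otimes>\<^bsub>D\<^esub> upow (\<delta> 0 i)) k = scalar (T ^ ((i + \<delta> 0 i) div N)) k"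
    unfolding upow_mult[OF assms] using assms by (auto simp: rmat_nth upow_def scalar_def)
qed

section \<open>An arbitrary splitting compared with right multiplication\<close>

context
  fixes \<rho> :: "(nat \<Rightarrow> 'a fls) \<Rightarrow> 'a fls mat"
  assumes \<rho>: "splitting \<rho>"
begin

lemma rho_carrier: "x \<in> carrier D \<Longrightarrow> \<rho> x \<in> carrier_mat N N"
  and rho_mult: "x \<in> carrier D \<Longrightarrow> y \<in> carrier D \<Longrightarrow> \<rho> (x \<otimes>\<^bsub>D\<^esub> y) = \<rho> x * \<rho> y"
  and rho_add: "x \<in> carrier D \<Longrightarrow> y \<in> carrier D \<Longrightarrow> \<rho> (x \<oplus>\<^bsub>D\<^esub> y) = \<rho> x + \<rho> y"
  and rho_scalar: "a \<in> qA \<Longrightarrow> \<rho> (scalar a) = a \<cdot>\<^sub>m 1\<^sub>m N"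
  using \<rho> unfolding splitting_def ring_hom_def by (auto simp: ring_mat_simps)

lemma rho_mult_nth:
  assumes "x \<in> carrier D" "y \<in> carrier D" "a < N" "l < N"
  shows "\<rho> (x \<otimes>\<^bsub>D\<^esub> y) $$ (a, l) = (\<Sum>m<N. \<rho> x $$ (a, m) * \<rho> y $$ (m, l))"
  using assms rho_carrier[of x] rho_carrier[of y]
  by (simp add: rho_mult scalar_prod_def lessThan_atLeast0)

lemma rho_sum:
  assumes "finite K" "\<And>k. k \<in> K \<Longrightarrow> f k \<in> carrier D" "a < N" "l < N"
  shows "(\<lambda>j. \<Sum>k\<in>K. f k j) \<in> carrier D \<and> \<rho> (\<lambda>j. \<Sum>k\<in>K. f k j) $$ (a, l) = (\<Sum>k\<in>K. \<rho> (f k) $$ (a, l))"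
  using assms(1,2)
proof (induction K rule: finite_induct)
  case empty
  have "(\<lambda>j. 0) = scalar 0" by (auto simp: scalar_def)
  thus ?case using rho_scalar[of 0] assms(3,4) subring_zero[OF subfield_is_subring[OF is_subfield_qA]]
    by (simp add: scalar_carrier qB_closed)
next
  case (insert k K)
  let ?S = "\<lambda>j. \<Sum>k\<in>K. f k j"
  have IH: "?S \<in> carrier D" "\<rho> ?S $$ (a, l) = (\<Sum>k\<in>K. \<rho> (f k) $$ (a, l))" "f k \<in> carrier D"
    using insert by auto
  have "(\<lambda>j. \<Sum>k\<in>insert k K. f k j) = f k \<oplus>\<^bsub>D\<^esub> ?S" using insert by (simp add: add_D)
  moreover have "f k \<oplus>\<^bsub>D\<^esub> ?S \<in> carrier D" using IH(1,3) by (auto simp: carrier_D add_D qB_closed)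
  ultimately show ?case
    using IH rho_add[OF IH(3,1)] rho_carrier[OF IH(1)] rho_carrier[OF IH(3)] assms(3,4) insert.hyps by simp
qed

text \<open>$\sum_j \zeta^{-j} \rho(\zeta)^j$ is, up to the factor $p^s$, the projection onto the
  \<open>\<zeta>\<close>-eigenspace of $\rho(\zeta)$.  Its conjugates under the powers of $\rho(u)$ add up to a nonzero
  scalar, because $\zeta^j$ has trace 0 for $0 < j < p^s$.\<close>

lemma rho_projection_nonzero:
  "\<exists>a<N. \<exists>l<N. (\<Sum>j<N. inverse (Z ^ j) * \<rho> (scalar (Z ^ j)) $$ (a, l)) \<noteq> 0"
proof (rule ccontr)
  assume "\<not> ?thesis"
  hence zero: "(\<Sum>j<N. inverse (Z ^ j) * \<rho> (scalar (Z ^ j)) $$ (a, l)) = 0" if "a < N" "l < N" for a l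
    using that by blast
  have Zq: "Z ^ j \<in> qB" for j by (intro B_subset_qB B_closed(9) Z_in_B)
  have "(\<Sum>j<N. inverse (Z ^ j) * \<rho> (scalar ((g ^^ i) (Z ^ j))) $$ (0, 0)) = 0" if i: "i < N" for i
  proof -
    define i' where "i' = \<delta> 0 i"
    define t where "t = T ^ ((i + i') div N)"
    have i': "i' < N" by (simp add: i'_def mod_diff_less)
    have t: "t \<in> qA" "t \<in> qB" "t \<noteq> 0"
      using T_nonzero by (auto simp: t_def T_pow_in_qB intro: A_subset_qA T_pow_in_A)
    \<comment> \<open>Conjugation by the image of the power of u, up to the central factor
      \<open>t\<close>, applies \<open>g ^^ i\<close> to scalars. Its outer factors do not depend on
      j, so it carries the assumed vanishing over to the conjugated sums.\<close>
    have conj: "\<rho> (upow i) * \<rho> (scalar b) * \<rho> (upow i') = t \<cdot>\<^sub>m \<rho> (scalar ((g ^^ i) b))" if b: "b \<in> qB" for b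
    proof -
      note c = upow_carrier[OF i] upow_carrier[OF i'] scalar_carrier[OF b]
        scalar_carrier[OF giter_mem[OF b, of i]] scalar_carrier[OF t(2)]
      note rc = c[THEN rho_carrier]
      have "\<rho> (upow i) * \<rho> (scalar b) = \<rho> (scalar ((g ^^ i) b)) * \<rho> (upow i)"
        using upow_scalar[OF i b] c by (simp flip: rho_mult)
      hence "\<rho> (upow i) * \<rho> (scalar b) * \<rho> (upow i')
          = \<rho> (scalar ((g ^^ i) b)) * (\<rho> (upow i) * \<rho> (upow i'))"
        using rc by (simp add: assoc_mult_mat[of _ N N _ N _ N])
      also have "\<rho> (upow i) * \<rho> (upow i') = \<rho> (scalar t)"
        using upow_upow_inverse[OF i] c by (simp add: i'_def t_def flip: rho_mult)
      also have "\<rho> (scalar ((g ^^ i) b)) * \<rho> (scalar t) = t \<cdot>\<^sub>m \<rho> (scalar ((g ^^ i) b))"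
        using rc t by (simp add: rho_scalar mult_smult_distrib[of _ N N _ N])
      finally show ?thesis .
    qed
    have nth: "(\<rho> (upow i) * \<rho> (scalar b) * \<rho> (upow i')) $$ (0, 0)
      = (\<Sum>m<N. \<Sum>n<N. \<rho> (upow i) $$ (0, m) * \<rho> (scalar b) $$ (m, n) * \<rho> (upow i') $$ (n, 0))"
      if b: "b \<in> qB" for b
      using upow_carrier[OF i, THEN rho_carrier] upow_carrier[OF i', THEN rho_carrier]
        scalar_carrier[OF b, THEN rho_carrier]
      by (simp add: scalar_prod_def lessThan_atLeast0 sum_distrib_left mult.assoc)
    have "t * (\<Sum>j<N. inverse (Z ^ j) * \<rho> (scalar ((g ^^ i) (Z ^ j))) $$ (0, 0))
      = (\<Sum>j<N. inverse (Z ^ j) * (t \<cdot>\<^sub>m \<rho> (scalar ((g ^^ i) (Z ^ j)))) $$ (0, 0))"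
    proof -
      have "(t \<cdot>\<^sub>m \<rho> (scalar ((g ^^ i) (Z ^ j)))) $$ (0, 0) = t * \<rho> (scalar ((g ^^ i) (Z ^ j))) $$ (0, 0)" for j
        using rho_carrier[OF scalar_carrier[OF giter_mem[OF Zq]], of i j] by simp
      thus ?thesis by (simp only: sum_distrib_left mult.left_commute)
    qed
    also have "\<dots> = (\<Sum>j<N. \<Sum>m<N. \<Sum>n<N. \<rho> (upow i) $$ (0, m) *
        (inverse (Z ^ j) * \<rho> (scalar (Z ^ j)) $$ (m, n)) * \<rho> (upow i') $$ (n, 0))"
      by (simp only: conj[OF Zq, symmetric] nth[OF Zq] sum_distrib_left mult_ac)
    also have "\<dots> = (\<Sum>m<N. \<Sum>n<N. \<Sum>j<N. \<rho> (upow i) $$ (0, m) *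
        (inverse (Z ^ j) * \<rho> (scalar (Z ^ j)) $$ (m, n)) * \<rho> (upow i') $$ (n, 0))"
      by (subst sum.swap) (intro sum.cong[OF refl] sum.swap)
    also have "\<dots> = (\<Sum>m<N. \<Sum>n<N. \<rho> (upow i) $$ (0, m) *
        (\<Sum>j<N. inverse (Z ^ j) * \<rho> (scalar (Z ^ j)) $$ (m, n)) * \<rho> (upow i') $$ (n, 0))"
      by (simp only: sum_distrib_left sum_distrib_right)
    also have "\<dots> = 0" by (simp add: zero)
    finally show ?thesis using t by simp
  qed
  hence "0 = (\<Sum>i<N. \<Sum>j<N. inverse (Z ^ j) * \<rho> (scalar ((g ^^ i) (Z ^ j))) $$ (0, 0))" by simp
  also have "\<dots> = (\<Sum>j<N. inverse (Z ^ j) * (\<Sum>i<N. \<rho> (scalar ((g ^^ i) (Z ^ j))) $$ (0, 0)))"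
    by (subst sum.swap) (simp add: sum_distrib_left)
  \<comment> \<open>Summation over i turns the conjugates into traces, of which only the one for j =
    0 survives.\<close>
  also have "\<dots> = (\<Sum>j<N. if j = 0 then of_nat N else 0)"
  proof (rule sum.cong[OF refl])
    fix j assume j: "j \<in> {..<N}"
    let ?tr = "\<Sum>i<N. (g ^^ i) (Z ^ j)"
    have "(\<lambda>l. \<Sum>i<N. scalar ((g ^^ i) (Z ^ j)) l) = scalar ?tr"
      by (auto simp: scalar_def fun_eq_iff)
    hence "(\<Sum>i<N. \<rho> (scalar ((g ^^ i) (Z ^ j))) $$ (0, 0)) = \<rho> (scalar ?tr) $$ (0, 0)"
      using rho_sum[of "{..<N}" "\<lambda>i. scalar ((g ^^ i) (Z ^ j))" 0 0]
      by (simp add: scalar_carrier giter_mem Zq)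
    also have "?tr = (if j = 0 then of_nat N else 0)" using trace_Z_pow[of j] j by auto
    also have "\<rho> (scalar \<dots>) $$ (0, 0) = \<dots>"
    proof -
      have "(if j = 0 then of_nat N else 0) \<in> qA"
        by (intro A_subset_qA) (auto intro!: subring_zero subring_power subring_of_nat is_subring_A)
      thus ?thesis by (simp add: rho_scalar)
    qed
    finally show "inverse (Z ^ j) * (\<Sum>i<N. \<rho> (scalar ((g ^^ i) (Z ^ j))) $$ (0, 0))
        = (if j = 0 then of_nat N else 0)" by simp
  qed
  also have "\<dots> = of_nat N" using N_pos by (simp add: sum.delta)
  finally show False by simp
qed

text \<open>The row \<open>q\<close> times the matrix \<open>\<rho> x\<close>. As a function of
  \<open>x\<close> it maps D, as a right module over itself, to the rows on which D acts through
  \<open>\<rho>\<close>.\<close>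

definition phi :: "(nat \<Rightarrow> 'a fls) \<Rightarrow> (nat \<Rightarrow> 'a fls) \<Rightarrow> nat \<Rightarrow> 'a fls" where
  "phi q x l = (\<Sum>a<N. q a * \<rho> x $$ (a, l))"

lemma phi_sum:
  assumes "finite K" "\<And>k. k \<in> K \<Longrightarrow> f k \<in> carrier D" "l < N"
  shows "phi q (\<lambda>j. \<Sum>k\<in>K. f k j) l = (\<Sum>k\<in>K. phi q (f k) l)"
  using rho_sum[OF assms(1,2) _ assms(3)] unfolding phi_def
  by (subst sum.swap) (simp add: sum_distrib_left)

lemma phi_mult:
  assumes "x \<in> carrier D" "y \<in> carrier D" "l < N"
  shows "phi q (x \<otimes>\<^bsub>D\<^esub> y) l = (\<Sum>m<N. phi q x m * \<rho> y $$ (m, l))"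
  using assms unfolding phi_def sum_distrib_right
  by (subst sum.swap) (simp add: rho_mult_nth sum_distrib_left mult.assoc)

lemma phi_scalar_qA: "a \<in> qA \<Longrightarrow> l < N \<Longrightarrow> phi q (scalar a) l = a * q l"
proof -
  assume a: "a \<in> qA" "l < N"
  have "phi q (scalar a) l = (\<Sum>m<N. if m = l then a * q l else 0)"
    unfolding phi_def using a by (intro sum.cong) (auto simp: rho_scalar)
  thus ?thesis using a by (simp add: sum.delta)
qed

text \<open>A nonzero row of the projection onto the eigenspace serves. Multiplication by the image
  of \<open>Z\<close> shifts j by one in a cyclic sum and thus brings out a factor \<open>Z\<close>;
  powers of \<open>Z\<close> and elements of \<open>A\<close> then give all of
  \<open>B\<close>.\<close>

lemma exists_eigenrow:
  obtains q where "\<exists>l<N. q l \<noteq> 0" "\<And>b l. b \<in> B \<Longrightarrow> l < N \<Longrightarrow> phi q (scalar b) l = b * q l"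
proof -
  obtain a l0 where al: "a < N" "l0 < N"
      "(\<Sum>j<N. inverse (Z ^ j) * \<rho> (scalar (Z ^ j)) $$ (a, l0)) \<noteq> 0"
    using rho_projection_nonzero by blast
  define q where "q l = (\<Sum>j<N. inverse (Z ^ j) * \<rho> (scalar (Z ^ j)) $$ (a, l))" for l
  have Zq: "Z ^ j \<in> qB" for j by (intro B_subset_qB B_closed(9) Z_in_B)
  have one: "phi q (scalar Z) l = Z * q l" if l: "l < N" for l
  proof -
    let ?f = "\<lambda>j. inverse (Z ^ j) * \<rho> (scalar (Z ^ j)) $$ (a, l)"
    have step: "(\<Sum>m<N. \<rho> (scalar (Z ^ j)) $$ (a, m) * \<rho> (scalar Z) $$ (m, l)) = \<rho> (scalar (Z ^ Suc j)) $$ (a, l)" for j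
    proof -
      have "scalar (Z ^ j) \<otimes>\<^bsub>D\<^esub> scalar Z = scalar (Z ^ Suc j)"
        using scalar_mult[OF scalar_carrier[OF Zq[of 1]], of "Z ^ j"] by (auto simp: scalar_def fun_eq_iff mult.commute)
      thus ?thesis using rho_mult_nth[OF scalar_carrier[OF Zq[of j]] scalar_carrier[OF Zq[of 1]] al(1) l] by simp
    qed
    have "phi q (scalar Z) l = (\<Sum>j<N. \<Sum>m<N. inverse (Z ^ j) * (\<rho> (scalar (Z ^ j)) $$ (a, m) * \<rho> (scalar Z) $$ (m, l)))"
      unfolding phi_def q_def sum_distrib_right by (subst sum.swap) (simp only: mult.assoc)
    also have "\<dots> = (\<Sum>j<N. inverse (Z ^ j) * \<rho> (scalar (Z ^ Suc j)) $$ (a, l))"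
      by (simp only: sum_distrib_left[symmetric] step)
    also have "\<dots> = (\<Sum>j<N. Z * ?f (Suc j))"
      using Z_nonzero by (intro sum.cong) (auto simp: field_simps)
    also have "\<dots> = Z * (\<Sum>j<N. ?f (Suc j))" by (simp only: sum_distrib_left)
    also have "(\<Sum>j<N. ?f (Suc j)) = (\<Sum>j<N. ?f j) + ?f N - ?f 0"
      using sum.lessThan_Suc_shift[of ?f N] sum.lessThan_Suc[of ?f N] by (simp add: algebra_simps)
    \<comment> \<open>Z ^ N lies in \<open>A\<close> and is mapped to a scalar matrix, so both terms
      are the same entry of the identity matrix.\<close>
    also have "?f N = ?f 0"
    proof -
      have "Z ^ N \<noteq> 0" using Z_nonzero by simp
      moreover have "1 \<in> qA" by (intro A_subset_qA subring_one is_subring_A)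
      ultimately show ?thesis
        using rho_scalar[OF A_subset_qA[OF Z_pow_N_in_A]] rho_scalar[of 1] al(1) l by simp
    qed
    finally show ?thesis by (simp only: q_def[of l] add_diff_cancel_right')
  qed
  have pow: "phi q (scalar (Z ^ j)) l = Z ^ j * q l" if "l < N" for j l
    using that
  proof (induction j arbitrary: l)
    case 0
    show ?case using phi_scalar_qA[of 1 l q] A_subset_qA[OF subring_one[OF is_subring_A]] 0 by simp
  next
    case (Suc j)
    have "scalar (Z ^ j) \<otimes>\<^bsub>D\<^esub> scalar Z = scalar (Z ^ Suc j)"
      using scalar_mult[OF scalar_carrier[OF Zq[of 1]], of "Z ^ j"] by (auto simp: scalar_def fun_eq_iff mult.commute)
    hence "phi q (scalar (Z ^ Suc j)) l = (\<Sum>m<N. phi q (scalar (Z ^ j)) m * \<rho> (scalar Z) $$ (m, l))"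
      using phi_mult[OF scalar_carrier[OF Zq[of j]] scalar_carrier[OF Zq[of 1]] Suc.prems, of q] by simp
    also have "\<dots> = (\<Sum>m<N. Z ^ j * q m * \<rho> (scalar Z) $$ (m, l))" by (simp add: Suc.IH)
    also have "\<dots> = Z ^ j * phi q (scalar Z) l" by (simp add: phi_def sum_distrib_left mult.assoc)
    finally show ?case using one[OF Suc.prems] by (simp add: mult_ac)
  qed
  have "phi q (scalar b) l = b * q l" if b: "b \<in> B" and l: "l < N" for b l
  proof -
    obtain \<alpha> where \<alpha>: "\<And>j. \<alpha> j \<in> A" "b = (\<Sum>j<N. \<alpha> j * Z ^ j)" using B_decompose[OF b] by blast
    have \<alpha>q: "\<alpha> j \<in> qA" "\<alpha> j \<in> qB" for j using \<alpha>(1) by (auto intro: A_subset_qA qA_subset_qB)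
    have prd: "scalar (Z ^ j) \<otimes>\<^bsub>D\<^esub> scalar (\<alpha> j) = scalar (\<alpha> j * Z ^ j)" for j
      using scalar_mult[OF scalar_carrier[OF \<alpha>q(2)], of "Z ^ j" j] by (auto simp: scalar_def fun_eq_iff mult.commute)
    have t: "phi q (scalar (\<alpha> j * Z ^ j)) l = \<alpha> j * Z ^ j * q l" for j
    proof -
      have "phi q (scalar (\<alpha> j * Z ^ j)) l = (\<Sum>m<N. phi q (scalar (Z ^ j)) m * \<rho> (scalar (\<alpha> j)) $$ (m, l))"
        unfolding prd[symmetric] by (intro phi_mult scalar_carrier Zq \<alpha>q l)
      also have "\<dots> = (\<Sum>m<N. Z ^ j * q m * \<rho> (scalar (\<alpha> j)) $$ (m, l))" by (simp add: pow)
      also have "\<dots> = Z ^ j * phi q (scalar (\<alpha> j)) l" by (simp add: phi_def sum_distrib_left mult.assoc)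
      finally show ?thesis by (simp add: phi_scalar_qA[OF \<alpha>q(1) l] mult_ac)
    qed
    have "scalar b = (\<lambda>l. \<Sum>j<N. scalar (\<alpha> j * Z ^ j) l)"
      by (auto simp: scalar_def fun_eq_iff \<alpha>(2))
    hence "phi q (scalar b) l = (\<Sum>j<N. phi q (scalar (\<alpha> j * Z ^ j)) l)"
      using phi_sum[of "{..<N}" "\<lambda>j. scalar (\<alpha> j * Z ^ j)" l q] l
      by (simp add: scalar_carrier qB_closed \<alpha>q Zq)
    thus ?thesis by (simp add: t \<alpha>(2) sum_distrib_right)
  qed
  moreover have "\<exists>l<N. q l \<noteq> 0" using al by (auto simp: q_def)
  ultimately show ?thesis using that by blast
qed

text \<open>The rows \<open>phi q (upow i)\<close> form a matrix \<open>Q\<close> that intertwines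
  the two representations: the i-th power of u times \<open>d\<close> is a combination of powers of
  u with coefficients from row i of \<open>rmat d\<close>, and these lie in \<open>B\<close>, so
  that the eigenrow lets them out as factors. Once \<open>Q\<close> is invertible the determinants
  agree.\<close>

lemma det_rho_eq_det_rmat:
  assumes d: "d \<in> carrier D" "\<And>j. d j \<in> B"
  shows "det (\<rho> d) = det (rmat d)"
proof -
  obtain q where q: "\<exists>l<N. q l \<noteq> 0" "\<And>b l. b \<in> B \<Longrightarrow> l < N \<Longrightarrow> phi q (scalar b) l = b * q l"
    using exists_eigenrow by blast
  have Zq: "Z ^ j \<in> qB" for j by (intro B_subset_qB B_closed(9) Z_in_B)
  define Q where "Q = mat N N (\<lambda>(i, l). phi q (upow i) l)"
  have Q: "Q \<in> carrier_mat N N" by (simp add: Q_def)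
  have sm: "phi q (scalar b \<otimes>\<^bsub>D\<^esub> upow i) l = b * phi q (upow i) l"
    if "b \<in> B" "i < N" "l < N" for b i l
  proof -
    have "phi q (scalar b \<otimes>\<^bsub>D\<^esub> upow i) l = (\<Sum>m<N. phi q (scalar b) m * \<rho> (upow i) $$ (m, l))"
      using that by (intro phi_mult scalar_carrier upow_carrier B_subset_qB)
    also have "\<dots> = (\<Sum>m<N. b * q m * \<rho> (upow i) $$ (m, l))"
      using that(1) by (simp add: q(2))
    also have "\<dots> = b * phi q (upow i) l" by (simp add: phi_def sum_distrib_left mult.assoc)
    finally show ?thesis .
  qed
  have intertwine: "Q * \<rho> d = rmat d * Q"
  proof (rule eq_matI)
    fix i l assume "i < dim_row (rmat d * Q)" "l < dim_col (rmat d * Q)"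
    hence il: "i < N" "l < N" by (auto simp: Q_def rmat_def)
    have rB: "rmat d $$ (i, k) \<in> B" if "k < N" for k
      using il that d(2) by (simp add: rmat_nth B_closed giter_B A_subset_B[OF T_pow_in_A])
    have "(Q * \<rho> d) $$ (i, l) = phi q (upow i \<otimes>\<^bsub>D\<^esub> d) l"
      using il rho_carrier[OF d(1)] phi_mult[OF upow_carrier[OF il(1)] d(1) il(2), of q]
      by (simp add: Q_def scalar_prod_def lessThan_atLeast0)
    also have "upow i \<otimes>\<^bsub>D\<^esub> d = (\<lambda>j. \<Sum>k<N. (scalar (rmat d $$ (i, k)) \<otimes>\<^bsub>D\<^esub> upow k) j)"
    proof
      fix j
      have "(\<Sum>k<N. (scalar (rmat d $$ (i, k)) \<otimes>\<^bsub>D\<^esub> upow k) j) = (\<Sum>k<N. if k = j then rmat d $$ (i, k) else 0)"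
        by (intro sum.cong) (auto simp: scalar_mult upow_carrier, auto simp: upow_def)
      thus "(upow i \<otimes>\<^bsub>D\<^esub> d) j = (\<Sum>k<N. (scalar (rmat d $$ (i, k)) \<otimes>\<^bsub>D\<^esub> upow k) j)"
        using il by (simp add: upow_mult sum.delta)
    qed
    also have "phi q \<dots> l = (\<Sum>k<N. phi q (scalar (rmat d $$ (i, k)) \<otimes>\<^bsub>D\<^esub> upow k) l)"
      using il by (intro phi_sum) (auto intro!: mult_D_closed scalar_carrier upow_carrier B_subset_qB rB)
    also have "\<dots> = (\<Sum>k<N. rmat d $$ (i, k) * phi q (upow k) l)"
      using il rB by (intro sum.cong) (auto simp: sm)
    also have "\<dots> = (rmat d * Q) $$ (i, l)"
      using il rmat_carrier[of d] by (simp add: Q_def scalar_prod_def lessThan_atLeast0)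
    finally show "(Q * \<rho> d) $$ (i, l) = (rmat d * Q) $$ (i, l)" .
  qed (use rho_carrier[OF d(1)] in \<open>auto simp: Q_def rmat_def\<close>)
  \<comment> \<open>In a relation between the rows of \<open>Q\<close>, multiplication by the image
    of Z ^ j multiplies the i-th coefficient by the i-th conjugate of Z ^ j. The conjugates of
    \<open>Z\<close> are distinct, so summing over j against the powers of one conjugate isolates a
    single row.\<close>
  have "det Q \<noteq> 0"
  proof
    assume "det Q = 0"
    hence "det (transpose_mat Q) = 0" using det_transpose[OF Q] by simp
    then obtain w where w: "w \<in> carrier_vec N" "w \<noteq> 0\<^sub>v N" "transpose_mat Q *\<^sub>v w = 0\<^sub>v N"
      using det_0_iff_vec_prod_zero_field[of "transpose_mat Q" N] Q by auto
    define v where "v i = vec_index w i" for i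
    have v: "(\<Sum>i<N. v i * phi q (upow i) l) = 0" if l: "l < N" for l
    proof -
      have "0 = vec_index (transpose_mat Q *\<^sub>v w) l" using w l by simp
      also have "\<dots> = (\<Sum>i<N. v i * phi q (upow i) l)"
        using l w(1) Q by (simp add: scalar_prod_def Q_def v_def lessThan_atLeast0 mult.commute)
      finally show ?thesis by simp
    qed
    have vj: "(\<Sum>i<N. v i * (g ^^ i) (Z ^ j) * phi q (upow i) l) = 0" if l: "l < N" for l j
    proof -
      have "0 = (\<Sum>m<N. (\<Sum>i<N. v i * phi q (upow i) m) * \<rho> (scalar (Z ^ j)) $$ (m, l))" by (simp add: v)
      also have "\<dots> = (\<Sum>i<N. v i * (\<Sum>m<N. phi q (upow i) m * \<rho> (scalar (Z ^ j)) $$ (m, l)))"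
        unfolding sum_distrib_right by (subst sum.swap) (simp add: sum_distrib_left mult.assoc)
      also have "\<dots> = (\<Sum>i<N. v i * phi q (scalar ((g ^^ i) (Z ^ j)) \<otimes>\<^bsub>D\<^esub> upow i) l)"
      proof (rule sum.cong[OF refl])
        fix i assume "i \<in> {..<N}"
        hence i: "i < N" by simp
        show "v i * (\<Sum>m<N. phi q (upow i) m * \<rho> (scalar (Z ^ j)) $$ (m, l))
            = v i * phi q (scalar ((g ^^ i) (Z ^ j)) \<otimes>\<^bsub>D\<^esub> upow i) l"
          unfolding upow_scalar[OF i Zq, symmetric]
          by (simp add: phi_mult[OF upow_carrier[OF i] scalar_carrier[OF Zq] l])
      qed
      also have "\<dots> = (\<Sum>i<N. v i * (g ^^ i) (Z ^ j) * phi q (upow i) l)"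
        using l by (intro sum.cong) (auto simp: sm giter_B B_closed Z_in_B)
      finally show ?thesis by simp
    qed
    have "v m = 0" if m: "m < N" for m
    proof -
      let ?x = "\<lambda>i. (g ^^ i) Z / (g ^^ m) Z"
      have nz: "(g ^^ i) Z \<noteq> 0" for i using Z_nonzero by (simp add: giter_Z)
      have "(\<Sum>j<N. ?x i ^ j) = (if i = m then of_nat N else 0)" if i: "i < N" for i
      proof (cases "i = m")
        case False
        \<comment> \<open>Z ^ N is fixed by g, so the quotient of two conjugates is an N-th root of
          unity.\<close>
        have "(g ^^ i) Z ^ N = (g ^^ m) Z ^ N"
          using giter_power[OF Zq[of 1], of _ N] giter_fixes_A[OF Z_pow_N_in_A] by simp
        hence "?x i ^ N = 1" using nz by (simp add: power_divide)
        moreover have "?x i \<noteq> 1" using giter_Z_inj i m False nz by (auto simp: inj_on_def)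
        ultimately show ?thesis using False sum_root_of_unity_powers[of "?x i" N] by simp
      qed (use nz in simp)
      hence orth: "(\<Sum>j<N. (g ^^ i) (Z ^ j) / (g ^^ m) Z ^ j) = (if i = m then of_nat N else 0)" if "i < N" for i
        using that by (simp add: power_divide giter_power B_subset_qB Z_in_B)
      have "of_nat N * v m * phi q (upow m) l = 0" if l: "l < N" for l
      proof -
        have "0 = (\<Sum>j<N. (\<Sum>i<N. v i * (g ^^ i) (Z ^ j) * phi q (upow i) l) / (g ^^ m) Z ^ j)"
          using vj[OF l] by simp
        also have "\<dots> = (\<Sum>i<N. v i * (\<Sum>j<N. (g ^^ i) (Z ^ j) / (g ^^ m) Z ^ j) * phi q (upow i) l)"
          unfolding sum_divide_distrib
          by (subst sum.swap) (simp add: sum_distrib_left sum_distrib_right)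
        also have "\<dots> = (\<Sum>i<N. if i = m then of_nat N * v m * phi q (upow m) l else 0)"
          by (intro sum.cong) (auto simp: orth)
        also have "\<dots> = of_nat N * v m * phi q (upow m) l" using m by (simp add: sum.delta)
        finally show ?thesis by simp
      qed
      \<comment> \<open>Multiplying a vanishing row by the image of the complementary power of u
        would make \<open>q\<close> itself vanish.\<close>
      moreover have "\<exists>l<N. phi q (upow m) l \<noteq> 0"
      proof (rule ccontr)
        assume "\<not> ?thesis"
        hence z: "\<forall>l<N. phi q (upow m) l = 0" by blast
        define t where "t = T ^ ((m + \<delta> 0 m) div N)"
        have tB: "t \<in> B" "t \<noteq> 0" using T_nonzero by (auto simp: t_def intro: A_subset_B T_pow_in_A)
        obtain l where l: "l < N" "q l \<noteq> 0" using q(1) by blast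
        have "t * q l = phi q (scalar t) l" using q(2)[OF tB(1) l(1)] by simp
        also have "scalar t = upow m \<otimes>\<^bsub>D\<^esub> upow (\<delta> 0 m)" by (simp add: t_def upow_upow_inverse[OF m])
        also have "phi q \<dots> l = (\<Sum>a<N. phi q (upow m) a * \<rho> (upow (\<delta> 0 m)) $$ (a, l))"
          using m l by (intro phi_mult upow_carrier mod_diff_less) auto
        also have "\<dots> = 0" using z by simp
        finally show False using tB l by simp
      qed
      ultimately show ?thesis by auto
    qed
    hence "w = 0\<^sub>v N" using w(1) by (intro eq_vecI) (auto simp: v_def)
    thus False using w by simp
  qed
  moreover have "det Q * det (\<rho> d) = det (rmat d) * det Q"
    using det_mult[OF Q rho_carrier[OF d(1)]] det_mult[OF rmat_carrier[of d] Q] intertwine by metis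
  ultimately show ?thesis by auto
qed

end

lemma nr_eq_det_rmat:
  assumes d: "d \<in> carrier D" "\<And>j. d j \<in> B"
  shows "nr d = det (rmat d)"
  unfolding nr_def using someI[of splitting, OF splitting_rmat] det_rho_eq_det_rmat[OF _ d] by blast

end

section \<open>The rotation action on the terms of the determinant\<close>

lemma funpow_inverse:
  fixes f h :: "'a \<Rightarrow> 'a"
  shows "f \<circ> h = id \<Longrightarrow> (f ^^ m) \<circ> (h ^^ m) = id"
proof (induction m)
  case (Suc m)
  have "(f ^^ Suc m) \<circ> (h ^^ Suc m) = (f ^^ m) \<circ> (f \<circ> h) \<circ> (h ^^ m)"
    by (simp only: funpow_Suc_right[of _ f] funpow.simps(2)[of _ h] o_assoc)
  thus ?case by (simp only: Suc.prems comp_id Suc.IH)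
qed simp

text \<open>Extended by the identity beyond n, so that it permutes {0..<n} in the sense of
  \<open>permutes\<close>.\<close>

definition rot :: "nat \<Rightarrow> nat \<Rightarrow> nat" where
  "rot n i = (if i < n then (i + 1) mod n else i)"

lemma rot_funpow: "(rot n ^^ m) i = (if i < n then (i + m) mod n else i)"
  by (induction m) (auto simp: rot_def mod_Suc_eq)

lemma rot_bij: "bij (rot n)" and rot_permutes: "rot n permutes {0..<n}"
proof -
  have "bij_betw (\<lambda>a. (1 + a) mod n) {..<n} {..<n}"
    using bij_betw_add_mod[of n 1] by (cases "n = 0") auto
  hence "bij_betw (rot n) {0..<n} {0..<n}"
    by (subst bij_betw_cong[of _ _ "\<lambda>a. (1 + a) mod n"]) (auto simp: rot_def lessThan_atLeast0)
  thus p: "rot n permutes {0..<n}" by (intro bij_imp_permutes) (auto simp: rot_def)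
  show "bij (rot n)" by (rule permutes_bij[OF p])
qed

lemma rot_funpow_n: "rot n ^^ n = id"
  by (auto simp: rot_funpow fun_eq_iff)

definition irot :: "nat \<Rightarrow> nat \<Rightarrow> nat" where
  "irot n = rot n ^^ (n - 1)"

lemma rot_inv: "rot n \<circ> irot n = id" "irot n \<circ> rot n = id"
proof -
  have "rot n ^^ Suc (n - 1) = id"
  proof (cases "n = 0")
    case False
    hence "Suc (n - 1) = n" by simp
    thus ?thesis using rot_funpow_n[of n] by metis
  qed (simp add: fun_eq_iff rot_def)
  thus "rot n \<circ> irot n = id" "irot n \<circ> rot n = id"
    unfolding irot_def by (simp_all only: funpow.simps(2) flip: funpow_Suc_right)
qed

lemma rot_funpow_permutes: "(rot n ^^ j) permutes {0..<n}"
proof (induction j)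
  case (Suc j)
  show ?case unfolding funpow.simps(2) by (rule permutes_compose[OF Suc rot_permutes])
qed (simp add: permutes_def)

lemma irot_funpow_n: "irot n ^^ n = id"
  using funpow_inverse[OF rot_inv(1), of n n] by (simp add: rot_funpow_n)

lemma mod_diff_rot: "i < n \<Longrightarrow> k < n \<Longrightarrow> mod_diff n (rot n k) (rot n i) = mod_diff n k i"
proof (rule mod_diff_unique)
  assume ik: "i < n" "k < n"
  show "(rot n i + mod_diff n k i) mod n = rot n k mod n"
    using add_mod_diff[of i n k] ik
    by (simp add: rot_def mod_add_left_eq) (metis Suc_eq_plus1_left add.commute add_Suc mod_Suc_eq)
  show "mod_diff n k i < n" using ik by (simp add: mod_diff_less)
qed (auto simp: rot_def less_imp_le)

text \<open>Conjugation by the rotation: the row and column indices of a determinant term are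
  shifted simultaneously.\<close>

definition rot_act :: "nat \<Rightarrow> nat set \<times> (nat \<Rightarrow> nat) \<Rightarrow> nat set \<times> (nat \<Rightarrow> nat)" where
  "rot_act n x = (rot n ` fst x, rot n \<circ> snd x \<circ> irot n)"

lemma rot_act_funpow:
  "(rot_act n ^^ m) x = ((rot n ^^ m) ` fst x, (rot n ^^ m) \<circ> snd x \<circ> (irot n ^^ m))"
  by (induction m) (simp_all add: rot_act_def image_image funpow_swap1 fun_eq_iff)

lemma rot_act_period: "(rot_act n ^^ n) x = x"
  by (simp add: rot_act_funpow rot_funpow_n irot_funpow_n)

lemma rot_act_fixed:
  assumes "(rot_act n ^^ m) (S, q) = (S, q)" "i \<in> S"
  shows "(rot n ^^ m) i \<in> S" "q ((rot n ^^ m) i) = (rot n ^^ m) (q i)"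
proof -
  have e: "(rot n ^^ m) ` S = S" "(rot n ^^ m) \<circ> q \<circ> (irot n ^^ m) = q"
    using assms(1) by (auto simp: rot_act_funpow)
  show "(rot n ^^ m) i \<in> S" using e(1) assms(2) by blast
  have "q ((rot n ^^ m) i) = ((rot n ^^ m) \<circ> q \<circ> ((irot n ^^ m) \<circ> (rot n ^^ m))) i"
    using e(2) by (metis comp_apply)
  thus "q ((rot n ^^ m) i) = (rot n ^^ m) (q i)" by (simp add: funpow_inverse[OF rot_inv(2)])
qed

definition partial_perms :: "nat \<Rightarrow> (nat set \<times> (nat \<Rightarrow> nat)) set" where
  "partial_perms n = Sigma (Pow {0..<n}) (\<lambda>S. {q. q permutes S})"

lemma finite_partial_perms: "finite (partial_perms n)"
  unfolding partial_perms_def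
  by (intro finite_SigmaI) (auto intro: finite_permutations finite_subset)

lemma rot_act_closed:
  assumes "x \<in> partial_perms n" shows "rot_act n x \<in> partial_perms n"
proof -
  obtain S q where x: "x = (S, q)" "S \<subseteq> {0..<n}" "q permutes S" using assms by (auto simp: partial_perms_def)
  have "rot n \<circ> q \<circ> irot n permutes rot n ` S"
    unfolding permutes_def
  proof (intro conjI allI impI)
    fix i assume "i \<notin> rot n ` S"
    hence "irot n i \<notin> S" using rot_inv(1)[of n] by (metis comp_apply id_apply imageI)
    hence "q (irot n i) = irot n i" using x(3) by (simp add: permutes_def)
    thus "(rot n \<circ> q \<circ> irot n) i = i" using rot_inv(1)[of n] by (simp add: fun_eq_iff)
  next
    fix y
    have "bij (rot n \<circ> q \<circ> irot n)"
      unfolding irot_def by (intro bij_comp rot_bij permutes_bij[OF rot_funpow_permutes] permutes_bij[OF x(3)])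
    thus "\<exists>!x. (rot n \<circ> q \<circ> irot n) x = y" by (simp add: bij_iff)
  qed
  moreover have "rot n ` S \<subseteq> {0..<n}" using x(2) permutes_in_image[OF rot_permutes] by blast
  ultimately show ?thesis by (simp add: partial_perms_def rot_act_def x(1))
qed

lemma rot_fixed_set:
  assumes "S \<subseteq> {0..<n}" "rot n ` S = S"
  shows "S = {} \<or> S = {0..<n}"
proof (cases "S = {}")
  case False
  then obtain i where i: "i \<in> S" by blast
  have "(rot n ^^ m) i \<in> S" for m
    by (induction m) (use i assms(2) in auto)
  moreover have "\<exists>m. (rot n ^^ m) i = k" if "k < n" for k
    using i assms(1) that add_mod_diff[of i n k]
    by (intro exI[of _ "mod_diff n k i"]) (auto simp: rot_funpow)
  ultimately have "k \<in> S" if "k < n" for k using that by metis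
  thus ?thesis using assms(1) by auto
qed auto

text \<open>The rotation is transitive, so a stable set is empty or full. A permutation that
  commutes with the rotation is determined by its value at 0 and is the rotation by that
  amount.\<close>

lemma rot_act_fixed_points:
  assumes n: "n > 0"
  shows "{x \<in> partial_perms n. rot_act n x = x} =
    insert ({}, id) ((\<lambda>j. ({0..<n}, rot n ^^ j)) ` {..<n})" (is "?F = ?G")
proof (intro equalityI subsetI)
  fix x assume x: "x \<in> ?F"
  obtain S q where Sq: "x = (S, q)" "S \<subseteq> {0..<n}" "q permutes S" using x by (auto simp: partial_perms_def)
  have "(rot_act n ^^ 1) (S, q) = (S, q)" using x Sq by simp
  note fixed = rot_act_fixed[OF this]
  have "rot n ` S = S" using x Sq by (simp add: rot_act_def)
  with rot_fixed_set[OF Sq(2)] consider "S = {}" | "S = {0..<n}" by blast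
  thus "x \<in> ?G"
  proof cases
    case 1
    thus ?thesis using Sq by simp
  next
    case 2
    have qm: "q ((rot n ^^ m) 0) = (rot n ^^ m) (q 0)" for m
    proof (induction m)
      case (Suc m)
      have "(rot n ^^ m) 0 \<in> S" using n by (simp add: 2 rot_funpow)
      thus ?case using fixed(2)[of "(rot n ^^ m) 0"] Suc by simp
    qed simp
    have q: "q m = (q 0 + m) mod n" if "m < n" for m
      using qm[of m] that n permutes_in_image[OF Sq(3), of 0] by (simp add: rot_funpow 2)
    have q0: "q 0 < n" using permutes_in_image[OF Sq(3), of 0] n 2 by auto
    have "q = rot n ^^ q 0"
    proof
      fix m show "q m = (rot n ^^ q 0) m"
        using q[of m] Sq(3) 2 by (auto simp: rot_funpow add.commute permutes_def)
    qed
    thus ?thesis using Sq 2 q0 by auto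
  qed
next
  fix x assume "x \<in> ?G"
  moreover have "rot_act n ({0..<n}, rot n ^^ j) = ({0..<n}, rot n ^^ j)" for j
  proof -
    have "rot n \<circ> (rot n ^^ j) \<circ> irot n = (rot n ^^ j) \<circ> (rot n \<circ> irot n)"
      by (auto simp: fun_eq_iff funpow_swap1)
    thus ?thesis using permutes_image[OF rot_permutes] by (simp add: rot_act_def rot_inv)
  qed
  moreover have "rot_act n ({}, id) = ({}, id)" by (simp add: rot_act_def rot_inv)
  ultimately show "x \<in> ?F"
    using rot_funpow_permutes by (auto simp: partial_perms_def permutes_empty simp del: image_id)
qed

text \<open>The n-th power of the sign of the rotation is the sign of the identity, and n is
  odd.\<close>

lemma sign_rot_funpow:
  assumes "odd n"
  shows "sign (rot n ^^ j) = 1"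
proof -
  have perm: "permutation (rot n ^^ j)" for j
    using permutes_imp_permutation[OF _ rot_permutes[of n]]
    by (induction j) (auto intro: permutation_compose)
  have pow: "sign (rot n ^^ j) = sign (rot n) ^ j" for j
    using perm[of 1] perm by (induction j) (auto simp: sign_compose)
  have "sign (rot n) ^ n = 1" using pow[of n] by (simp add: rot_funpow_n)
  hence "sign (rot n) = 1" using assms by (cases "rot n" rule: sign_cases) auto
  thus ?thesis by (simp add: pow)
qed

lemma sign_rot_conj: "q permutes S \<Longrightarrow> finite S \<Longrightarrow> sign (rot n \<circ> q \<circ> irot n) = sign q"
proof -
  assume q: "q permutes S" "finite S"
  have perms: "permutation (rot n)" "permutation (irot n)" "permutation q"
    unfolding irot_def using q
    by (auto intro: permutes_imp_permutation[OF _ rot_permutes] permutes_imp_permutation[OF _ rot_funpow_permutes]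
        permutes_imp_permutation)
  have "sign (rot n) * sign (irot n) = 1"
    using sign_compose[OF perms(1,2)] by (simp add: rot_inv)
  thus ?thesis using perms by (simp add: sign_compose permutation_compose mult_ac)
qed

section \<open>Terms of the determinant and their orbits\<close>

context cyclic_order
begin

text \<open>The factors \<open>T\<close> of the entries are merged into one power, since the carry
  of a single entry is not invariant under rotation but the total is: q permutes \<open>S\<close>,
  so N times the number of carries is the sum of the differences \<delta>.\<close>

definition perm_term :: "(nat \<Rightarrow> 'a fls) \<Rightarrow> nat set \<times> (nat \<Rightarrow> nat) \<Rightarrow> 'a fls" where
  "perm_term y x = of_int (sign (snd x)) * T ^ ((\<Sum>i\<in>fst x. \<delta> (snd x i) i) div N) *
     (\<Prod>i\<in>fst x. (g ^^ i) (y (\<delta> (snd x i) i)))"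

lemma partial_permsD:
  assumes "(S, q) \<in> partial_perms N"
  shows "finite S" "q permutes S" "i \<in> S \<Longrightarrow> i < N" "i \<in> S \<Longrightarrow> q i \<in> S" "i \<in> S \<Longrightarrow> q i < N"
  using assms permutes_in_image[of q S i] by (auto simp: partial_perms_def intro: finite_subset)

lemma perm_term_eq:
  assumes "(S, q) \<in> partial_perms N"
  shows "of_int (sign q) * (\<Prod>i\<in>S. rmat y $$ (i, q i)) = perm_term y (S, q)"
proof -
  note S = partial_permsD[OF assms]
  have "N * (\<Sum>i\<in>S. (i + \<delta> (q i) i) div N) + (\<Sum>i\<in>S. q i) = (\<Sum>i\<in>S. N * ((i + \<delta> (q i) i) div N) + q i)"
    by (simp add: sum.distrib sum_distrib_left)
  also have "\<dots> = (\<Sum>i\<in>S. i + \<delta> (q i) i)"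
  proof (rule sum.cong[OF refl])
    fix i assume i: "i \<in> S"
    have "(i + \<delta> (q i) i) mod N = q i" using S i by (intro add_mod_diff) (auto intro: less_imp_le)
    thus "N * ((i + \<delta> (q i) i) div N) + q i = i + \<delta> (q i) i"
      using mult_div_mod_eq[of N "i + \<delta> (q i) i"] by simp
  qed
  also have "\<dots> = (\<Sum>i\<in>S. i) + (\<Sum>i\<in>S. \<delta> (q i) i)" by (rule sum.distrib)
  also have "(\<Sum>i\<in>S. i) = (\<Sum>i\<in>S. q i)"
    using sum.permute[OF S(2), of "\<lambda>i. i"] by simp
  finally have e: "(\<Sum>i\<in>S. \<delta> (q i) i) = N * (\<Sum>i\<in>S. (i + \<delta> (q i) i) div N)" by simp
  have "(\<Prod>i\<in>S. rmat y $$ (i, q i)) = (\<Prod>i\<in>S. (g ^^ i) (y (\<delta> (q i) i)) * T ^ ((i + \<delta> (q i) i) div N))"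
    using S by (intro prod.cong) (auto simp: rmat_nth)
  also have "\<dots> = T ^ ((\<Sum>i\<in>S. \<delta> (q i) i) div N) * (\<Prod>i\<in>S. (g ^^ i) (y (\<delta> (q i) i)))"
    using N_pos by (simp add: e prod.distrib power_sum mult.commute)
  finally show ?thesis by (simp add: perm_term_def mult.assoc)
qed

lemma det_rmat_one_plus:
  "det (1\<^sub>m N + rmat y) = sum (perm_term y) (partial_perms N)"
proof -
  have "det (1\<^sub>m N + rmat y) = (\<Sum>S\<in>Pow {0..<N}. \<Sum>q\<in>{q. q permutes S}. perm_term y (S, q))"
    by (subst det_one_plus[OF rmat_carrier])
       (intro sum.cong refl perm_term_eq, auto simp: partial_perms_def)
  also have "\<dots> = sum (perm_term y) (partial_perms N)"
    unfolding partial_perms_def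
    by (subst sum.Sigma) (auto intro: finite_permutations finite_subset)
  finally show ?thesis .
qed

text \<open>Rotation raises the exponent of g in every factor by one and preserves the sign and the
  differences \<delta>. At the wrap-around the N-th iterate of g is the identity.\<close>

lemma perm_term_rot_act:
  assumes y: "\<And>j. y j \<in> B" and x: "x \<in> partial_perms N"
  shows "perm_term y (rot_act N x) = g (perm_term y x)"
proof -
  obtain S q where Sq: "x = (S, q)" by (cases x)
  note S = partial_permsD[OF x[unfolded Sq]]
  let ?q = "rot N \<circ> q \<circ> irot N"
  have inj: "inj_on (rot N) S" using rot_bij[of N] by (auto simp: bij_def inj_on_def)
  have q_rot: "?q (rot N i) = rot N (q i)" for i using rot_inv(2)[of N] by (simp add: fun_eq_iff)
  have d: "\<delta> (?q (rot N i)) (rot N i) = \<delta> (q i) i" if "i \<in> S" for i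
    using that S unfolding q_rot by (intro mod_diff_rot) auto
  have grot: "(g ^^ rot N i) b = g ((g ^^ i) b)" if "i \<in> S" "b \<in> B" for i b
    using giter_mod_N[OF B_subset_qB[OF that(2)], of "i + 1"] S that by (simp add: rot_def)
  have fB: "(g ^^ i) (y j) \<in> qB" for i j by (intro B_subset_qB giter_B y)
  have cA: "of_int (sign q) * T ^ n \<in> A" for n
    by (intro subring_mult subring_of_int is_subring_A T_pow_in_A)
  have "perm_term y (rot_act N x) = of_int (sign q) * T ^ ((\<Sum>i\<in>S. \<delta> (q i) i) div N) *
      (\<Prod>i\<in>S. g ((g ^^ i) (y (\<delta> (q i) i))))"
    using sign_rot_conj[OF S(2,1), of N]
    by (simp add: perm_term_def rot_act_def Sq sum.reindex[OF inj] prod.reindex[OF inj] d[simplified] grot y)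
  also have "\<dots> = (g ^^ 1) (perm_term y x)"
    unfolding perm_term_def Sq fst_conv snd_conv
    by (subst giter_mult, rule B_subset_qB[OF A_subset_B[OF cA]], rule qB_closed(8)[OF fB],
        subst giter_fixes_A[OF cA], subst giter_prod[OF fB]) simp
  finally show ?thesis by simp
qed

lemma perm_term_rot_act_funpow:
  assumes y: "\<And>j. y j \<in> B" and x: "x \<in> partial_perms N"
  shows "perm_term y ((rot_act N ^^ m) x) = (g ^^ m) (perm_term y x)"
proof (induction m)
  case (Suc m)
  have "(rot_act N ^^ m) x \<in> partial_perms N" by (induction m) (auto simp: x rot_act_closed)
  thus ?case using Suc perm_term_rot_act[OF y] by simp
qed simp

definition cyc_norm :: "'a fls \<Rightarrow> 'a fls" where
  "cyc_norm b = (\<Prod>i<N. (g ^^ i) b)"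

text \<open>The empty set gives 1. The rotation by j selects the coefficient y j in every row, so
  its product is a norm; there are j carries, and the sign is 1 because N is odd.\<close>

lemma sum_perm_term_fixed_points:
  "(\<Sum>x\<in>{x \<in> partial_perms N. rot_act N x = x}. perm_term y x) = 1 + (\<Sum>j<N. cyc_norm (y j) * T ^ j)"
proof -
  have oddN: "odd N" using odd_p by simp
  have inj: "inj_on (\<lambda>j. ({0..<N}, rot N ^^ j)) {..<N}"
  proof (rule inj_onI)
    fix a b assume ab: "a \<in> {..<N}" "b \<in> {..<N}" "({0..<N}, rot N ^^ a) = ({0..<N}, rot N ^^ b)"
    hence "(rot N ^^ a) 0 = (rot N ^^ b) 0" by simp
    thus "a = b" using ab by (simp add: rot_funpow)
  qed
  have t: "perm_term y ({0..<N}, rot N ^^ j) = cyc_norm (y j) * T ^ j" if j: "j < N" for j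
  proof -
    have d: "\<delta> ((rot N ^^ j) i) i = j" if "i < N" for i
      using that j by (intro mod_diff_unique) (auto simp: rot_funpow)
    have "(\<Sum>i\<in>{0..<N}. \<delta> ((rot N ^^ j) i) i) = N * j" by (simp add: d)
    thus ?thesis using N_pos
      by (simp add: perm_term_def cyc_norm_def sign_rot_funpow[OF oddN] d lessThan_atLeast0 mult.commute)
  qed
  have notin: "({}, id) \<notin> (\<lambda>j. ({0..<N}, rot N ^^ j)) ` {..<N}" using N_pos by auto
  show ?thesis
    unfolding rot_act_fixed_points[OF N_pos]
    by (subst sum.insert[OF _ notin]) (simp_all add: sum.reindex[OF inj] t, simp add: perm_term_def)
qed


section \<open>The elements 1 - \<zeta> between \<open>pi_r\<close> and \<open>Pi\<close>\<close>

lemma pi_r_eq: "pi_r = 1 - Z ^ N"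
  by (simp add: pi_r_def Z_pow_N flip: fls_minus_const)

lemma pi_r_in_A: "pi_r \<in> A" unfolding pi_r_eq
  by (intro subring_diff subring_one is_subring_A Z_pow_N_in_A)

lemma cyc_norm_Pi: "cyc_norm Pi = pi_r"
  using prod_giter_Pi[of 0] by (simp add: cyc_norm_def pi_r_eq)

lemma pi_r_nonzero: "pi_r \<noteq> 0"
proof
  assume "pi_r = 0"
  hence "Z ^ N = 1" by (simp add: pi_r_eq)
  hence "p ^ (r + s) \<le> p ^ s" using N_pos by (auto simp: Z_pow_one_iff intro: dvd_imp_le)
  thus False using r_pos p_gt_2 by simp
qed

lemma p_in_pi_r_power: "of_nat p \<in> (*) (pi_r ^ totient (p ^ r)) ` B"
proof -
  obtain y where y: "y \<in> cyc_ints r" "of_nat p = (1 - \<zeta> r) ^ totient (p ^ r) * y"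
    using one_minus_zeta_power_dvd_p[OF r_pos] by blast
  have "of_nat p = fls_const (of_nat p)" by (rule fls_of_nat)
  also have "\<dots> = pi_r ^ totient (p ^ r) * fls_const y"
    by (simp only: y(2) pi_r_def fls_const_power flip: fls_const_mult_const)
  finally show ?thesis using const_in_A[OF y(1)] A_subset_B by blast
qed

text \<open>For k \<le> s this is the constant 1 - \<open>\<zeta> (r + k)\<close>, the norm of
  \<open>Pi\<close> to the fixed field of \<open>g ^^ p ^ k\<close>; k = 0 gives \<open>pi_r\<close>
  and k = s gives \<open>Pi\<close>.\<close>

definition Pi_k :: "nat \<Rightarrow> 'a fls" where
  "Pi_k k = 1 - Z ^ p ^ (s - k)"

lemma Pi_k_in_B: "Pi_k k \<in> B"
  unfolding Pi_k_def by (intro B_closed(3,6,9) Z_in_B)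

lemma giter_Pi_k: "(g ^^ i) (Pi_k k) = 1 - (g ^^ i) Z ^ p ^ (s - k)"
  by (simp add: Pi_k_def giter_diff giter_power B_subset_qB B_closed(6,9) Z_in_B)

lemma giter_Pi_k_fixed: "k \<le> s \<Longrightarrow> (g ^^ (p ^ k)) (Pi_k k) = Pi_k k"
  using giter_Z_pow[of k 1] by (simp add: giter_Pi_k giter_power[symmetric] B_subset_qB Z_in_B) (simp add: Pi_k_def)

text \<open>\<open>pi_r\<close> is the product of the conjugates of \<open>Pi_k k\<close>, and all of them are associated.\<close>

lemma Pi_k_power:
  assumes k: "k \<le> s"
  obtains w where "w \<in> B" "Pi_k k ^ p ^ k = pi_r * w" "(g ^^ (p ^ k)) w = w"
proof -
  let ?M = "p ^ k" and ?h = "p ^ (s - k)"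
  have N: "N = ?h * ?M" using k by (simp flip: power_add)
  have PiB: "Pi \<in> qB" by (intro B_subset_qB Pi_in_B)
  have "pi_r = (\<Prod>m<?h. \<Prod>j\<in>{m * ?M..<m * ?M + ?M}. (g ^^ j) Pi)"
    unfolding cyc_norm_Pi[symmetric] cyc_norm_def N by (rule prod.nat_group[symmetric])
  also have "\<dots> = (\<Prod>m<?h. \<Prod>j<?M. (g ^^ j) ((g ^^ (?M * m)) Pi))"
  proof (rule prod.cong[OF refl])
    fix m
    show "(\<Prod>j\<in>{m * ?M..<m * ?M + ?M}. (g ^^ j) Pi) = (\<Prod>j<?M. (g ^^ j) ((g ^^ (?M * m)) Pi))"
      using prod.shift_bounds_nat_ivl[of "\<lambda>i. (g ^^ i) Pi" 0 "m * ?M" ?M]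
      by (simp add: lessThan_atLeast0 add.commute giter_funpow_add mult.commute)
  qed
  also have "\<dots> = (\<Prod>j<?M. (g ^^ j) (Pi_k k))"
    unfolding Pi_k_def prod_giter_Pi[OF k, symmetric]
    by (subst prod.swap) (simp add: giter_prod giter_mem PiB)
  finally have pr: "pi_r = (\<Prod>j<?M. (g ^^ j) (Pi_k k))" .
  have "\<exists>w\<in>B. Pi_k k = (g ^^ j) (Pi_k k) * w" if j: "j < ?M" for j
  proof -
    have "?M \<le> N" using k p_gt_2 by (intro power_increasing) auto
    hence "j \<le> N" using j by linarith
    \<comment> \<open>\<open>Z\<close> is in turn a power of its conjugate, which makes
      \<open>Pi_k k\<close> divisible by each of its own conjugates.\<close>
    have "Z = (g ^^ (N - j)) ((g ^^ j) Z)" using giter_N_Z \<open>j \<le> N\<close> by (simp add: giter_funpow_add)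
    also have "\<dots> = (g ^^ j) Z ^ (gexp ^ (N - j))"
      by (simp add: giter_Z giter_power B_subset_qB Z_in_B flip: power_mult) (simp add: mult.commute)
    finally have "Z ^ ?h = ((g ^^ j) Z ^ ?h) ^ (gexp ^ (N - j))"
      by (metis power_mult mult.commute)
    hence "Pi_k k = 1 - ((g ^^ j) Z ^ ?h) ^ (gexp ^ (N - j))" by (simp add: Pi_k_def)
    also have "\<dots> \<in> (*) (1 - (g ^^ j) Z ^ ?h) ` B"
      by (intro one_minus_power_mem is_subring_B B_closed(9) giter_B Z_in_B)
    finally show ?thesis by (auto simp: giter_Pi_k)
  qed
  then obtain w where w: "\<And>j. j < ?M \<Longrightarrow> w j \<in> B" "\<And>j. j < ?M \<Longrightarrow> Pi_k k = (g ^^ j) (Pi_k k) * w j"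
    by metis
  let ?w = "\<Prod>j<?M. w j"
  have wB: "?w \<in> B" using w(1) by (intro B_closed(8)) auto
  have "Pi_k k ^ ?M = (\<Prod>j<?M. Pi_k k)" by simp
  also have "\<dots> = (\<Prod>j<?M. (g ^^ j) (Pi_k k) * w j)" using w(2) by (intro prod.cong) auto
  also have "\<dots> = pi_r * ?w" by (simp add: prod.distrib pr)
  finally have e: "Pi_k k ^ ?M = pi_r * ?w" .
  \<comment> \<open>Both \<open>pi_r\<close> and \<open>Pi_k k\<close> are fixed by this iterate of
    g, hence so is the quotient.\<close>
  have "pi_r * (g ^^ ?M) ?w = (g ^^ ?M) (pi_r * ?w)"
    using wB by (simp add: giter_mult giter_fixes_A pi_r_in_A B_subset_qB A_subset_B)
  also have "\<dots> = pi_r * ?w"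
    unfolding e[symmetric] by (simp add: giter_power B_subset_qB Pi_k_in_B giter_Pi_k_fixed[OF k])
  finally have "(g ^^ ?M) ?w = ?w" using pi_r_nonzero by simp
  thus ?thesis using that wB e by blast
qed

text \<open>For k \<ge> 2 already 2 * totient (p ^ r) \<ge> p ^ r. For k = 1 put q = p ^ (r - 1), so
  that n div p < q. If n div p = q - 1, the right side is p ^ r - 1 and the hypothesis is just
  enough; smaller quotients leave room.\<close>

lemma totient_bound:
  assumes k: "k \<ge> 1" and n: "n + 1 < p ^ r"
  shows "n + 1 \<le> k * totient (p ^ r) + n div p ^ k"
proof -
  define q where "q = p ^ (r - 1)"
  have q: "p ^ r = p * q" using r_pos power_eq_if[of p r] unfolding q_def by auto
  have t: "totient (p ^ r) = q * (p - 1)" using r_pos prime_p by (simp add: totient_prime_power q_def)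
  obtain m where m: "p = m + 2" using p_gt_2 by (metis add.commute le_Suc_ex less_imp_le)
  show ?thesis
  proof (cases "k = 1")
    case True
    define d where "d = n div p"
    have n_eq: "n = p * d + n mod p" "n mod p < p" by (auto simp: d_def)
    have "p * d < p * q" using n_eq(1) n q by linarith
    hence "d < q" by simp
    then obtain e where e: "q = d + 1 + e" using less_iff_Suc_add[of d q] by auto
    show ?thesis
    proof (cases "e = 0")
      case True
      hence "p * q = q * (p - 1) + d + 1" using e by (simp add: m algebra_simps)
      thus ?thesis using n \<open>k = 1\<close> q t by (simp add: d_def)
    next
      case False
      then obtain e' where "e = e' + 1" by (cases e) auto
      hence "p * d + p \<le> q * (p - 1) + d" using e by (simp add: m algebra_simps)
      hence "n + 1 \<le> q * (p - 1) + d" using n_eq by linarith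
      thus ?thesis using \<open>k = 1\<close> t by (simp add: d_def)
    qed
  next
    case False
    hence "2 * totient (p ^ r) \<le> k * totient (p ^ r)" using k by (intro mult_right_mono) auto
    moreover have "p * q \<le> 2 * (q * (p - 1))" by (simp add: m algebra_simps)
    hence "p ^ r \<le> 2 * totient (p ^ r)" using q t by linarith
    ultimately show ?thesis using n by linarith
  qed
qed

lemma Phi_eq: assumes n: "n + 1 < p ^ r" shows "\<Phi> n = n"
  unfolding \<Phi>_def
proof (rule Least_equality)
  show "\<exists>k. n = k * totient (p ^ r) + n div p ^ k" by (intro exI[of _ 0]) simp
  fix m assume "\<exists>k. m = k * totient (p ^ r) + n div p ^ k"
  then obtain k where k: "m = k * totient (p ^ r) + n div p ^ k" by blast
  show "n \<le> m" using totient_bound[of k n] n k by (cases "k = 0") auto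
qed

text \<open>Division of n by p ^ k with remainder extracts pi_r ^ (n div p ^ k) from the power of
  \<open>Pi_k k\<close> and leaves an element of \<open>B\<close> fixed by
  \<open>g ^^ p ^ k\<close>. Its trace is divisible by p ^ k, hence by the power of
  \<open>pi_r\<close> with exponent k * totient (p ^ r).\<close>

lemma sum_giter_Pi_k_power:
  assumes k: "1 \<le> k" "k \<le> s" and n: "n + 1 < p ^ r" and b: "b \<in> B" "(g ^^ (p ^ k)) b = b"
  shows "(\<Sum>i<p ^ k. (g ^^ i) (Pi_k k ^ n * b)) \<in> (*) (pi_r ^ (n + 1)) ` B"
proof -
  let ?M = "p ^ k"
  obtain w where w: "w \<in> B" "Pi_k k ^ ?M = pi_r * w" "(g ^^ ?M) w = w" using Pi_k_power[OF k(2)] by blast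
  define a where "a = n div ?M"
  define b' where "b' = w ^ a * Pi_k k ^ (n mod ?M) * b"
  have b': "b' \<in> B" unfolding b'_def by (intro B_closed(1,9) w Pi_k_in_B b)
  have fixb': "(g ^^ ?M) b' = b'"
    by (simp add: b'_def giter_mult giter_power B_subset_qB B_closed(1,9) w Pi_k_in_B b giter_Pi_k_fixed[OF k(2)])
  have "Pi_k k ^ n = (Pi_k k ^ ?M) ^ a * Pi_k k ^ (n mod ?M)"
    by (simp add: a_def flip: power_mult power_add)
  hence eq: "Pi_k k ^ n * b = pi_r ^ a * b'" by (simp add: w(2) b'_def power_mult_distrib mult_ac)
  have piA: "pi_r ^ a \<in> A" by (intro subring_power is_subring_A pi_r_in_A)
  have "(\<Sum>i<?M. (g ^^ i) (Pi_k k ^ n * b)) = pi_r ^ a * (\<Sum>i<?M. (g ^^ i) b')"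
    unfolding eq using b' piA
    by (simp add: giter_mult B_subset_qB A_subset_B giter_fixes_A sum_distrib_left)
  moreover have "(\<Sum>i<?M. (g ^^ i) b') \<in> (*) ((pi_r ^ totient (p ^ r)) ^ k) ` B"
  proof -
    obtain c where c: "c \<in> A" "(\<Sum>i<?M. (g ^^ i) b') = of_nat ?M * c"
      using partial_trace_B[OF b' k(2) fixb'] by blast
    have "of_nat ?M \<in> (*) ((pi_r ^ totient (p ^ r)) ^ k) ` B"
      using principal_mem_power[OF is_subring_B p_in_pi_r_power, of k] by simp
    thus ?thesis unfolding c(2) using B_closed(1)[OF _ A_subset_B[OF c(1)]] by (auto simp: mult.assoc)
  qed
  ultimately obtain c where c: "c \<in> B"
      "(\<Sum>i<?M. (g ^^ i) (Pi_k k ^ n * b)) = pi_r ^ (a + k * totient (p ^ r)) * c"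
    by (auto simp: power_add mult.assoc mult.commute[of k] power_mult)
  have "a + k * totient (p ^ r) = (n + 1) + (a + k * totient (p ^ r) - (n + 1))"
    using totient_bound[OF k(1) n] by (simp add: a_def)
  hence "pi_r ^ (a + k * totient (p ^ r)) = pi_r ^ (n + 1) * pi_r ^ (a + k * totient (p ^ r) - (n + 1))"
    by (metis power_add)
  hence "(\<Sum>i<?M. (g ^^ i) (Pi_k k ^ n * b)) = pi_r ^ (n + 1) * (pi_r ^ (a + k * totient (p ^ r) - (n + 1)) * c)"
    by (simp only: c(2) mult.assoc)
  moreover have "pi_r ^ (a + k * totient (p ^ r) - (n + 1)) * c \<in> B"
    by (intro B_closed(1,9) A_subset_B pi_r_in_A c)
  ultimately show ?thesis by blast
qed

text \<open>Invariance under rotation by p ^ k makes \<open>S\<close> a union of translates of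
  \<open>S0\<close> by multiples of p ^ k, along which the differences \<delta> repeat. The product
  over \<open>S\<close> is therefore the norm, to the fixed field of \<open>g ^^ p ^ k\<close>, of
  the product over \<open>S0\<close>.\<close>

lemma perm_term_periodic:
  assumes x: "\<And>j. x j \<in> B" and X: "X \<in> partial_perms N" "fst X \<noteq> {}"
    and k: "k \<le> s" and per: "(rot_act N ^^ (p ^ k)) X = X"
  obtains b where "b \<in> B" "(g ^^ (p ^ k)) b = b" "perm_term (\<lambda>j. Pi ^ n * x j) X = Pi_k k ^ n * b"
proof -
  obtain S q where Sq: "X = (S, q)" by (cases X)
  note S = partial_permsD[OF X(1)[unfolded Sq]]
  let ?M = "p ^ k" and ?h = "p ^ (s - k)"
  have N: "N = ?M * ?h" using k by (simp flip: power_add)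
  have M: "?M > 0" and h: "?h > 0" by simp_all
  have perm: "(rot_act N ^^ (m * ?M)) (S, q) = (S, q)" for m
    using per by (induction m) (auto simp: Sq funpow_add)
  note fixed = rot_act_fixed[OF perm]
  define S0 where "S0 = {i \<in> S. i < ?M}"
  define e where "e i = \<delta> (q i) i" for i
  have shift: "(i + m * ?M) mod N \<in> S \<and> e ((i + m * ?M) mod N) = e i" if i: "i \<in> S" for i m
  proof
    have r: "(rot N ^^ (m * ?M)) i = (i + m * ?M) mod N" "(rot N ^^ (m * ?M)) (q i) = (q i + m * ?M) mod N"
      using S i by (auto simp: rot_funpow)
    show "(i + m * ?M) mod N \<in> S" using fixed(1)[OF i, of m] r by simp
    have q: "q ((i + m * ?M) mod N) = (q i + m * ?M) mod N" using fixed(2)[OF i, of m] r by simp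
    have "\<delta> ((q i + m * ?M) mod N) ((i + m * ?M) mod N) = \<delta> (q i) i"
    proof (rule mod_diff_unique)
      have "(i + \<delta> (q i) i) mod N = q i" using S i by (intro add_mod_diff) (auto intro: less_imp_le)
      hence e: "(i + \<delta> (q i) i + m * ?M) mod N = (q i + m * ?M) mod N" by (metis mod_add_left_eq)
      have "((i + m * ?M) mod N + \<delta> (q i) i) mod N = (i + m * ?M + \<delta> (q i) i) mod N"
        by (rule mod_add_left_eq)
      also have "i + m * ?M + \<delta> (q i) i = i + \<delta> (q i) i + m * ?M" by simp
      finally show "((i + m * ?M) mod N + \<delta> (q i) i) mod N = ((q i + m * ?M) mod N) mod N"
        by (simp only: e mod_mod_trivial)
    qed (use N_pos in \<open>auto simp: mod_diff_less intro: less_imp_le\<close>)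
    thus "e ((i + m * ?M) mod N) = e i" by (simp add: e_def q)
  qed
  define f where "f y i = (g ^^ i) (y (e i))" for y :: "nat \<Rightarrow> 'a fls" and i
  have bij: "bij_betw (\<lambda>(i, m). i + m * ?M) (S0 \<times> {..<?h}) S"
  proof (rule bij_betwI)
    show "(\<lambda>(i, m). i + m * ?M) \<in> S0 \<times> {..<?h} \<rightarrow> S"
    proof clarsimp
      fix i m assume im: "i \<in> S0" "m < ?h"
      have "i + m * ?M < ?M + m * ?M" using im by (simp add: S0_def)
      also have "\<dots> = (m + 1) * ?M" by simp
      also have "\<dots> \<le> ?h * ?M" using im by (intro mult_right_mono) auto
      finally have "i + m * ?M < N" by (simp add: N mult.commute)
      thus "i + m * ?M \<in> S" using shift[of i m] im by (simp add: S0_def)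
    qed
    show "(\<lambda>i. (i mod ?M, i div ?M)) \<in> S \<rightarrow> S0 \<times> {..<?h}"
    proof
      fix i assume i: "i \<in> S"
      have iN: "i < N" using S i by auto
      hence dh: "i div ?M < ?h" by (simp add: N less_mult_imp_div_less mult.commute)
      \<comment> \<open>The available translations only go forward: this many steps of length p ^ k
        pass N once and end at the remainder of i.\<close>
      have "i + (?h - i div ?M) * ?M = i mod ?M + i div ?M * ?M + (?h - i div ?M) * ?M"
        by (simp only: mod_div_mult_eq)
      also have "\<dots> = i mod ?M + (i div ?M + (?h - i div ?M)) * ?M" by (simp only: distrib_right add.assoc)
      also have "\<dots> = i mod ?M + N" using dh by (simp add: N mult.commute)
      finally have "(i + (?h - i div ?M) * ?M) mod N = i mod ?M mod N" by simp
      moreover have "i mod ?M < N" using iN mod_less_eq_dividend[of i ?M] by linarith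
      ultimately have "i mod ?M \<in> S" using shift[OF i, of "?h - i div ?M"] by simp
      thus "(i mod ?M, i div ?M) \<in> S0 \<times> {..<?h}" using dh by (simp add: S0_def)
    qed
  qed (auto simp: S0_def intro: mod_div_mult_eq)
  have finS0: "finite S0" using S by (simp add: S0_def)
  have prod_f: "(\<Prod>i\<in>S. f y i) = (\<Prod>m<?h. (g ^^ (?M * m)) (\<Prod>i\<in>S0. f y i))"
    if y: "\<And>j. y j \<in> B" for y
  proof -
    have "(\<Prod>i\<in>S. f y i) = (\<Prod>(i, m)\<in>S0 \<times> {..<?h}. f y (i + m * ?M))"
      by (subst prod.reindex_bij_betw[OF bij, symmetric]) (simp add: case_prod_unfold)
    also have "\<dots> = (\<Prod>(i, m)\<in>S0 \<times> {..<?h}. (g ^^ (?M * m)) (f y i))"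
    proof (rule prod.cong[OF refl], unfold case_prod_unfold)
      fix im assume "im \<in> S0 \<times> {..<?h}"
      moreover define i m where "i = fst im" and "m = snd im"
      ultimately have im: "i \<in> S0" "m \<in> {..<?h}" by auto
      hence "i + m * ?M \<in> S" using bij_betwE[OF bij] by auto
      hence "e (i + m * ?M) = e i" using shift[of i m] im S by (simp add: S0_def)
      hence "f y (i + m * ?M) = (g ^^ (?M * m)) (f y i)"
        by (simp add: f_def giter_funpow_add add.commute mult.commute)
      thus "f y (fst im + snd im * ?M) = (g ^^ (?M * snd im)) (f y (fst im))"
        by (simp only: i_def m_def)
    qed
    also have "\<dots> = (\<Prod>i\<in>S0. \<Prod>m<?h. (g ^^ (?M * m)) (f y i))" by (rule prod.cartesian_product[symmetric])
    also have "\<dots> = (\<Prod>m<?h. \<Prod>i\<in>S0. (g ^^ (?M * m)) (f y i))" by (rule prod.swap)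
    also have "\<dots> = (\<Prod>m<?h. (g ^^ (?M * m)) (\<Prod>i\<in>S0. f y i))"
      using y by (subst giter_prod) (auto simp: f_def intro: B_subset_qB giter_B)
    finally show ?thesis .
  qed
  \<comment> \<open>One index is enough: its factor supplies Pi ^ n, because every conjugate of
    \<open>Pi\<close> is divisible by \<open>Pi\<close>, and the other factors lie in
    \<open>B\<close>.\<close>
  obtain i0 where i0: "i0 \<in> S0"
    using X(2) bij_betw_imp_surj_on[OF bij] by (auto simp: Sq)
  let ?y = "\<lambda>j. Pi ^ n * x j"
  have yB: "?y j \<in> B" for j by (intro B_closed(1,9) Pi_in_B x)
  have fB: "f y i \<in> B" if "\<And>j. y j \<in> B" for y i unfolding f_def by (intro giter_B that)
  have "(\<Prod>i\<in>S0. f ?y i) \<in> (*) (Pi ^ n) ` B"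
  proof -
    obtain w where w: "w \<in> B" "(g ^^ i0) Pi = Pi * w"
    proof -
      have "(g ^^ i0) Pi - Pi + Pi \<in> (*) Pi ` B"
        by (intro ideal_add[OF Pi_ideal] giter_cong Pi_in_B principal_mem_self is_subring_B)
      thus ?thesis using that by auto
    qed
    have "f ?y i0 = Pi ^ n * (w ^ n * (g ^^ i0) (x (e i0)))"
      by (simp add: f_def giter_mult giter_power B_subset_qB B_closed(9) Pi_in_B x w power_mult_distrib mult.assoc)
    hence "(\<Prod>i\<in>S0. f ?y i) = Pi ^ n * (w ^ n * (g ^^ i0) (x (e i0)) * (\<Prod>i\<in>S0 - {i0}. f ?y i))"
      using prod.remove[OF finS0 i0, of "f ?y"] by (simp add: mult.assoc)
    moreover have "w ^ n * (g ^^ i0) (x (e i0)) * (\<Prod>i\<in>S0 - {i0}. f ?y i) \<in> B"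
      by (intro B_closed(1,8,9) w giter_B x fB yB)
    ultimately show ?thesis by blast
  qed
  then obtain z where z: "z \<in> B" "(\<Prod>i\<in>S0. f ?y i) = Pi ^ n * z" by blast
  define b0 where "b0 = (\<Prod>m<?h. (g ^^ (?M * m)) z)"
  have b0: "b0 \<in> B" unfolding b0_def by (intro B_closed(8) giter_B z)
  have "(\<Prod>i\<in>S. f ?y i) = (\<Prod>m<?h. (g ^^ (?M * m)) Pi ^ n * (g ^^ (?M * m)) z)"
    using z(1) by (simp add: prod_f[OF yB] z(2) giter_mult giter_power B_subset_qB B_closed(9) Pi_in_B)
  also have "\<dots> = Pi_k k ^ n * b0"
    by (simp add: prod.distrib prod_power_distrib[symmetric] prod_giter_Pi[OF k] Pi_k_def b0_def)
  finally have pS: "(\<Prod>i\<in>S. f ?y i) = Pi_k k ^ n * b0" .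
  have fixb0: "(g ^^ ?M) b0 = b0"
  proof -
    have per: "(g ^^ (?M * ?h)) z = z" using giter_N_B[OF z(1)] by (simp only: N)
    have "(g ^^ ?M) b0 = (\<Prod>m<?h. (g ^^ (?M * Suc m)) z)"
      unfolding b0_def using z(1) by (subst giter_prod) (auto simp: giter_funpow_add B_subset_qB giter_B)
    \<comment> \<open>The factors are permuted cyclically: the last one, where the exponent of g
      reaches N, is the one with exponent 0.\<close>
    also have "\<dots> = b0"
    proof -
      obtain h' where h': "?h = Suc h'" using h by (metis gr0_conv_Suc)
      have "(\<Prod>m<Suc h'. (g ^^ (?M * Suc m)) z) = (\<Prod>m<h'. (g ^^ (?M * Suc m)) z) * (g ^^ (?M * Suc h')) z"
        by (rule prod.lessThan_Suc)
      also have "(g ^^ (?M * Suc h')) z = (g ^^ (?M * 0)) z" using per by (simp only: h') simp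
      also have "(\<Prod>m<h'. (g ^^ (?M * Suc m)) z) * (g ^^ (?M * 0)) z = (\<Prod>m<Suc h'. (g ^^ (?M * m)) z)"
        by (subst prod.lessThan_Suc_shift) (rule mult.commute)
      finally show ?thesis by (simp only: b0_def h')
    qed
    finally show ?thesis .
  qed
  define c where "c = of_int (sign q) * T ^ ((\<Sum>i\<in>S. \<delta> (q i) i) div N)"
  have cA: "c \<in> A" unfolding c_def by (intro subring_mult subring_of_int is_subring_A T_pow_in_A)
  have "perm_term ?y X = c * (Pi_k k ^ n * b0)"
    unfolding pS[symmetric] by (simp add: perm_term_def Sq c_def f_def e_def)
  hence "perm_term ?y X = Pi_k k ^ n * (c * b0)" by (simp only: mult_ac)
  moreover have "c * b0 \<in> B" by (rule B_closed(1)[OF A_subset_B[OF cA] b0])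
  moreover have "(g ^^ ?M) (c * b0) = c * b0"
    using cA b0 fixb0 by (simp add: giter_mult giter_fixes_A B_subset_qB A_subset_B)
  ultimately show ?thesis using that by blast
qed

text \<open>Orbits of length greater than 1 vanish modulo pi_r ^ (n + 1). In the fixed terms pi_r ^
  n comes out because \<open>pi_r\<close> is the norm of \<open>Pi\<close>.\<close>

lemma det_rmat_one_plus_cong:
  assumes x: "\<And>j. x j \<in> B" and n: "n + 1 < p ^ r"
  shows "det (1\<^sub>m N + rmat (\<lambda>j. Pi ^ n * x j)) - (1 + pi_r ^ n * (\<Sum>j<N. cyc_norm (x j) * T ^ j))
    \<in> (*) (pi_r ^ (n + 1)) ` B"
proof -
  let ?y = "\<lambda>j. Pi ^ n * x j"
  have yB: "?y j \<in> B" for j by (intro B_closed(1,9) Pi_in_B x)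
  have I: "is_ideal B ((*) (pi_r ^ (n + 1)) ` B)"
    by (intro is_ideal_principal is_subring_B B_closed(9) A_subset_B pi_r_in_A)
  have "sum (perm_term ?y) (partial_perms N)
      - (\<Sum>X\<in>{X \<in> partial_perms N. rot_act N X = X}. perm_term ?y X) \<in> (*) (pi_r ^ (n + 1)) ` B"
  proof (rule cyclic_orbit_sum[OF I prime_p finite_partial_perms rot_act_closed rot_act_period])
    fix X k assume X: "X \<in> partial_perms N" "rot_act N X \<noteq> X" "1 \<le> k" "k \<le> s" "(rot_act N ^^ p ^ k) X = X"
    \<comment> \<open>The only permutation of the empty set is the identity, and this pair is a
      fixed point.\<close>
    have "fst X \<noteq> {}"
    proof
      assume "fst X = {}"
      hence "X = ({}, id)" using X(1) by (auto simp: partial_perms_def)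
      thus False using X(2) rot_act_fixed_points[OF N_pos] by auto
    qed
    then obtain b where b: "b \<in> B" "(g ^^ (p ^ k)) b = b" "perm_term ?y X = Pi_k k ^ n * b"
      by (rule perm_term_periodic[OF x X(1) _ X(4,5)])
    show "(\<Sum>i<p ^ k. perm_term ?y ((rot_act N ^^ i) X)) \<in> (*) (pi_r ^ (n + 1)) ` B"
      unfolding perm_term_rot_act_funpow[OF yB X(1)] b(3)
      by (rule sum_giter_Pi_k_power[OF X(3,4) n b(1,2)])
  qed
  moreover have "cyc_norm (?y j) = pi_r ^ n * cyc_norm (x j)" for j
  proof -
    have "cyc_norm (?y j) = (\<Prod>i<N. (g ^^ i) Pi ^ n * (g ^^ i) (x j))"
      by (simp add: cyc_norm_def giter_mult giter_power B_subset_qB B_closed(9) Pi_in_B x)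
    also have "\<dots> = cyc_norm Pi ^ n * cyc_norm (x j)"
      by (simp only: cyc_norm_def prod.distrib prod_power_distrib)
    finally show ?thesis by (simp only: cyc_norm_Pi)
  qed
  ultimately show ?thesis
    unfolding det_rmat_one_plus sum_perm_term_fixed_points by (simp add: sum_distrib_left mult.assoc)
qed


section \<open>Levels\<close>

lemma DeltaD: "x \<in> Delta \<Longrightarrow> x j \<in> B" "x \<in> Delta \<Longrightarrow> j \<ge> N \<Longrightarrow> x j = 0" "x \<in> Delta \<Longrightarrow> x \<in> carrier D"
  by (cases "j < N"; auto simp: Delta_def carrier_D B_closed B_subset_qB)+

lemma scalar_Pi_pow: "scalar Pi [^]\<^bsub>D\<^esub> k = scalar (Pi ^ k)"
proof (induction k)
  case 0
  show ?case by (simp add: nat_pow_def one_D)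
next
  case (Suc k)
  have "scalar Pi [^]\<^bsub>D\<^esub> Suc k = scalar (Pi ^ k) \<otimes>\<^bsub>D\<^esub> scalar Pi"
    using Suc by (simp add: nat_pow_def)
  also have "\<dots> = (\<lambda>j. Pi ^ k * scalar Pi j)"
    by (rule scalar_mult[OF scalar_carrier[OF B_subset_qB[OF Pi_in_B]]])
  also have "\<dots> = scalar (Pi ^ Suc k)" by (auto simp: scalar_def mult.commute)
  finally show ?case .
qed

lemma one_plus_eq: "one_plus k = {\<lambda>j. scalar 1 j + Pi ^ k * x j | x. x \<in> Delta}"
  unfolding one_plus_def one_D scalar_Pi_pow
  by (intro Collect_cong ex_cong1) (auto simp: add_D scalar_mult DeltaD(3))

lemma one_plus_mono:
  assumes "d \<in> one_plus m" "k \<le> m" shows "d \<in> one_plus k"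
proof -
  obtain x where x: "d = (\<lambda>j. scalar 1 j + Pi ^ m * x j)" "x \<in> Delta" using assms(1) by (auto simp: one_plus_eq)
  have "Pi ^ m = Pi ^ k * Pi ^ (m - k)" using assms(2) by (simp flip: power_add)
  hence "d = (\<lambda>j. scalar 1 j + Pi ^ k * (Pi ^ (m - k) * x j))" by (simp add: x(1) mult.assoc)
  moreover have "(\<lambda>j. Pi ^ (m - k) * x j) \<in> Delta"
    using x(2) by (auto simp: Delta_def B_closed Pi_in_B)
  ultimately show ?thesis by (auto simp: one_plus_eq)
qed

lemma scalar_ge_N: "j \<ge> N \<Longrightarrow> scalar b j = 0"
  by (cases "j = 0") (auto simp: scalar_def)

lemma scalar_in_Delta: "b \<in> B \<Longrightarrow> scalar b \<in> Delta"
  by (auto simp: Delta_def scalar_ge_N) (simp add: scalar_def B_closed(5))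

text \<open>The exponent 0 imposes no further condition, which provides the start of the induction
  for reduced norm 1.\<close>

lemma Delta_subset_one_plus_0: "d \<in> Delta \<Longrightarrow> d \<in> one_plus 0"
  unfolding one_plus_eq
  using DeltaD(1)[OF scalar_in_Delta[OF B_closed(6)]]
  by (auto intro!: exI[of _ "\<lambda>j. d j - scalar 1 j"] simp: Delta_def scalar_ge_N B_closed(3))

lemma cyc_norm_cong: assumes "b \<in> B" shows "cyc_norm b - b ^ N \<in> (*) Pi ` B"
  using ideal_prod_diff[OF Pi_ideal, of "{..<N}" "\<lambda>i. (g ^^ i) b" "\<lambda>_. b"] assms
  by (simp add: cyc_norm_def giter_B giter_cong)

text \<open>Two expressions for \<open>nr d\<close> are compared. Cancelling pi_r ^ n leaves the sum
  of the norms divisible by \<open>pi_r\<close>, hence by \<open>Pi\<close>, where norms may be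
  replaced by N-th powers since g acts trivially modulo \<open>Pi\<close>.\<close>

lemma one_plus_Suc:
  assumes d: "d \<in> one_plus n" and n: "n + 1 < p ^ r"
    and nr: "b \<in> B" "nr d = 1 + pi_r ^ (n + 1) * b"
  shows "d \<in> one_plus (n + 1)"
proof -
  obtain x where x: "d = (\<lambda>j. scalar 1 j + Pi ^ n * x j)" "x \<in> Delta"
    using d by (auto simp: one_plus_eq)
  let ?y = "\<lambda>j. Pi ^ n * x j" and ?S = "\<Sum>j<N. cyc_norm (x j) * T ^ j"
  have y: "?y \<in> Delta" using x(2) by (auto simp: Delta_def B_closed Pi_in_B)
  have xB: "x j \<in> B" for j by (rule DeltaD(1)[OF x(2)])
  have one: "scalar 1 \<in> Delta" by (rule scalar_in_Delta[OF B_closed(6)])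
  have dD: "d \<in> carrier D" "d j \<in> B" for j
    using DeltaD(1)[OF y] DeltaD(1)[OF one] DeltaD(2)[OF y] DeltaD(2)[OF one]
    by (auto simp: x(1) carrier_D intro!: B_closed(2) B_subset_qB)
  have "d = \<one>\<^bsub>D\<^esub> \<oplus>\<^bsub>D\<^esub> ?y" by (simp add: x(1) one_D add_D)
  hence "rmat d = 1\<^sub>m N + rmat ?y"
    using splitting_rmat DeltaD(3)[OF y] DeltaD(3)[OF one, folded one_D]
    unfolding splitting_def ring_hom_def by (auto simp: ring_mat_simps)
  hence "nr d = det (1\<^sub>m N + rmat ?y)" using nr_eq_det_rmat[OF dD] by simp
  then obtain c where c: "c \<in> B" "nr d - (1 + pi_r ^ n * ?S) = pi_r ^ (n + 1) * c"
    using det_rmat_one_plus_cong[of x n, OF xB n] by auto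
  hence "pi_r ^ n * ?S = pi_r ^ n * (pi_r * (b - c))" by (simp add: nr(2) algebra_simps)
  hence S: "?S = pi_r * (b - c)" using pi_r_nonzero by simp
  have pi: "pi_r \<in> (*) Pi ` B"
    unfolding pi_r_eq Pi_eq by (rule one_minus_power_mem[OF is_subring_B Z_in_B])
  have TB: "T ^ j \<in> B" for j by (rule A_subset_B[OF T_pow_in_A])
  have "(\<Sum>j<N. x j ^ N * T ^ j) = ?S - (\<Sum>j<N. (cyc_norm (x j) - x j ^ N) * T ^ j)"
    by (simp add: left_diff_distrib sum_subtractf)
  also have "\<dots> \<in> (*) Pi ` B"
    unfolding S
    by (intro ideal_diff[OF Pi_ideal] ideal_sum[OF Pi_ideal] ideal_rmult[OF Pi_ideal] cyc_norm_cong pi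
        xB TB B_closed(3) nr c)
  finally have "x j \<in> (*) Pi ` B" if "j < N" for j
    using Pi_dvd_if_Pi_dvd_frobenius_sum[of x, OF xB _ that] by blast
  hence "\<forall>j. \<exists>w\<in>B. j < N \<longrightarrow> x j = Pi * w" using B_closed(5) by blast
  then obtain w where w: "\<And>j. w j \<in> B" "\<And>j. j < N \<Longrightarrow> x j = Pi * w j" by metis
  \<comment> \<open>\<open>Delta\<close> demands zero coefficients from N on, so the quotients are
    cut off there.\<close>
  define x' where "x' j = (if j < N then w j else 0)" for j
  have "x j = Pi * x' j" for j using w(2) DeltaD(2)[OF x(2)] by (auto simp: x'_def)
  hence "d = (\<lambda>j. scalar 1 j + Pi ^ (n + 1) * x' j)" by (simp add: x(1) mult_ac)
  moreover have "x' \<in> Delta" using w(1) by (auto simp: Delta_def x'_def)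
  ultimately show ?thesis by (auto simp: one_plus_eq)
qed

lemma one_plus_if_nr_one:
  assumes d: "d \<in> Delta" and nr: "nr d = 1" and n: "n < p ^ r"
  shows "d \<in> one_plus n"
  using n
proof (induction n)
  case 0
  show ?case by (rule Delta_subset_one_plus_0[OF d])
next
  case (Suc n)
  thus ?case using one_plus_Suc[of d n 0] nr B_closed(5) by simp
qed

text \<open>The admissible k are bounded by the finite supremum, so they form a finite set and the
  supremum is attained.\<close>

lemma has_level_finiteD:
  assumes "has_level d (enat n)"
  shows "d \<in> one_plus n" "d \<notin> one_plus (n + 1)"
proof -
  let ?K = "{enat k | k. 1 \<le> k \<and> d \<in> one_plus k}"
  have K: "d \<in> one_plus 1" "enat n = Sup ?K" using assms by (auto simp: has_level_def)
  hence "enat 1 \<in> ?K" by blast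
  hence ne: "?K \<noteq> {}" by blast
  have "finite ?K"
  proof (rule finite_enat_bounded)
    show "y \<le> enat n" if "y \<in> ?K" for y unfolding K(2) using that by (rule Sup_upper)
  qed
  note fin = this
  have "Sup ?K = Max ?K" unfolding Sup_enat_def by (simp only: fin ne if_True if_False)
  hence "Sup ?K \<in> ?K" using Max_in[OF fin ne] by (simp only:)
  thus "d \<in> one_plus n" unfolding K(2)[symmetric] by simp
  show "d \<notin> one_plus (n + 1)"
  proof
    assume "d \<in> one_plus (n + 1)"
    hence "enat (n + 1) \<le> Sup ?K" by (intro Sup_upper) auto
    thus False unfolding K(2)[symmetric] by simp
  qed
qed

text \<open>For \<open>nr d = 1\<close> no level is given at the outset: membership is built up from
  the exponent 0, and the resulting level may be infinite. In the other case
  \<open>\<Phi> n = n\<close> whenever n + 1 < p ^ r, and then the level n could be raised to n +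
  1.\<close>

lemma level_bound:
  assumes d: "d \<in> Delta_units"
    and nr: "nr d = 1 \<or> (\<exists>n. has_level d (enat n) \<and> (\<exists>a\<in>A. nr d = 1 + pi_r ^ (\<Phi> n + 1) * a))"
  shows "\<exists>n. has_level d n \<and> enat (p ^ r - 1) \<le> n"
  using nr
proof (elim disjE exE conjE bexE)
  assume "nr d = 1"
  moreover have "d \<in> Delta" using d by (auto simp: Delta_units_def Units_def)
  moreover have "p ^ r - 1 < p ^ r" by simp
  ultimately have l: "d \<in> one_plus (p ^ r - 1)" by (intro one_plus_if_nr_one)
  \<comment> \<open>\<open>has_level\<close> includes membership for the exponent 1, which follows
    by monotonicity once p ^ r - 1 \<ge> 1.\<close>
  have "p ^ 1 \<le> p ^ r" using r_pos p_gt_2 by (intro power_increasing) auto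
  hence q: "1 \<le> p ^ r - 1" using p_gt_2 by simp
  have "has_level d (Sup {enat k | k. 1 \<le> k \<and> d \<in> one_plus k})"
    using one_plus_mono[OF l q] by (simp add: has_level_def)
  moreover have "enat (p ^ r - 1) \<le> Sup {enat k | k. 1 \<le> k \<and> d \<in> one_plus k}"
    using l q by (intro Sup_upper) blast
  ultimately show ?thesis by blast
next
  fix n a assume n: "has_level d (enat n)" "a \<in> A" "nr d = 1 + pi_r ^ (\<Phi> n + 1) * a"
  have "\<not> n + 1 < p ^ r"
  proof
    assume less: "n + 1 < p ^ r"
    have "d \<in> one_plus (n + 1)"
      using n(3) has_level_finiteD(1)[OF n(1)]
      by (intro one_plus_Suc[OF _ less A_subset_B[OF n(2)]]) (simp_all add: Phi_eq[OF less])
    thus False using has_level_finiteD(2)[OF n(1)] by blast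
  qed
  hence "enat (p ^ r - 1) \<le> enat n" by simp
  thus ?thesis using n(1) by blast
qed

end
theorem mainTheorem4:
  fixes p r s :: nat and v :: "'a::field_char_0 \<Rightarrow> real" and Qp F :: "'a set"
    and \<zeta> :: "nat \<Rightarrow> 'a" and g :: "'a fls \<Rightarrow> 'a fls" and d :: "nat \<Rightarrow> 'a fls"
  assumes "cyclic_order p v Qp F r s \<zeta> g"
    and "d \<in> cyclic_order.Delta_units p v Qp F r s \<zeta> g"
    and "cyclic_order.nr p v Qp F r s \<zeta> g d = 1 \<or>
         (\<exists>n. cyclic_order.has_level p v Qp F r s \<zeta> g d (enat n) \<and>
              (\<exists>a \<in> cyclotomic_tower.A v Qp F r \<zeta>.
                 cyclic_order.nr p v Qp F r s \<zeta> g d =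
                   1 + cyclotomic_tower.pi_r r \<zeta> ^ (cyclotomic_tower.\<Phi> p r n + 1) * a))"
  shows "\<exists>n. cyclic_order.has_level p v Qp F r s \<zeta> g d n \<and> enat (p ^ r - 1) \<le> n"
proof -
  interpret cyclic_order p v Qp F r s \<zeta> g by (rule assms(1))
  show ?thesis using assms(2,3) by (rule level_bound)
qed

end
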